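(* Let $\mathbf{A}=\mathbb{F}_r[T]$ and let $E$ be a uniformizable $T$-module of dimension $t$ defined over $C_\infty$. Then the $T$-action of $E$ extends uniquely to an injection of $\mathbb{F}_r$-algebras $\lambda\mapsto E_\lambda$ from $\mathbf{K}^{\mathrm{sep}}$ into the algebra of multi-valued operators on $E$ such that, for every $\lambda\in\mathbf{K}^{\mathrm{sep}}$, the induced action $E_{\lambda,\ast}$ on the tangent space at the origin has the form $$E_{\lambda,\ast}=\overline{\lambda}\cdot\mathbf{1}+N_\lambda$$ where $N_\lambda$ is a nilpotent $t\times t$ matrix.
   Context: Let $r$ be a power of a prime $p$, $\mathbf{A}=\mathbb{F}_r[T]$, $\mathbf{k}=\mathbb{F}_r(T)$, $\mathbf{K}=\mathbf{k}_\infty=\mathbb{F}_r((1/T))$, $\mathbf{C}_\infty$ the completion of an algebraic closure of $\mathbf{K}$, and $\mathbf{K}^{\mathrm{sep}}\subset\mathbf{C}_\infty$ the separable closure of $\mathbf{K}$. These are "operators". A second, isomorphic copy ("scalars") is denoted by non-bold letters $A,k,K,C_\infty$, with canonical isomorphism $\alpha\mapsto\overline{\alpha}=\theta(\alpha)$, $\mathbf{C}_\infty\to C_\infty$; write $\theta=\overline{T}$. A $T$-module $E$ of dimension $t$ over $C_\infty$ is, after choosing coordinates identifying the underlying algebraic group with $\mathbb{G}_a^t$, an $\mathbb{F}_r$-algebra homomorphism $a\mapsto E_a$ from $\mathbf{A}$ to the $\mathbb{F}_r$-linear algebraic endomorphisms of $\mathbb{G}_a^t$ (polynomials $\sum a_i\tau^i$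 with $a_i$ in the $t\times t$ matrices over $C_\infty$, $\tau$ being the $r$-th power map on each coordinate) such that the tangent action (the coefficient of $\tau^0$) of $E_T$ is $E_{T,\ast}=\theta\cdot\mathbf{1}+N_T$ with $N_T$ nilpotent. Its exponential $e(\tau)=\sum_i c_i\tau^i$, $c_0=\mathbf{1}$, is the $\mathbb{F}_r$-linear entire function satisfying $e(E_{a,\ast}\mathbf{z})=E_a(e(\mathbf{z}))$ for $a \in \mathbf{A}$, and $\log(\tau)$ is its formal inverse under composition. $E$ is uniformizable if $e$ is surjective on $C_\infty^t$. A multi-valued operator on $E$ is a formal power series $f(\tau)=\sum_{i\ge0}a_i\tau^i$ ($a_i$ being $t\times t$ matrices over $C_\infty$) of the form $f(\tau)=e(M\log(\tau))$ for some $t\times t$ matrix $M$ over $C_\infty$. Under composition these form an $\mathbb{F}_r$-algebra isomorphic to the algebra of $t\times t$ matrices over $C_\infty$; the tangent action of $e(M\log(\tau))$ is $M$. For $a\in\mathbf{A}$, $E_a=e(E_{a,\ast}\log(\tau))$. *)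

theory Defs
  imports
    "HOL-Analysis.Analysis"
    "HOL-Computational_Algebra.Formal_Laurent_Series"
    "HOL-Algebra.Algebraic_Closure_Type"
begin

text \<open>
  Conventions. The type \<open>'q\<close> is the finite field with \<open>r = CARD('q)\<close> elements, and
  \<open>'q poly\<close> is the polynomial ring in \<open>T\<close> over it. The completion of its fraction field at
  infinity is \<open>'q fls\<close>, whose formal variable stands for \<open>1/T\<close>; so \<open>T\<close> is
  \<^const>\<open>fls_X_inv\<close>. The dimension \<open>t\<close> is the cardinality of the index type \<open>'t\<close>.
\<close>

section \<open>The field of operators and the field of scalars\<close>

definition T_infty :: "'q::{field,finite} fls" where
  "T_infty = fls_X_inv"

text \<open>The absolute value at infinity, normalised by \<open>|T| = r\<close>.\<close>

definition abs_infty :: "'q::{field,finite} fls \<Rightarrow> real" where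
  "abs_infty x = (if x = 0 then 0 else real CARD('q) powi (- fls_subdegree x))"

definition field_embedding :: "('a::field \<Rightarrow> 'b::field) \<Rightarrow> bool" where
  "field_embedding h \<longleftrightarrow>
     h 1 = 1 \<and> (\<forall>x y. h (x + y) = h x + h y) \<and> (\<forall>x y. h (x * y) = h x * h y)"

text \<open>
  The absolute value on a completion is \<open>|x| = dist x 0\<close>. The following says that \<open>'c\<close>, whose
  metric is complete by its class, is a completion of the algebraic closure of \<open>'q fls\<close>: the
  metric comes from a non-archimedean absolute value extending the one on \<open>'q fls\<close>, and the
  algebraic closure embeds via \<open>\<iota>\<close> as a dense subfield.
\<close>

definition completed_alg_closure ::
    "('q::{field,finite} fls alg_closure \<Rightarrow> 'c::{field,complete_space}) \<Rightarrow> bool" where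
  "completed_alg_closure \<iota> \<longleftrightarrow>
     (\<forall>x y :: 'c. dist x y = dist (x - y) 0) \<and>
     (\<forall>x y :: 'c. dist (x * y) 0 = dist x 0 * dist y 0) \<and>
     (\<forall>x y :: 'c. dist (x + y) 0 \<le> max (dist x 0) (dist y 0)) \<and>
     field_embedding \<iota> \<and>
     (\<forall>x. dist (\<iota> (to_ac x)) 0 = abs_infty x) \<and>
     closure (range \<iota>) = UNIV"

text \<open>
  The canonical isomorphism from the operator copy \<open>(\<iota>\<^sub>o, 'b)\<close> to the scalar copy \<open>(\<iota>\<^sub>s, 'c)\<close>.
\<close>

definition canonical_iso ::
    "('q::{field,finite} fls alg_closure \<Rightarrow> 'b::{field,complete_space}) \<Rightarrow>
     ('q fls alg_closure \<Rightarrow> 'c::{field,complete_space}) \<Rightarrow> ('b \<Rightarrow> 'c) \<Rightarrow> bool" where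
  "canonical_iso \<iota>\<^sub>o \<iota>\<^sub>s \<theta> \<longleftrightarrow>
     field_embedding \<theta> \<and> bij \<theta> \<and> (\<forall>x y. dist (\<theta> x) (\<theta> y) = dist x y) \<and>
     (\<forall>x. \<theta> (\<iota>\<^sub>o x) = \<iota>\<^sub>s x)"

text \<open>
  An element of the algebraic closure is separable if its minimal polynomial has only simple
  roots there.
\<close>

definition separable_element :: "'k::field alg_closure \<Rightarrow> bool" where
  "separable_element x \<longleftrightarrow>
     (\<exists>p :: 'k poly. Factorial_Ring.irreducible p \<and> poly (map_poly to_ac p) x = 0 \<and> rsquarefree (map_poly to_ac p))"

definition K_sep :: "('q::{field,finite} fls alg_closure \<Rightarrow> 'b::{field,complete_space}) \<Rightarrow> 'b set" where
  "K_sep \<iota> = \<iota> ` {x. separable_element x}"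

definition poly_to_fls :: "'q::{field,finite} poly \<Rightarrow> 'q fls" where
  "poly_to_fls a = poly (map_poly fls_const a) T_infty"

section \<open>Twisted power series over matrices\<close>

text \<open>
  The sequence \<open>f\<close> stands for \<open>\<Sum>i. f i \<tau>^i\<close>, where \<open>\<tau>\<close> raises each coordinate to the power \<open>r\<close>.
\<close>

type_synonym ('c, 't) tau_series = "nat \<Rightarrow> 'c^'t^'t"

definition frob_vec :: "nat \<Rightarrow> nat \<Rightarrow> 'c::field^'t::finite \<Rightarrow> 'c^'t" where
  "frob_vec r i z = (\<chi> k. (z $ k) ^ (r ^ i))"

definition frob_mat :: "nat \<Rightarrow> nat \<Rightarrow> 'c::field^'t::finite^'t \<Rightarrow> 'c^'t^'t" where
  "frob_mat r i M = (\<chi> k l. (M $ k $ l) ^ (r ^ i))"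

definition tau_const :: "'c::field^'t::finite^'t \<Rightarrow> ('c, 't) tau_series" where
  "tau_const M = (\<lambda>n. if n = 0 then M else 0)"

definition tau_add :: "('c::field, 't::finite) tau_series \<Rightarrow> ('c, 't) tau_series \<Rightarrow> ('c, 't) tau_series" where
  "tau_add f g = (\<lambda>n. f n + g n)"

text \<open>Composition, determined by \<open>\<tau>^i M = frob_mat r i M \<tau>^i\<close>.\<close>

definition tau_comp ::
    "nat \<Rightarrow> ('c::field, 't::finite) tau_series \<Rightarrow> ('c, 't) tau_series \<Rightarrow> ('c, 't) tau_series" where
  "tau_comp r f g = (\<lambda>n. \<Sum>i\<le>n. f i ** frob_mat r i (g (n - i)))"

definition tangent :: "('c::field, 't::finite) tau_series \<Rightarrow> 'c^'t^'t" where
  "tangent f = f 0"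

definition tau_converges ::
    "nat \<Rightarrow> ('c::{field,complete_space}, 't::finite) tau_series \<Rightarrow> 'c^'t \<Rightarrow> bool" where
  "tau_converges r f z \<longleftrightarrow> summable (\<lambda>i. f i *v frob_vec r i z)"

definition tau_eval ::
    "nat \<Rightarrow> ('c::{field,complete_space}, 't::finite) tau_series \<Rightarrow> 'c^'t \<Rightarrow> 'c^'t" where
  "tau_eval r f z = (\<Sum>i. f i *v frob_vec r i z)"

definition nilpotent_mat :: "'c::field^'t::finite^'t \<Rightarrow> bool" where
  "nilpotent_mat N \<longleftrightarrow> (\<exists>n. (((**) N) ^^ n) (mat 1) = 0)"

text \<open>
  \<open>F\<close> is a homomorphism of algebras over \<open>'q\<close> from the subalgebra \<open>S\<close> to the twisted power
  series under composition; \<open>\<eta>\<close> and \<open>\<kappa>\<close> are the structure maps from \<open>'q\<close> to \<open>S\<close> and to the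
  field of coefficients.
\<close>

definition tau_algebra_hom ::
    "('q::{field,finite} \<Rightarrow> 's::comm_ring_1) \<Rightarrow> ('q \<Rightarrow> 'c::field) \<Rightarrow> 's set \<Rightarrow>
     ('s \<Rightarrow> ('c, 't::finite) tau_series) \<Rightarrow> bool" where
  "tau_algebra_hom \<eta> \<kappa> S F \<longleftrightarrow>
     F 1 = tau_const (mat 1) \<and>
     (\<forall>x\<in>S. \<forall>y\<in>S. F (x + y) = tau_add (F x) (F y)) \<and>
     (\<forall>x\<in>S. \<forall>y\<in>S. F (x * y) = tau_comp CARD('q) (F x) (F y)) \<and>
     (\<forall>c. \<forall>x\<in>S. F (\<eta> c * x) = tau_comp CARD('q) (tau_const (mat (\<kappa> c))) (F x))"

abbreviation const_infty ::
    "('q::{field,finite} fls alg_closure \<Rightarrow> 'c) \<Rightarrow> 'q \<Rightarrow> 'c" where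
  "const_infty \<iota> c \<equiv> \<iota> (to_ac (fls_const c))"

section \<open>T-modules, exponential and multi-valued operators\<close>

definition T_module ::
    "('q::{field,finite} fls alg_closure \<Rightarrow> 'c::{field,complete_space}) \<Rightarrow>
     ('q poly \<Rightarrow> ('c, 't::finite) tau_series) \<Rightarrow> bool" where
  "T_module \<iota> E \<longleftrightarrow>
     (\<forall>a. finite {i. E a i \<noteq> 0}) \<and>
     tau_algebra_hom (\<lambda>c. [:c:]) (const_infty \<iota>) UNIV E \<and>
     (\<exists>N. nilpotent_mat N \<and> tangent (E [:0, 1:]) = mat (\<iota> (to_ac T_infty)) + N)"

definition is_exponential ::
    "('q::{field,finite} poly \<Rightarrow> ('c::{field,complete_space}, 't::finite) tau_series) \<Rightarrow>
     ('c, 't) tau_series \<Rightarrow> bool" where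
  "is_exponential E e \<longleftrightarrow>
     e 0 = mat 1 \<and>
     (\<forall>z. tau_converges CARD('q) e z) \<and>
     (\<forall>a z. tau_eval CARD('q) e (tangent (E a) *v z) =
            tau_eval CARD('q) (E a) (tau_eval CARD('q) e z))"

definition exponential ::
    "('q::{field,finite} poly \<Rightarrow> ('c::{field,complete_space}, 't::finite) tau_series) \<Rightarrow>
     ('c, 't) tau_series" where
  "exponential E = (THE e. is_exponential E e)"

definition logarithm ::
    "('q::{field,finite} poly \<Rightarrow> ('c::{field,complete_space}, 't::finite) tau_series) \<Rightarrow>
     ('c, 't) tau_series" where
  "logarithm E =
     (THE l. tau_comp CARD('q) (exponential E) l = tau_const (mat 1) \<and>
             tau_comp CARD('q) l (exponential E) = tau_const (mat 1))"

definition uniformizable ::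
    "('q::{field,finite} poly \<Rightarrow> ('c::{field,complete_space}, 't::finite) tau_series) \<Rightarrow> bool" where
  "uniformizable E \<longleftrightarrow> surj (tau_eval CARD('q) (exponential E))"

definition multivalued_operators ::
    "('q::{field,finite} poly \<Rightarrow> ('c::{field,complete_space}, 't::finite) tau_series) \<Rightarrow>
     ('c, 't) tau_series set" where
  "multivalued_operators E =
     {f. \<exists>M. f = tau_comp CARD('q) (exponential E)
                    (tau_comp CARD('q) (tau_const M) (logarithm E))}"

end

theory Submission
  imports Defs "HOL-Algebra.Sylow"
begin

text \<open>
  Write \<open>e\<close> for the exponential and \<open>l\<close> for its formal inverse. The map
  \<open>M \<mapsto> e M l\<close> is an isomorphism from the matrix algebra onto the multi-valued operators,
  with inverse the tangent map, and it sends the tangent action of \<open>a\<close> to \<open>E a\<close> because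
  \<open>e\<close> intertwines the two. So the theorem is a statement about matrices: the homomorphism
  \<open>T \<mapsto> M = \<theta> + N\<close>, with \<open>\<theta> = \<iota> T\<close> and \<open>N\<close> nilpotent, extends in exactly one way from the polynomial
  ring to a homomorphism \<open>D\<close> on the separable closure \<open>L\<close> of the Laurent series field \<open>K\<close>
  such that \<open>D x\<close> always is \<open>\<iota> x\<close> plus a nilpotent matrix.

  Let \<open>Q\<close> be a power of \<open>r\<close> that is at least the dimension. A nilpotent matrix has \<open>Q\<close>-th power
  zero, and \<open>Q\<close>-th powers are additive in characteristic \<open>p\<close>; hence
  \<open>D (u ^ Q) = (\<iota> u + N\<^sub>u) ^ Q = (\<iota> u) ^ Q\<close> is a scalar that is forced. On the other hand
  \<open>1, T, \<dots>, T ^ (Q - 1)\<close> is a basis of \<open>L\<close> over the field of \<open>Q\<close>-th powers of \<open>L\<close>. Therefore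
  \<open>D (\<Sum>i<Q. u\<^sub>i ^ Q T ^ i) = (\<Sum>i<Q. (\<iota> u\<^sub>i) ^ Q M ^ i)\<close>, which proves uniqueness; and since
  \<open>M ^ Q = \<theta> ^ Q\<close>, which is what the relation between \<open>T\<close> and \<open>T ^ Q \<in> L ^ Q\<close> demands, this
  formula does define a homomorphism (\<open>ex_tangent_extension\<close>, \<open>tangent_extension_unique\<close>).
  What makes this work is the inseparability of \<open>K\<close> over its \<open>Q\<close>-th powers.

  The basis property is a computation with coefficients for \<open>K\<close> (\<open>power_basis_T_infty\<close>). It
  passes to \<open>L\<close> because a finite separable extension \<open>K'\<close> of \<open>K\<close> is spanned over \<open>K\<close> by its
  \<open>Q\<close>-th powers, so that the Frobenius map carries \<open>K\<close>-bases of \<open>K'\<close> to \<open>K\<close>-bases of \<open>K'\<close>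
  (\<open>separable_algebra_powers_independent\<close>). The same dimension count shows that sums and
  products of separable elements are separable.

  For the exponential, the trick is again to raise to the power \<open>Q\<close>: the tangent action of
  \<open>T ^ Q\<close> is the scalar \<open>w = \<theta> ^ Q\<close>. A series \<open>g\<close> with \<open>g w = E (T ^ Q) g\<close> is determined by its
  constant term through the recursion obtained by dividing by \<open>w ^ (r ^ n) - w\<close>. This gives
  existence, uniqueness and the functional equation for every other \<open>a\<close>, and the size of the
  divisors makes the series converge everywhere (\<open>ex_exponential\<close>).
\<close>

section \<open>Frobenius in characteristic p\<close>

text \<open>
  Multiplication by \<open>x \<noteq> 0\<close> permutes the units, so it does not change their product.
\<close>

lemma finite_field_power_card:
  fixes x :: "'q::{field,finite}"
  shows "x ^ CARD('q) = x"
proof (cases "x = 0")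
  case False
  let ?U = "UNIV - {0::'q}"
  have "(\<Prod>y\<in>?U. x * y) = \<Prod>?U"
    by (rule prod.reindex_bij_witness[of _ "\<lambda>y. y / x" "\<lambda>y. x * y"]) (use False in auto)
  then have "x ^ card ?U * \<Prod>?U = 1 * \<Prod>?U"
    by (simp add: prod.distrib)
  then have "x ^ card ?U = 1"
    by (subst (asm) mult_right_cancel) auto
  moreover have "CARD('q) = Suc (card ?U)"
    by (rule card_Suc_Diff1[symmetric]) auto
  ultimately show ?thesis by (simp only: power_Suc mult_1_right)
qed simp

lemma prime_CHAR_finite_field: "Factorial_Ring.prime CHAR('q::{field,finite})"
  by (intro prime_CHAR_semidom finite_imp_CHAR_pos) simp

text \<open>
  By Sylow's theorem for the additive group there is a subgroup of order \<open>l\<close>, and its elements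
  are killed by \<open>l\<close>.
\<close>

lemma prime_dvd_CARD_imp_eq_CHAR:
  assumes l: "Factorial_Ring.prime l" "l dvd CARD('q::{field,finite})"
  shows "l = CHAR('q)"
proof -
  let ?G = "\<lparr>carrier = (UNIV :: 'q set), mult = (+), one = 0\<rparr>"
  have G: "Group.group ?G"
  proof (rule groupI)
    fix x assume "x \<in> carrier ?G"
    show "\<exists>y\<in>carrier ?G. y \<otimes>\<^bsub>?G\<^esub> x = \<one>\<^bsub>?G\<^esub>"
      by (rule bexI[of _ "- x"]) auto
  qed (auto simp: add.assoc)
  obtain m where "CARD('q) = l ^ 1 * m" using l(2) by auto
  then obtain H where H: "subgroup H ?G" "card H = l ^ 1"
    using sylow_thm[OF l(1) G, of 1 m] by (auto simp: Coset.order_def)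
  have "l > 1" using l(1) prime_gt_1_nat by blast
  then have "finite H" using H(2) by (intro card_ge_0_finite) simp
  have "H \<noteq> {0}" using H(2) \<open>l > 1\<close> by auto
  obtain x where x: "x \<in> H" "x \<noteq> 0"
    using \<open>H \<noteq> {0}\<close> subgroup.one_closed[OF H(1)] by auto
  \<comment> \<open>Translation by \<open>x\<close> permutes \<open>H\<close>; comparing the two sums over \<open>H\<close> gives \<open>l x = 0\<close>.\<close>
  have "(+) x ` H \<subseteq> H"
    using subgroup.m_closed[OF H(1) x(1)] by auto
  then have "(+) x ` H = H"
    using \<open>finite H\<close> by (simp add: card_subset_eq card_image)
  then have "\<Sum>H = (\<Sum>y\<in>H. x + y)"
    using sum.reindex[of "(+) x" H "\<lambda>y. y"] by simp
  then have "of_nat l * x = 0"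
    using H(2) by (simp add: sum.distrib)
  then have "of_nat l = (0 :: 'q)" using x(2) by simp
  then have "CHAR('q) dvd l" by (simp add: of_nat_eq_0_iff_char_dvd)
  then show ?thesis
    using primes_dvd_imp_eq[OF prime_CHAR_finite_field[where 'q = 'q] l(1)] by simp
qed

lemma CARD_finite_field: "\<exists>m. CARD('q::{field,finite}) = CHAR('q) ^ m"
proof -
  let ?p = "CHAR('q)"
  have "\<not> is_unit ?p" using prime_CHAR_finite_field[where 'q='q] not_prime_unit by blast
  then obtain m where m: "CARD('q) = ?p ^ multiplicity ?p CARD('q) * m" "\<not> ?p dvd m"
    by (rule multiplicity_decompose'[rotated]) auto
  have "m = 1"
  proof (rule ccontr)
    assume "m \<noteq> 1"
    then obtain l where l: "Factorial_Ring.prime l" "l dvd m" using prime_factor_nat by blast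
    then have "l dvd CARD('q)" by (subst m(1)) (rule dvd_mult)
    then show False using prime_dvd_CARD_imp_eq_CHAR[OF l(1)] l(2) m(2) by auto
  qed
  then show ?thesis using m(1) by auto
qed

lemma power_CHAR_add:
  fixes x y :: "'a::comm_semiring_1"
  assumes "Factorial_Ring.prime CHAR('a)"
  shows "(x + y) ^ (CHAR('a) ^ n) = x ^ (CHAR('a) ^ n) + y ^ (CHAR('a) ^ n)"
  using freshmans_dream'[OF assms refl] .

lemma power_CHAR_sum:
  fixes f :: "'b \<Rightarrow> 'a::comm_semiring_1"
  assumes "Factorial_Ring.prime CHAR('a)"
  shows "(\<Sum>i\<in>I. f i) ^ (CHAR('a) ^ n) = (\<Sum>i\<in>I. f i ^ (CHAR('a) ^ n))"
  using freshmans_dream_sum'[OF assms refl] .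

lemma power_CHAR_diff:
  fixes x y :: "'a::comm_ring_1"
  assumes "Factorial_Ring.prime CHAR('a)"
  shows "(x - y) ^ (CHAR('a) ^ n) = x ^ (CHAR('a) ^ n) - y ^ (CHAR('a) ^ n)"
  using power_CHAR_add[OF assms, of "x - y" y n] by (simp add: algebra_simps)

lemma inj_power_CHAR:
  fixes x y :: "'a::idom"
  assumes p: "Factorial_Ring.prime CHAR('a)" and eq: "x ^ (CHAR('a) ^ n) = y ^ (CHAR('a) ^ n)"
  shows "x = y"
proof -
  have "(x - y) ^ (CHAR('a) ^ n) = 0" using eq by (simp add: power_CHAR_diff[OF p])
  then show ?thesis by simp
qed

section \<open>Laurent series over their Q-th powers\<close>

text \<open>
  This says that \<open>1, T, \<dots>, T ^ (Q - 1)\<close> is a basis over the field of \<open>Q\<close>-th powers; it is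
  spelled out with the \<open>Q\<close>-th roots \<open>d i\<close> of the coordinates, so that the subfield does not occur.
\<close>

definition power_basis :: "'k::field \<Rightarrow> nat \<Rightarrow> bool" where
  "power_basis T Q \<longleftrightarrow>
     (\<forall>c. \<exists>d. c = (\<Sum>i<Q. d i ^ Q * T ^ i)) \<and>
     (\<forall>d. (\<Sum>i<Q. d i ^ Q * T ^ i) = 0 \<longrightarrow> (\<forall>i<Q. d i = 0))"

text \<open>
  Both sides are ring homomorphisms that fix the constants and send \<open>X\<close> to \<open>X ^ Q\<close>. Splitting off
  the constant term of \<open>f\<close> reduces the coefficient \<open>n\<close> to the coefficient \<open>n - Q\<close>.
\<close>

lemma fps_power_CARD:
  fixes f :: "'q::{field,finite} fps"
  assumes Q: "Q = CARD('q) ^ s"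
  shows "f ^ Q = f oo fps_X ^ Q"
proof -
  obtain m where m: "CARD('q) = CHAR('q) ^ m" using CARD_finite_field by blast
  have p: "Factorial_Ring.prime CHAR('q fps)" using prime_CHAR_finite_field[where 'q='q] by simp
  have Q': "Q = CHAR('q fps) ^ (m * s)" using Q m by (simp add: power_mult)
  have Q0: "Q > 0" using Q by simp
  have cQ: "(c::'q) ^ Q = c" for c
    unfolding Q by (induction s) (simp_all add: power_mult finite_field_power_card)
  have "fps_nth (f ^ Q) n = fps_nth (f oo fps_X ^ Q) n" for n
  proof (induction n arbitrary: f rule: less_induct)
    case (less n)
    let ?a = "fps_const (fps_nth f 0)" and ?h = "fps_shift 1 f"
    have f: "f = ?a + fps_X * ?h" by (rule fps_ext) simp
    have X0: "fps_nth (fps_X ^ Q :: 'q fps) 0 = 0" using Q0 by simp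
    have "f ^ Q = ?a ^ Q + (fps_X * ?h) ^ Q"
      using arg_cong[OF f, of "\<lambda>z. z ^ Q"] by (simp only: Q' power_CHAR_add[OF p])
    also have "\<dots> = ?a + fps_X ^ Q * ?h ^ Q"
      by (simp add: power_mult_distrib fps_const_power cQ)
    finally have 1: "f ^ Q = ?a + fps_X ^ Q * ?h ^ Q" .
    have "f oo fps_X ^ Q = (?a + fps_X * ?h) oo fps_X ^ Q"
      using arg_cong[OF f, of "\<lambda>z. z oo fps_X ^ Q"] .
    also have "\<dots> = ?a + fps_X ^ Q * (?h oo fps_X ^ Q)"
      using X0 by (simp only: fps_compose_add_distrib fps_compose_mult_distrib[OF X0]
          fps_const_compose fps_X_fps_compose_startby0)
    finally have 2: "f oo fps_X ^ Q = ?a + fps_X ^ Q * (?h oo fps_X ^ Q)" .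
    show ?case
      unfolding 1 2 using less.IH[of "n - Q" ?h] Q0 by (simp add: fps_X_power_mult_nth)
  qed
  then show ?thesis by (rule fps_ext)
qed

lemma fls_power_CARD_nth:
  fixes f :: "'q::{field,finite} fls"
  assumes Q: "Q = CARD('q) ^ s"
  shows "fls_nth (f ^ Q) n = (if int Q dvd n then fls_nth f (n div int Q) else 0)"
proof -
  have Q0: "Q > 0" using Q by simp
  obtain k g where f: "f = fls_shift k (fps_to_fls g)"
    using fls_as_fps'[of f "- fls_subdegree f"] by blast
  have "f ^ Q = fls_shift (Q * k) (fps_to_fls (g oo fps_X ^ Q))"
    by (simp add: f fls_shifted_pow fps_to_fls_power[symmetric] fps_power_CARD[OF Q, of g])
  also have "\<dots> = fls_compose_power f Q"
    using Q0 by (simp add: f fls_compose_power_fps_to_fls)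
  finally show ?thesis by (simp add: fls_nth_compose_power[OF Q0])
qed

text \<open>
  Multiplication by \<open>T\<close> shifts the coefficients, the formal variable being \<open>1/T\<close>.
\<close>

lemma fls_mult_T_infty_power_nth: "fls_nth (f * T_infty ^ i) n = fls_nth f (n + int i)"
  by (simp add: T_infty_def fls_X_inv_power_conv_shift_1 fls_shifted_times_simps)

lemma residue_unique:
  assumes "Q > 0" "i < Q" "int Q dvd n + int i"
  shows "i = nat ((- n) mod int Q)"
proof -
  have "(- n) mod int Q = int i mod int Q"
  proof (subst mod_eq_dvd_iff)
    have "- n - int i = - (n + int i)" by simp
    then show "int Q dvd - n - int i" using assms(3) by (simp only: dvd_minus_iff)
  qed
  then show ?thesis using assms(2) by simp
qed

text \<open>
  The summand \<open>i\<close> lives in the degrees congruent to \<open>- i\<close> modulo \<open>Q\<close>, so each coefficient of the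
  sum comes from a single summand.
\<close>

lemma fls_power_expansion_nth:
  fixes d :: "nat \<Rightarrow> 'q::{field,finite} fls"
  assumes Q: "Q = CARD('q) ^ s"
  defines "j \<equiv> \<lambda>n. nat ((- n) mod int Q)"
  shows "fls_nth (\<Sum>i<Q. d i ^ Q * T_infty ^ i) n = fls_nth (d (j n)) ((n + int (j n)) div int Q)"
proof -
  have Q0: "Q > 0" using Q by simp
  have j: "j n < Q" "int Q dvd n + int (j n)"
  proof -
    show "j n < Q" using Q0 by (simp add: j_def nat_less_iff)
    have "(n + (- n) mod int Q) mod int Q = 0" by (simp add: mod_add_right_eq)
    then show "int Q dvd n + int (j n)" using Q0 by (simp add: j_def dvd_eq_mod_eq_0)
  qed
  have "fls_nth (\<Sum>i<Q. d i ^ Q * T_infty ^ i) n = (\<Sum>i<Q. fls_nth (d i ^ Q * T_infty ^ i) n)"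
    by (rule fls_nth_sum)
  also have "\<dots> = (\<Sum>i\<in>{j n}. fls_nth (d i ^ Q * T_infty ^ i) n)"
  proof (rule sum.mono_neutral_right)
    show "\<forall>i\<in>{..<Q} - {j n}. fls_nth (d i ^ Q * T_infty ^ i) n = 0"
    proof
      fix i assume i: "i \<in> {..<Q} - {j n}"
      then have "\<not> int Q dvd n + int i"
        using residue_unique[OF Q0, of i n] by (auto simp: j_def)
      then show "fls_nth (d i ^ Q * T_infty ^ i) n = 0"
        by (simp add: fls_mult_T_infty_power_nth fls_power_CARD_nth[OF Q])
    qed
  qed (use j in auto)
  finally show ?thesis using j by (simp add: fls_mult_T_infty_power_nth fls_power_CARD_nth[OF Q])
qed

text \<open>
  Sorting the coefficients of a Laurent series by their degree modulo \<open>Q\<close> gives the expansion and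
  shows that it is unique; the constants are their own \<open>Q\<close>-th powers.
\<close>

lemma power_basis_T_infty:
  assumes Q: "Q = CARD('q::{field,finite}) ^ s"
  shows "power_basis (T_infty :: 'q fls) Q"
  unfolding power_basis_def
proof (intro conjI allI impI)
  have Q0: "Q > 0" using Q by simp
  let ?j = "\<lambda>n. nat ((- n) mod int Q)"
  fix c :: "'q fls"
  define d where "d i = Abs_fls (\<lambda>m. fls_nth c (int Q * m - int i))" for i
  obtain N where N: "\<forall>n<N. fls_nth c n = 0" by (elim fls_nth_vanishes_belowE)
  have d: "fls_nth (d i) m = fls_nth c (int Q * m - int i)" for i m
    unfolding d_def
  proof (rule nth_Abs_fls_lower_bound)
    show "\<forall>m<(- \<bar>N\<bar>). fls_nth c (int Q * m - int i) = 0"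
    proof (intro allI impI)
      fix m assume m: "m < - \<bar>N\<bar>"
      then have "int Q * m \<le> 1 * m" using Q0 by (intro mult_right_mono_neg) auto
      then show "fls_nth c (int Q * m - int i) = 0" using N m by simp
    qed
  qed
  have "c = (\<Sum>i<Q. d i ^ Q * T_infty ^ i)"
  proof (rule fls_eqI)
    fix n
    have "(n + (- n) mod int Q) mod int Q = 0" by (simp add: mod_add_right_eq)
    then have "int Q dvd n + int (?j n)" using Q0 by (simp add: dvd_eq_mod_eq_0)
    then show "fls_nth c n = fls_nth (\<Sum>i<Q. d i ^ Q * T_infty ^ i) n"
      by (simp only: fls_power_expansion_nth[OF Q] d dvd_mult_div_cancel) simp
  qed
  then show "\<exists>d. c = (\<Sum>i<Q. d i ^ Q * T_infty ^ i)" by blast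
next
  fix d :: "nat \<Rightarrow> 'q fls" and i
  assume z: "(\<Sum>i<Q. d i ^ Q * T_infty ^ i) = 0" and i: "i < Q"
  have Q0: "Q > 0" using Q by simp
  show "d i = 0"
  proof (rule fls_eqI)
    fix m
    let ?n = "int Q * m - int i"
    have "i = nat ((- ?n) mod int Q)" by (rule residue_unique[OF Q0 i]) simp
    then have "fls_nth (\<Sum>i<Q. d i ^ Q * T_infty ^ i) ?n = fls_nth (d i) ((?n + int i) div int Q)"
      using fls_power_expansion_nth[OF Q, of d ?n] by simp
    then show "fls_nth (d i) m = fls_nth 0 m" using z Q0 by simp
  qed
qed

section \<open>Separable elements of an algebraic closure\<close>

interpretation ac: vector_space "\<lambda>(c::'k::field) x. to_ac c * x"
  by unfold_locales (simp_all add: algebra_simps)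

definition eval_ac :: "'k::field poly \<Rightarrow> 'k alg_closure \<Rightarrow> 'k alg_closure" where
  "eval_ac f x = poly (map_poly to_ac f) x"

lemma eval_ac_altdef:
  assumes "Polynomial.degree f \<le> n"
  shows "eval_ac f x = (\<Sum>i\<le>n. to_ac (Polynomial.coeff f i) * x ^ i)"
proof -
  have "Polynomial.degree (map_poly to_ac f) \<le> n"
    using map_poly_degree_leq assms le_trans by blast
  then have "eval_ac f x = (\<Sum>i\<le>n. Polynomial.coeff (map_poly to_ac f) i * x ^ i)"
    unfolding eval_ac_def poly_altdef
    by (intro sum.mono_neutral_left) (auto simp: coeff_eq_0)
  then show ?thesis by (simp add: coeff_map_poly)
qed

lemma eval_ac_pCons: "eval_ac (pCons a f) x = to_ac a + x * eval_ac f x"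
  by (simp add: eval_ac_def map_poly_pCons)

lemma eval_ac_0 [simp]: "eval_ac 0 x = 0"
  by (simp add: eval_ac_def)

lemma eval_ac_add: "eval_ac (f + g) x = eval_ac f x + eval_ac g x"
  by (induction f g rule: poly_induct2) (simp_all add: eval_ac_pCons algebra_simps)

lemma eval_ac_smult: "eval_ac (Polynomial.smult c f) x = to_ac c * eval_ac f x"
  by (induction f) (simp_all add: eval_ac_pCons algebra_simps)

lemma eval_ac_mult: "eval_ac (f * g) x = eval_ac f x * eval_ac g x"
  by (induction f) (simp_all add: eval_ac_pCons eval_ac_add eval_ac_smult algebra_simps)

lemma eval_ac_sum: "eval_ac (\<Sum>i\<in>I. f i) x = (\<Sum>i\<in>I. eval_ac (f i) x)"
  by (induction I rule: infinite_finite_induct) (simp_all add: eval_ac_add)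

lemma eval_ac_monom: "eval_ac (Polynomial.monom c n) x = to_ac c * x ^ n"
  by (simp add: eval_ac_def map_poly_monom poly_monom)

lemma eval_ac_dvd: "g dvd f \<Longrightarrow> eval_ac g x = 0 \<Longrightarrow> eval_ac f x = 0"
  by (auto simp: dvd_def eval_ac_mult)

lemma eval_ac_mod: "eval_ac g x = 0 \<Longrightarrow> eval_ac (f mod g) x = eval_ac f x"
  using eval_ac_add[of "f div g * g" "f mod g" x] by (simp add: eval_ac_mult)

text \<open>
  The minimal polynomial, as a polynomial of least degree in the ideal of those vanishing at \<open>x\<close>.
  Degrees replace greatest common divisors here, since they only need division with remainder.
\<close>

lemma ex_min_poly:
  obtains g :: "'k::field poly" where "g \<noteq> 0" "eval_ac g x = 0"
    "\<And>f. eval_ac f x = 0 \<longleftrightarrow> g dvd f"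
proof -
  define P where "P g \<longleftrightarrow> g \<noteq> 0 \<and> eval_ac g x = 0" for g :: "'k poly"
  obtain p :: "'k poly" where "p \<noteq> 0" "poly (map_poly to_ac p) x = 0"
    using alg_closure_algebraic by blast
  then have "P p" by (simp add: P_def eval_ac_def)
  then obtain g where g: "P g" "\<And>f. P f \<Longrightarrow> Polynomial.degree g \<le> Polynomial.degree f"
    using ex_has_least_nat[of P p Polynomial.degree] by blast
  show ?thesis
  proof (rule that)
    show "g \<noteq> 0" "eval_ac g x = 0" using g(1) by (auto simp: P_def)
    fix f show "eval_ac f x = 0 \<longleftrightarrow> g dvd f"
    proof
      assume f: "eval_ac f x = 0"
      show "g dvd f"
      proof (rule ccontr)
        assume "\<not> g dvd f"
        then have nz: "f mod g \<noteq> 0" by (simp add: dvd_eq_mod_eq_0)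
        then have "P (f mod g)" using f g(1) by (simp add: P_def eval_ac_mod)
        moreover have "Polynomial.degree (f mod g) < Polynomial.degree g"
          using degree_mod_less[of g f] nz g(1) by (auto simp: P_def)
        ultimately show False using g(2) by fastforce
      qed
    qed (use g(1) in \<open>auto simp: P_def intro: eval_ac_dvd\<close>)
  qed
qed

lemma irreducible_root_dvd_iff:
  fixes g :: "'k::field poly"
  assumes g: "Factorial_Ring.irreducible g" "eval_ac g x = 0"
  shows "eval_ac f x = 0 \<longleftrightarrow> g dvd f"
proof -
  obtain h :: "'k poly" where h: "h \<noteq> 0" "eval_ac h x = 0" "\<And>f. eval_ac f x = 0 \<longleftrightarrow> h dvd f"
    using ex_min_poly by blast
  have "\<not> is_unit h"
    using h(2) by (auto simp: is_unit_poly_iff eval_ac_pCons)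
  moreover have "h dvd g" using g(2) h(3) by blast
  ultimately have "g dvd h"
    using irreducibleD'[OF g(1) \<open>h dvd g\<close>] by simp
  then show ?thesis
    using h(3)[of f] dvd_trans[OF \<open>h dvd g\<close>, of f] dvd_trans[OF \<open>g dvd h\<close>, of f] by metis
qed

lemma ex_irreducible_root:
  obtains g :: "'k::field poly" where "Factorial_Ring.irreducible g" "eval_ac g x = 0"
proof -
  obtain h :: "'k poly" where h: "h \<noteq> 0" "eval_ac h x = 0" "\<And>f. eval_ac f x = 0 \<longleftrightarrow> h dvd f"
    using ex_min_poly by blast
  have "Factorial_Ring.irreducible h"
  proof (rule Factorial_Ring.irreducibleI)
    show "\<not> is_unit h" using h(2) by (auto simp: is_unit_poly_iff eval_ac_pCons)
    have unit: "is_unit b" if ab: "h = a * b" "h dvd a" for a b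
    proof -
      obtain c where "a = h * c" using ab(2) by (auto simp: dvd_def)
      then have "h * 1 = (h * c) * b" using ab(1) by simp
      then have "h * 1 = h * (c * b)" by (simp only: mult.assoc)
      then have "1 = c * b" using mult_left_cancel[OF h(1), of 1 "c * b"] by blast
      then show ?thesis by (metis dvd_triv_right)
    qed
    fix a b assume ab: "h = a * b"
    then have "eval_ac a x = 0 \<or> eval_ac b x = 0"
      using h(2) by (auto simp: eval_ac_mult)
    then have "h dvd a \<or> h dvd b" using h(3) by simp
    moreover have ba: "h = b * a" using ab by (simp only: mult.commute)
    ultimately show "is_unit a \<or> is_unit b"
      using unit[OF ab] unit[OF ba] by (elim disjE) simp_all
  qed fact
  then show ?thesis using that h(2) by blast
qed

lemma degree_irreducible_pos: "Factorial_Ring.irreducible (g::'k::field poly) \<Longrightarrow> 0 < Polynomial.degree g"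
  unfolding Factorial_Ring.irreducible_def using is_unit_iff_degree[of g] by simp

lemma card_roots_rsquarefree:
  fixes f :: "'a::alg_closed_field poly"
  assumes "rsquarefree f"
  shows "card {x. poly f x = 0} = Polynomial.degree f"
proof -
  have f: "f \<noteq> 0" using assms by (simp add: rsquarefree_def)
  obtain A where A: "size A = Polynomial.degree f"
      "f = Polynomial.smult (Polynomial.lead_coeff f) (\<Prod>x\<in>#A. [:- x, 1:])"
    using alg_closed_imp_factorization[OF f] by blast
  have "proots f = proots (\<Prod>x\<in>#A. [:- x, 1:])"
    using f by (subst A(2)) (simp only: proots_smult leading_coeff_0_iff not_False_eq_True)
  also have "\<dots> = A"
  proof (induction A)
    case (add x A)
    have "(\<Prod>x\<in>#A. [:- x, 1:]) \<noteq> 0" by (auto simp: prod_mset_zero_iff)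
    then have "proots ([:- x, 1:] * (\<Prod>x\<in>#A. [:- x, 1:])) = add_mset x A"
      by (subst proots_mult) (simp_all del: mult_pCons_left add: add.IH)
    then show ?case by simp
  qed simp
  finally have pA: "proots f = A" .
  have "count A x \<le> 1" for x
    using assms f unfolding pA[symmetric] rsquarefree_def by (metis count_proots le0 order_refl)
  then have "A = mset_set (set_mset A)"
    by (intro multiset_eqI) (metis One_nat_def count_greater_zero_iff count_mset_set(1,3) finite_set_mset le_antisym not_in_iff Suc_leI)
  then have "size A = card (set_mset A)" by (metis size_mset_set)
  then show ?thesis using A(1) pA f by (metis set_count_proots)
qed

text \<open>
  A linear relation between powers of \<open>y\<close> is a polynomial with root \<open>y\<close>. Linear independence is
  stated for the set of powers, hence the extra statement that they are distinct.
\<close>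

lemma powers_independent:
  fixes y :: "'k::field alg_closure"
  assumes "\<And>h. h \<noteq> 0 \<Longrightarrow> Polynomial.degree h < d \<Longrightarrow> eval_ac h y \<noteq> 0"
  shows "inj_on (\<lambda>i. y ^ i) {..<d}" "ac.independent ((\<lambda>i. y ^ i) ` {..<d})"
proof -
  show inj: "inj_on (\<lambda>i. y ^ i) {..<d}"
  proof (rule inj_onI, rule ccontr)
    fix i j assume ij: "i \<in> {..<d}" "j \<in> {..<d}" "y ^ i = y ^ j" "i \<noteq> j"
    let ?h = "Polynomial.monom (1::'k) i + Polynomial.monom (- 1) j"
    have "Polynomial.coeff ?h i = 1" using ij(4) by simp
    then have "?h \<noteq> 0" by (metis coeff_0 zero_neq_one)
    moreover have "Polynomial.degree ?h < d"
      using ij(1,2) by (intro degree_add_less le_less_trans[OF degree_monom_le]) auto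
    moreover have "eval_ac ?h y = 0" using ij(3) by (simp add: eval_ac_add eval_ac_monom)
    ultimately show False using assms by blast
  qed
  show "ac.independent ((\<lambda>i. y ^ i) ` {..<d})"
  proof (rule ac.independent_if_scalars_zero)
    fix f x assume s: "(\<Sum>x\<in>(\<lambda>i. y ^ i) ` {..<d}. to_ac (f x) * x) = 0" and x: "x \<in> (\<lambda>i. y ^ i) ` {..<d}"
    let ?h = "\<Sum>i<d. Polynomial.monom (f (y ^ i)) i"
    have "eval_ac ?h y = 0"
      using s by (simp add: sum.reindex[OF inj] eval_ac_sum eval_ac_monom)
    moreover have deg: "Polynomial.degree ?h < d"
      using x by (intro degree_sum_less le_less_trans[OF degree_monom_le]) auto
    ultimately have h0: "?h = 0" using assms by blast
    obtain i where i: "i < d" "x = y ^ i" using x by auto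
    have "Polynomial.coeff ?h i = f (y ^ i)" using i(1) by (simp add: coeff_sum)
    then show "f x = 0" using h0 i(2) by (metis coeff_0)
  qed simp
qed

lemma powers_no_relation:
  fixes y :: "'k::field alg_closure"
  assumes inj: "inj_on (\<lambda>i. y ^ i) {..<d}" and ind: "ac.independent ((\<lambda>i. y ^ i) ` {..<d})"
    and h: "Polynomial.degree h < d" "eval_ac h y = 0"
  shows "h = 0"
proof (rule poly_eqI)
  fix n
  have "eval_ac h y = (\<Sum>i<d. to_ac (Polynomial.coeff h i) * y ^ i)"
    using eval_ac_altdef[of h "d - 1" y] h(1) lessThan_Suc_atMost[of "d - 1"] by simp
  also have "\<dots> = (\<Sum>x\<in>(\<lambda>i. y ^ i) ` {..<d}. to_ac (Polynomial.coeff h (the_inv_into {..<d} (\<lambda>i. y ^ i) x)) * x)"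
    by (subst sum.reindex[OF inj]) (auto intro!: sum.cong simp: the_inv_into_f_f[OF inj])
  finally have z: "\<dots> = 0" using h(2) by simp
  show "Polynomial.coeff h n = Polynomial.coeff 0 n"
  proof (cases "n < d")
    case True
    then have "Polynomial.coeff h (the_inv_into {..<d} (\<lambda>i. y ^ i) (y ^ n)) = 0"
      using ac.independentD[OF ind _ order_refl z] by auto
    then show ?thesis using True by (simp add: the_inv_into_f_f[OF inj])
  next
    case False
    then show ?thesis using h(1) by (simp add: coeff_eq_0)
  qed
qed

lemma coeff_pderiv_eq_0_imp:
  fixes g :: "'k::field poly"
  assumes "pderiv g = 0" "Polynomial.coeff g i \<noteq> 0"
  shows "CHAR('k) dvd i"
proof (cases i)
  case (Suc n)
  have "of_nat (Suc n) * Polynomial.coeff g (Suc n) = 0"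
    using assms(1) coeff_pderiv[of g n] by simp
  then have "of_nat i = (0::'k)" using assms(2) Suc by (simp del: of_nat_Suc)
  then show ?thesis by (simp add: of_nat_eq_0_iff_char_dvd)
qed simp

lemma map_poly_to_ac_pderiv: "map_poly to_ac (pderiv g) = pderiv (map_poly to_ac g)"
  by (intro poly_eqI) (simp add: coeff_pderiv coeff_map_poly del: of_nat_Suc)

text \<open>
  A double root would be a root of the derivative as well; but \<open>g\<close>, being irreducible, divides every
  polynomial that shares a root with it, and the derivative has smaller degree.
\<close>

lemma rsquarefree_if_pderiv_nonzero:
  fixes g :: "'k::field poly"
  assumes g: "Factorial_Ring.irreducible g" "pderiv g \<noteq> 0" 
  shows "rsquarefree (map_poly to_ac g)"
proof -
  let ?f = "map_poly to_ac g"
  have nz: "?f \<noteq> 0" using g(1) by (auto simp: Factorial_Ring.irreducible_def map_poly_eq_0_iff)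
  have "Polynomial.order x ?f \<le> 1" for x
  proof (rule ccontr)
    assume "\<not> Polynomial.order x ?f \<le> 1"
    then have "2 \<le> Polynomial.order x ?f" by simp
    then have "[:- x, 1:] ^ 2 dvd ?f" using order_divides by blast
    then obtain h where h: "?f = [:- x, 1:] ^ 2 * h" by (auto simp: dvd_def)
    have "poly ?f x = 0" by (simp add: h)
    moreover have "poly (pderiv ?f) x = 0"
      unfolding h power2_eq_square mult.assoc
      by (simp add: pderiv_mult del: mult_pCons_left mult_pCons_right)
    ultimately have "g dvd pderiv g"
      using irreducible_root_dvd_iff[OF g(1), of x "pderiv g"]
      by (simp add: eval_ac_def map_poly_to_ac_pderiv)
    then have "Polynomial.degree g \<le> Polynomial.degree (pderiv g)"
      using g(2) dvd_imp_degree_le by blast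
    then have "Polynomial.lead_coeff (pderiv g) = 0"
      by (simp add: coeff_pderiv coeff_eq_0)
    then show False using g(2) by simp
  qed
  then have "Polynomial.order x ?f = 0 \<or> Polynomial.order x ?f = 1" for x
    using le_Suc_eq[of "Polynomial.order x ?f" 0] by simp
  then show ?thesis using nz unfolding rsquarefree_def by blast
qed

text \<open>
  The image of \<open>M\<close> under every iterate of the Frobenius map still spans \<open>M\<close> over the base field. For
  a field \<open>M\<close> of finite degree this is separability, in a form that linear algebra can use.
\<close>

definition powers_span :: "'k::field alg_closure set \<Rightarrow> bool" where
  "powers_span M \<longleftrightarrow>
     (\<forall>n. M \<subseteq> ac.span ((\<lambda>x. x ^ (CHAR('k) ^ n)) ` M))"

text \<open>
  A finite separable extension of the base field, as a subring of its algebraic closure.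
\<close>

definition separable_algebra :: "'k::field alg_closure set \<Rightarrow> bool" where
  "separable_algebra M \<longleftrightarrow> ac.subspace M \<and> 1 \<in> M \<and> (\<forall>x\<in>M. \<forall>y\<in>M. x * y \<in> M) \<and>
     (\<exists>B. finite B \<and> M \<subseteq> ac.span B) \<and> powers_span M"

lemma (in vector_space) span_subset_span_if_card_le:
  assumes "finite T" "independent S" "S \<subseteq> span T" "card T \<le> card S"
  shows "span T \<subseteq> span S"
proof (rule span_minimal)
  show "T \<subseteq> span S"
  proof (rule subsetI, rule ccontr)
    fix v assume v: "v \<in> T" "v \<notin> span S"
    have "v \<notin> S" using v(2) by (rule contrapos_nn) (rule span_base)
    have sub: "insert v S \<subseteq> span T" using assms(3) span_base[OF v(1)] by simp
    have "finite (insert v S) \<and> card (insert v S) \<le> card T"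
      by (rule independent_span_bound[OF assms(1) independent_insertI[OF v(2) assms(2)] sub])
    moreover from this have "card (insert v S) = Suc (card S)"
      using \<open>v \<notin> S\<close> by (intro card_insert_disjoint) auto
    ultimately show False using assms(4) by linarith
  qed
qed (rule subspace_span)

lemma powers_subset_span:
  assumes g: "eval_ac g x = 0" "g \<noteq> 0"
  shows "x ^ n \<in> ac.span ((\<lambda>i. x ^ i) ` {..<Polynomial.degree g})"
proof (cases "Polynomial.degree g = 0")
  case True
  then obtain c where "g = [:c:]" by (rule degree_eq_zeroE)
  then show ?thesis using g by (simp add: eval_ac_pCons)
next
  case False
  define h where "h = Polynomial.monom 1 n mod g"
  have deg: "Polynomial.degree h \<le> Polynomial.degree g - 1"
    using degree_mod_less[OF g(2), of "Polynomial.monom 1 n"] by (auto simp: h_def)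
  have "x ^ n = eval_ac h x"
    unfolding h_def by (simp add: eval_ac_mod[OF g(1)] eval_ac_monom)
  also have "\<dots> = (\<Sum>i\<le>Polynomial.degree g - 1. to_ac (Polynomial.coeff h i) * x ^ i)"
    by (rule eval_ac_altdef[OF deg])
  also have "\<dots> \<in> ac.span ((\<lambda>i. x ^ i) ` {..<Polynomial.degree g})"
    using False by (intro ac.span_sum ac.span_scale ac.span_base imageI) auto
  finally show ?thesis .
qed

text \<open>
  This is the fact that a separable \<open>x\<close> generates the same field as \<open>x ^ q\<close>. The minimal polynomial
  of \<open>x\<close> has \<open>d\<close> distinct roots, \<open>d\<close> being its degree, and their \<open>q\<close>-th powers are distinct
  conjugates of \<open>x ^ q\<close>. So the powers of \<open>x ^ q\<close> with exponents below \<open>d\<close> are independent, and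
  counting dimensions they span the field generated by \<open>x\<close>.
\<close>

lemma separable_powers_span:
  fixes x :: "'k::field alg_closure"
  assumes p: "Factorial_Ring.prime CHAR('k)" and x: "separable_element x"
  shows "x ^ i \<in> ac.span (range (\<lambda>j. (x ^ j) ^ (CHAR('k) ^ n)))"
proof -
  let ?q = "CHAR('k) ^ n"
  obtain g :: "'k poly" where g: "Factorial_Ring.irreducible g" "eval_ac g x = 0"
      "rsquarefree (map_poly to_ac g)"
    using x by (auto simp: separable_element_def eval_ac_def)
  let ?d = "Polynomial.degree g"
  let ?R = "{y. eval_ac g y = 0}"
  have gnz: "g \<noteq> 0" using g(1) by auto
  have inj: "inj_on (\<lambda>y::'k alg_closure. y ^ ?q) A" for A
    using inj_power_CHAR[where 'a = "'k alg_closure"] p by (auto intro: inj_onI)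
  \<comment> \<open>A polynomial that kills \<open>x ^ q\<close> kills the \<open>q\<close>-th powers of all \<open>d\<close> conjugates of \<open>x\<close>.\<close>
  have no: "eval_ac h (x ^ ?q) \<noteq> 0" if h: "h \<noteq> 0" "Polynomial.degree h < ?d" for h
  proof
    assume hx: "eval_ac h (x ^ ?q) = 0"
    define f where "f = (\<Sum>i\<le>Polynomial.degree h. Polynomial.monom (Polynomial.coeff h i) (?q * i))"
    have f: "eval_ac f y = eval_ac h (y ^ ?q)" for y
      unfolding f_def eval_ac_altdef[OF order_refl, of h]
      by (simp add: eval_ac_sum eval_ac_monom power_mult)
    have "g dvd f" using irreducible_root_dvd_iff[OF g(1,2), of f] f[of x] hx by simp
    then have "eval_ac f y = 0" if "eval_ac g y = 0" for y
      using that by (rule eval_ac_dvd)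
    then have "(\<lambda>y. y ^ ?q) ` ?R \<subseteq> {y. eval_ac h y = 0}"
      using f by auto
    moreover have nz: "map_poly to_ac h \<noteq> 0" using h(1) by (simp add: map_poly_eq_0_iff)
    have "finite {y. eval_ac h y = 0}"
      using nz poly_roots_finite unfolding eval_ac_def by blast
    ultimately have "card ((\<lambda>y. y ^ ?q) ` ?R) \<le> card {y. eval_ac h y = 0}"
      using card_mono by blast
    also have "\<dots> \<le> Polynomial.degree (map_poly to_ac h)"
      unfolding eval_ac_def by (rule card_poly_roots_bound[OF nz])
    also have "\<dots> < ?d" using h(2) map_poly_degree_leq le_less_trans by blast
    finally have "card ?R < ?d" by (simp add: card_image[OF inj])
    moreover have "card ?R = Polynomial.degree (map_poly to_ac g)"
      unfolding eval_ac_def by (rule card_roots_rsquarefree[OF g(3)])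
    moreover have "Polynomial.degree (map_poly to_ac g) = ?d"
      by (rule degree_map_poly) simp
    ultimately show False by simp
  qed
  let ?S = "(\<lambda>i. (x ^ ?q) ^ i) ` {..<?d}"
  note ind = powers_independent[of ?d "x ^ ?q", OF no]
  have "?S \<subseteq> ac.span ((\<lambda>i. x ^ i) ` {..<?d})"
    using powers_subset_span[OF g(2) gnz] by (auto simp flip: power_mult)
  moreover have "card ((\<lambda>i. x ^ i) ` {..<?d}) \<le> card ?S"
    using ind(1) card_image_le[of "{..<?d}" "\<lambda>i. x ^ i"] by (simp add: card_image)
  ultimately have "ac.span ((\<lambda>i. x ^ i) ` {..<?d}) \<subseteq> ac.span ?S"
    using ind(2) by (intro ac.span_subset_span_if_card_le) auto
  moreover have "?S \<subseteq> range (\<lambda>j. (x ^ j) ^ ?q)"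
    by (auto simp: power_mult[symmetric] mult.commute)
  ultimately show ?thesis
    using powers_subset_span[OF g(2) gnz, of i] ac.span_mono by blast
qed

lemma span_mult:
  assumes "a \<in> ac.span A" "b \<in> ac.span B" "\<And>a b. a \<in> A \<Longrightarrow> b \<in> B \<Longrightarrow> a * b \<in> ac.span C"
  shows "a * b \<in> ac.span C"
  using assms(1)
proof (induction rule: ac.span_induct_alt)
  case (step c x y)
  have "x * b \<in> ac.span C"
    using assms(2)
  proof (induction rule: ac.span_induct_alt)
    case (step c' x' y')
    then show ?case
      using assms(3)[OF \<open>x \<in> A\<close> step(1)] ac.span_add[OF ac.span_scale[of "x * x'" C c']]
      by (simp add: algebra_simps)
  qed (simp add: ac.span_zero)
  then show ?case
    using step.IH ac.span_add[OF ac.span_scale[of "x * b" C c]] by (simp add: algebra_simps)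
qed (simp add: ac.span_zero)

text \<open>
  In the span of the products \<open>m x ^ i\<close>, both factors are combinations of \<open>q\<close>-th powers, hence so
  are the products.
\<close>

lemma separable_algebra_adjoin:
  fixes x :: "'k::field alg_closure"
  assumes p: "Factorial_Ring.prime CHAR('k)" and M: "separable_algebra M" and x: "separable_element x"
  shows "\<exists>M'. separable_algebra M' \<and> M \<subseteq> M' \<and> x \<in> M'"
proof -
  define G where "G = {m * x ^ i | m i. m \<in> M}"
  define M' where "M' = ac.span G"
  have M1: "1 \<in> M" and Mm: "\<And>x y. x \<in> M \<Longrightarrow> y \<in> M \<Longrightarrow> x * y \<in> M"
    and Mp: "\<And>n. M \<subseteq> ac.span ((\<lambda>x. x ^ (CHAR('k) ^ n)) ` M)"
    using M by (auto simp: separable_algebra_def powers_span_def)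
  have GM: "G \<subseteq> M'" unfolding M'_def by (rule ac.span_superset)
  have incl: "M \<subseteq> M'"
    using GM unfolding G_def by (force intro: exI[of _ 0])
  have "x \<in> M'" using GM M1 unfolding G_def by (force intro: exI[of _ 1])
  moreover have "separable_algebra M'"
    unfolding separable_algebra_def powers_span_def
  proof (intro conjI ballI allI)
    show "ac.subspace M'" unfolding M'_def by (rule ac.subspace_span)
    show "1 \<in> M'" using incl M1 by blast
    show "a * b \<in> M'" if "a \<in> M'" "b \<in> M'" for a b
    proof -
      have "a * b \<in> ac.span G" if "a \<in> G" "b \<in> G" for a b
      proof -
        obtain m i m' i' where "a = m * x ^ i" "b = m' * x ^ i'" "m \<in> M" "m' \<in> M"
          using \<open>a \<in> G\<close> \<open>b \<in> G\<close> unfolding G_def by blast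
        then have "a * b = (m * m') * x ^ (i + i')" "m * m' \<in> M"
          using Mm by (simp_all add: power_add algebra_simps)
        then have "a * b \<in> G" unfolding G_def by blast
        then show ?thesis by (rule ac.span_base)
      qed
      then show ?thesis using span_mult that unfolding M'_def by blast
    qed
    obtain B where B: "finite B" "M \<subseteq> ac.span B"
      using M by (auto simp: separable_algebra_def)
    obtain g :: "'k poly" where g: "Factorial_Ring.irreducible g" "eval_ac g x = 0"
      using ex_irreducible_root by blast
    let ?P = "(\<lambda>i. x ^ i) ` {..<Polynomial.degree g}"
    let ?C = "(\<lambda>(b, y). b * y) ` (B \<times> ?P)"
    have "m * x ^ i \<in> ac.span ?C" if "m \<in> M" for m i
    proof (rule span_mult)
      show "m \<in> ac.span B" using B(2) that by blast
      show "x ^ i \<in> ac.span ?P" by (rule powers_subset_span[OF g(2)]) (use g(1) in auto)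
      show "a * b \<in> ac.span ?C" if "a \<in> B" "b \<in> ?P" for a b
        using that by (intro ac.span_base) auto
    qed
    then have "M' \<subseteq> ac.span ?C"
      unfolding M'_def G_def by (intro ac.span_minimal ac.subspace_span) auto
    moreover have "finite ?C" using B(1) by simp
    ultimately show "\<exists>B. finite B \<and> M' \<subseteq> ac.span B" by blast
    fix n
    let ?q = "CHAR('k) ^ n"
    have "m * x ^ i \<in> ac.span ((\<lambda>x. x ^ ?q) ` M')" if "m \<in> M" for m i
    proof (rule span_mult)
      show "m \<in> ac.span ((\<lambda>x. x ^ ?q) ` M)" using Mp that by blast
      show "x ^ i \<in> ac.span (range (\<lambda>j. (x ^ j) ^ ?q))" by (rule separable_powers_span[OF p x])
      fix a b assume "a \<in> (\<lambda>x. x ^ ?q) ` M" "b \<in> range (\<lambda>j. (x ^ j) ^ ?q)"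
      then obtain m j where "m \<in> M" "a = m ^ ?q" "b = (x ^ j) ^ ?q" by blast
      then have "a * b = (m * x ^ j) ^ ?q" "m * x ^ j \<in> M'"
        using GM by (auto simp: power_mult_distrib G_def)
      then show "a * b \<in> ac.span ((\<lambda>x. x ^ ?q) ` M')" by (intro ac.span_base) auto
    qed
    then show "M' \<subseteq> ac.span ((\<lambda>x. x ^ ?q) ` M')"
      unfolding M'_def G_def by (intro ac.span_minimal ac.subspace_span) auto
  qed
  ultimately show ?thesis using incl by blast
qed

lemma ex_separable_algebra:
  fixes Z :: "'k::field alg_closure set"
  assumes p: "Factorial_Ring.prime CHAR('k)" and "finite Z" "\<forall>x\<in>Z. separable_element x"
  shows "\<exists>M. separable_algebra M \<and> Z \<subseteq> M"
  using assms(2,3)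
proof (induction rule: finite_induct)
  case empty
  have "(1::'k alg_closure) \<in> ac.span ((\<lambda>x. x ^ (CHAR('k) ^ n)) ` ac.span {1})" for n
    by (rule ac.span_base, rule image_eqI[of _ _ 1]) (simp_all add: ac.span_base)
  then have "powers_span (ac.span {1::'k alg_closure})"
    unfolding powers_span_def by (intro allI ac.span_minimal ac.subspace_span) simp
  moreover have "x * y \<in> ac.span {1}" if "x \<in> ac.span {1}" "y \<in> ac.span {1}" for x y :: "'k alg_closure"
    by (rule span_mult[OF that]) (simp add: ac.span_base)
  ultimately have "separable_algebra (ac.span {1::'k alg_closure})"
    unfolding separable_algebra_def
    by (intro conjI ballI ac.subspace_span exI[of _ "{1}"]) (simp_all add: ac.span_base)
  then show ?case by (intro exI[of _ "ac.span {1}"]) simp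
next
  case (insert x Z)
  then obtain M where M: "separable_algebra M" "Z \<subseteq> M" by auto
  obtain M' where "separable_algebra M'" "M \<subseteq> M'" "x \<in> M'"
    using separable_algebra_adjoin[OF p M(1), of x] insert.prems by auto
  then show ?case using M(2) by (intro exI[of _ M']) auto
qed

text \<open>
  The Frobenius map is additive and takes a basis \<open>B'\<close> of \<open>M\<close> to a set that spans the \<open>q\<close>-th powers
  and so all of \<open>M\<close>. A spanning set with as many elements as a basis is independent.
\<close>

lemma separable_algebra_powers_independent:
  fixes B :: "'k::field alg_closure set"
  assumes p: "Factorial_Ring.prime CHAR('k)" and M: "separable_algebra M"
    and B: "B \<subseteq> M" "ac.independent B"
  shows "ac.independent ((\<lambda>x. x ^ (CHAR('k) ^ n)) ` B)"
proof -
  let ?\<phi> = "\<lambda>x::'k alg_closure. x ^ (CHAR('k) ^ n)"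
  have p': "Factorial_Ring.prime CHAR('k alg_closure)" using p by simp
  obtain B' where B': "B \<subseteq> B'" "B' \<subseteq> M" "ac.independent B'" "M \<subseteq> ac.span B'"
    using ac.maximal_independent_subset_extend[OF B] by blast
  obtain C where "finite C" "M \<subseteq> ac.span C" using M by (auto simp: separable_algebra_def)
  then have fin: "finite B'"
    using ac.independent_span_bound[OF \<open>finite C\<close> B'(3)] B'(2) by auto
  have "?\<phi> m \<in> ac.span (?\<phi> ` B')" if "m \<in> M" for m
  proof -
    have "m \<in> range (\<lambda>c. \<Sum>b\<in>B'. to_ac (c b) * b)"
      using that B'(4) unfolding ac.span_finite[OF fin] by (rule rev_subsetD)
    then obtain c where "m = (\<Sum>b\<in>B'. to_ac (c b) * b)"
      by (elim rangeE)
    then have "?\<phi> m = (\<Sum>b\<in>B'. to_ac (c b ^ (CHAR('k) ^ n)) * ?\<phi> b)"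
      by (simp add: power_CHAR_sum[OF p', unfolded CHAR_alg_closure] power_mult_distrib)
    also have "\<dots> \<in> ac.span (?\<phi> ` B')"
      by (intro ac.span_sum ac.span_scale ac.span_base imageI)
    finally show ?thesis .
  qed
  then have "ac.span (?\<phi> ` M) \<subseteq> ac.span (?\<phi> ` B')"
    by (intro ac.span_minimal ac.subspace_span) auto
  moreover have "M \<subseteq> ac.span (?\<phi> ` M)"
    using M by (simp add: separable_algebra_def powers_span_def)
  ultimately have sp: "B' \<subseteq> ac.span (?\<phi> ` B')" using B'(2) by simp
  have "ac.independent (?\<phi> ` B')"
  proof
    assume "ac.dependent (?\<phi> ` B')"
    then obtain a where a: "a \<in> ?\<phi> ` B'" "a \<in> ac.span (?\<phi> ` B' - {a})"
      unfolding ac.dependent_def by blast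
    then have "ac.span (?\<phi> ` B') = ac.span (?\<phi> ` B' - {a})"
      using ac.span_redundant[OF a(2)] by (simp add: insert_absorb)
    then have "card B' \<le> card (?\<phi> ` B' - {a})"
      using ac.independent_span_bound[of "?\<phi> ` B' - {a}", OF _ B'(3)] sp fin by simp
    also have "\<dots> < card (?\<phi> ` B')" by (rule card_Diff1_less) (use a(1) fin in auto)
    also have "\<dots> \<le> card B'" using fin by (rule card_image_le)
    finally show False by simp
  qed
  then show ?thesis using ac.dependent_mono[OF _ image_mono[OF B'(1)]] by (rule contrapos_nn)
qed

text \<open>
  If the derivative of the minimal polynomial \<open>g\<close> of \<open>z\<close> vanished, \<open>g\<close> would be a polynomial in
  \<open>X ^ p\<close>. That is a linear relation between powers of \<open>z ^ p\<close> with exponents at most \<open>d / p\<close>,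
  although the \<open>p\<close>-th powers of the independent elements \<open>z ^ i\<close> with \<open>i < d\<close> are independent.
\<close>

lemma separable_algebra_imp_separable:
  fixes z :: "'k::field alg_closure"
  assumes p: "Factorial_Ring.prime CHAR('k)" and M: "separable_algebra M" and z: "z \<in> M"
  shows "separable_element z"
proof -
  let ?p = "CHAR('k)"
  obtain g :: "'k poly" where g: "Factorial_Ring.irreducible g" "eval_ac g z = 0"
    using ex_irreducible_root by blast
  let ?d = "Polynomial.degree g"
  have gnz: "g \<noteq> 0" using g(1) by auto
  have "pderiv g \<noteq> 0"
  proof
    assume pd: "pderiv g = 0"
    have "eval_ac h z \<noteq> 0" if "h \<noteq> 0" "Polynomial.degree h < ?d" for h
      using irreducible_root_dvd_iff[OF g, of h] that dvd_imp_degree_le[of g h] by auto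
    note ind = powers_independent[OF this]
    have zM: "z ^ i \<in> M" for i
      by (induction i) (use M z in \<open>auto simp: separable_algebra_def\<close>)
    have inj: "inj_on (\<lambda>i. (z ^ ?p) ^ i) {..<?d}"
    proof (rule inj_onI)
      fix i j assume ij: "i \<in> {..<?d}" "j \<in> {..<?d}" "(z ^ ?p) ^ i = (z ^ ?p) ^ j"
      have "(z ^ i) ^ (?p ^ 1) = (z ^ j) ^ (?p ^ 1)"
        using ij(3) by (simp add: power_mult[symmetric] mult.commute)
      then have "z ^ i = z ^ j"
        using inj_power_CHAR[where 'a = "'k alg_closure" and n = 1] p by simp
      then show "i = j" using ind(1) ij(1,2) by (auto dest: inj_onD)
    qed
    have "ac.independent ((\<lambda>x. x ^ (?p ^ 1)) ` (\<lambda>i. z ^ i) ` {..<?d})"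
      by (rule separable_algebra_powers_independent[OF p M _ ind(2)]) (use zM in auto)
    then have ind': "ac.independent ((\<lambda>i. (z ^ ?p) ^ i) ` {..<?d})"
      by (simp add: image_image power_mult[symmetric] mult.commute)
    define h where "h = (\<Sum>j\<le>?d div ?p. Polynomial.monom (Polynomial.coeff g (?p * j)) j)"
    have p1: "?p > 1" using p prime_gt_1_nat by blast
    have d0: "?d > 0" using degree_irreducible_pos[OF g(1)] .
    have "Polynomial.degree h \<le> ?d div ?p"
      unfolding h_def by (intro degree_sum_le order_trans[OF degree_monom_le]) auto
    also have "\<dots> < ?d" using p1 d0 by simp
    finally have dh: "Polynomial.degree h < ?d" .
    have "eval_ac g z = (\<Sum>i\<le>?d. to_ac (Polynomial.coeff g i) * z ^ i)"
      by (rule eval_ac_altdef) simp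
    also have "\<dots> = (\<Sum>i\<in>(\<lambda>j. ?p * j) ` {..?d div ?p}. to_ac (Polynomial.coeff g i) * z ^ i)"
    proof (rule sum.mono_neutral_right)
      show "(\<lambda>j. ?p * j) ` {..?d div ?p} \<subseteq> {..?d}"
        using p1 by (auto simp: less_eq_div_iff_mult_less_eq mult.commute)
      show "\<forall>i\<in>{..?d} - (\<lambda>j. ?p * j) ` {..?d div ?p}. to_ac (Polynomial.coeff g i) * z ^ i = 0"
      proof
        fix i assume i: "i \<in> {..?d} - (\<lambda>j. ?p * j) ` {..?d div ?p}"
        have "Polynomial.coeff g i = 0"
        proof (rule ccontr)
          assume "Polynomial.coeff g i \<noteq> 0"
          then have "?p dvd i" by (rule coeff_pderiv_eq_0_imp[OF pd])
          then have "i \<in> (\<lambda>j. ?p * j) ` {..?d div ?p}"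
            using i by (intro image_eqI[of _ _ "i div ?p"]) (auto intro: div_le_mono)
          then show False using i by blast
        qed
        then show "to_ac (Polynomial.coeff g i) * z ^ i = 0" by simp
      qed
    qed simp
    also have "\<dots> = eval_ac h (z ^ ?p)"
      using p1 by (subst sum.reindex) (auto simp: inj_on_def h_def eval_ac_sum eval_ac_monom power_mult)
    finally have "eval_ac h (z ^ ?p) = 0" using g(2) by simp
    then have h0: "h = 0" using powers_no_relation[OF inj ind' dh] by simp
    have "?p dvd ?d"
      using coeff_pderiv_eq_0_imp[OF pd] gnz by (simp add: leading_coeff_0_iff)
    moreover have "Polynomial.coeff h (?d div ?p) = Polynomial.coeff g (?p * (?d div ?p))"
      by (simp add: h_def coeff_sum)
    ultimately show False using h0 gnz by simp
  qed
  then have "rsquarefree (map_poly to_ac g)"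
    by (rule rsquarefree_if_pderiv_nonzero[OF g(1)])
  then show ?thesis using g by (auto simp: separable_element_def eval_ac_def)
qed

text \<open>
  Two separable elements lie in a common separable algebra, which is closed under the operations.
\<close>

lemma separable_closed:
  fixes x y :: "'k::field alg_closure"
  assumes p: "Factorial_Ring.prime CHAR('k)" and xy: "separable_element x" "separable_element y"
  shows "separable_element (x + y)" "separable_element (x * y)" "separable_element (to_ac c * x)"
    "separable_element (to_ac c)"
proof -
  obtain M where M: "separable_algebra M" "{x, y} \<subseteq> M"
    using ex_separable_algebra[OF p, of "{x, y}"] xy by auto
  have sub: "ac.subspace M" "1 \<in> M" "\<And>a b. a \<in> M \<Longrightarrow> b \<in> M \<Longrightarrow> a * b \<in> M"
    using M(1) by (auto simp: separable_algebra_def)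
  have "to_ac c * 1 \<in> M" by (rule ac.subspace_scale[OF sub(1,2)])
  then have "x + y \<in> M" "x * y \<in> M" "to_ac c * x \<in> M" "to_ac c \<in> M"
    using ac.subspace_add[OF sub(1)] ac.subspace_scale[OF sub(1)] sub(3) M(2) by auto
  then show "separable_element (x + y)" "separable_element (x * y)"
    "separable_element (to_ac c * x)" "separable_element (to_ac c)"
    using separable_algebra_imp_separable[OF p M(1)] by auto
qed

lemma separable_to_ac:
  assumes p: "Factorial_Ring.prime CHAR('k::field)"
  shows "separable_element (to_ac (c::'k))"
proof -
  obtain M where "separable_algebra (M :: 'k alg_closure set)"
    using ex_separable_algebra[OF p, of "{}"] by auto
  then have "separable_element (0 :: 'k alg_closure)"
    using separable_algebra_imp_separable[OF p] ac.subspace_0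
    by (auto simp: separable_algebra_def)
  then show ?thesis using separable_closed(4)[OF p] by blast
qed

lemma separable_diff:
  fixes x y :: "'k::field alg_closure"
  assumes p: "Factorial_Ring.prime CHAR('k)" and xy: "separable_element x" "separable_element y"
  shows "separable_element (x - y)"
proof -
  have "separable_element (x + to_ac (- 1) * y)"
    using separable_closed(1,3)[OF p] xy by blast
  then show ?thesis by simp
qed

lemma separable_sum:
  fixes f :: "'i \<Rightarrow> 'k::field alg_closure"
  assumes p: "Factorial_Ring.prime CHAR('k)" and "\<And>i. i \<in> I \<Longrightarrow> separable_element (f i)"
  shows "separable_element (\<Sum>i\<in>I. f i)"
  using assms(2)
proof (induction I rule: infinite_finite_induct)
  case (insert x I)
  then show ?case using separable_closed(1)[OF p] by simp
qed (use separable_to_ac[OF p, of 0] in simp_all)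

lemma separable_power:
  fixes x :: "'k::field alg_closure"
  assumes p: "Factorial_Ring.prime CHAR('k)" and x: "separable_element x"
  shows "separable_element (x ^ n)"
proof (induction n)
  case 0
  show ?case using separable_to_ac[OF p, of 1] by simp
next
  case (Suc n)
  then show ?case using separable_closed(2)[OF p x] by simp
qed

text \<open>
  An element of a separable algebra is a combination of \<open>Q\<close>-th powers with coefficients in the base
  field; expanding these coefficients in the basis \<open>T ^ i\<close> collects the \<open>Q\<close>-th powers.
\<close>

lemma separable_power_expansion:
  fixes x :: "'k::field alg_closure"
  assumes p: "Factorial_Ring.prime CHAR('k)" and Q: "Q = CHAR('k) ^ n" "power_basis T Q"
    and x: "separable_element x"
  shows "\<exists>u. (\<forall>i. separable_element (u i)) \<and> x = (\<Sum>i<Q. u i ^ Q * to_ac T ^ i)"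
proof -
  have p': "Factorial_Ring.prime CHAR('k alg_closure)" using p by simp
  note frob = power_CHAR_add[OF p', of _ _ n, unfolded CHAR_alg_closure, folded Q(1)]
  obtain M where M: "separable_algebra M" "x \<in> M"
    using ex_separable_algebra[OF p, of "{x}"] x by auto
  have sub: "ac.subspace M" using M(1) by (simp add: separable_algebra_def)
  have "M \<subseteq> ac.span ((\<lambda>x. x ^ Q) ` M)"
    using M(1) Q(1) by (simp add: separable_algebra_def powers_span_def)
  then have "x \<in> ac.span ((\<lambda>x. x ^ Q) ` M)" using M(2) by auto
  then have "\<exists>u. (\<forall>i. u i \<in> M) \<and> x = (\<Sum>i<Q. u i ^ Q * to_ac T ^ i)"
  proof (induction rule: ac.span_induct_alt)
    case base
    have "0 < Q" using Q(1) p prime_gt_0_nat by auto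
    then have "0 = (\<Sum>i<Q. (0::'k alg_closure) ^ Q * to_ac T ^ i)" by (simp add: zero_power)
    then show ?case by (intro exI[of _ "\<lambda>i. 0"]) (simp add: ac.subspace_0[OF sub])
  next
    case (step c y z)
    then obtain u where u: "\<And>i. u i \<in> M" "z = (\<Sum>i<Q. u i ^ Q * to_ac T ^ i)" by auto
    obtain m where m: "m \<in> M" "y = m ^ Q" using step.hyps by auto
    obtain d where d: "c = (\<Sum>i<Q. d i ^ Q * T ^ i)" using Q(2) unfolding power_basis_def by blast
    let ?v = "\<lambda>i. to_ac (d i) * m + u i"
    have "to_ac c * y + z = (\<Sum>i<Q. ?v i ^ Q * to_ac T ^ i)"
      unfolding d m(2) u(2)
      by (simp add: frob power_mult_distrib to_ac_sum sum_distrib_left sum_distrib_right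
          sum.distrib algebra_simps)
    moreover have "?v i \<in> M" for i
      using ac.subspace_add[OF sub ac.subspace_scale[OF sub m(1)] u(1)] .
    ultimately show ?case by (intro exI[of _ ?v]) simp
  qed
  then obtain u where "\<And>i. u i \<in> M" "x = (\<Sum>i<Q. u i ^ Q * to_ac T ^ i)" by auto
  then show ?thesis using separable_algebra_imp_separable[OF p M(1)] by (intro exI[of _ u]) simp
qed

text \<open>
  Expand the \<open>u i\<close> in a basis \<open>B\<close> over the base field. Since the \<open>Q\<close>-th powers of \<open>B\<close> remain
  independent, the relation splits into one relation over the base field for each element of \<open>B\<close>.
\<close>

lemma separable_power_expansion_unique:
  fixes u :: "nat \<Rightarrow> 'k::field alg_closure"
  assumes p: "Factorial_Ring.prime CHAR('k)" and Q: "Q = CHAR('k) ^ n" "power_basis T Q"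
    and u: "\<And>i. i < Q \<Longrightarrow> separable_element (u i)" and z: "(\<Sum>i<Q. u i ^ Q * to_ac T ^ i) = 0"
    and i: "i < Q"
  shows "u i = 0"
proof -
  have p': "Factorial_Ring.prime CHAR('k alg_closure)" using p by simp
  note frob = power_CHAR_sum[OF p', of _ _ n, unfolded CHAR_alg_closure, folded Q(1)]
  let ?\<phi> = "\<lambda>x::'k alg_closure. x ^ Q"
  obtain M where M: "separable_algebra M" "u ` {..<Q} \<subseteq> M"
    using ex_separable_algebra[OF p, of "u ` {..<Q}"] u by auto
  obtain B where B: "B \<subseteq> M" "ac.independent B" "M \<subseteq> ac.span B"
    using ac.maximal_independent_subset[of M] by auto
  obtain C where C: "finite C" "M \<subseteq> ac.span C" using M(1) by (auto simp: separable_algebra_def)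
  then have fin: "finite B"
    using ac.independent_span_bound[OF C(1) B(2)] B(1) by auto
  have inj: "inj_on ?\<phi> B"
    using inj_power_CHAR[OF p', of _ n] Q(1) by (auto intro: inj_onI)
  have ind: "ac.independent (?\<phi> ` B)"
    using separable_algebra_powers_independent[OF p M(1) B(1,2), of n] Q(1) by simp
  have "\<exists>c. u i = (\<Sum>b\<in>B. to_ac (c b) * b)" if "i < Q" for i
  proof -
    have "u i \<in> range (\<lambda>c. \<Sum>b\<in>B. to_ac (c b) * b)"
      using that M(2) B(3) unfolding ac.span_finite[OF fin] by auto
    then show ?thesis by (elim rangeE) (rule exI)
  qed
  then obtain c where c: "\<And>i. i < Q \<Longrightarrow> u i = (\<Sum>b\<in>B. to_ac (c i b) * b)"
    by metis
  have "(\<Sum>i<Q. u i ^ Q * to_ac T ^ i) = (\<Sum>i<Q. \<Sum>b\<in>B. to_ac (c i b ^ Q * T ^ i) * ?\<phi> b)"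
    by (intro sum.cong refl) (simp add: c frob power_mult_distrib sum_distrib_left algebra_simps)
  also have "\<dots> = (\<Sum>b\<in>B. to_ac (\<Sum>i<Q. c i b ^ Q * T ^ i) * ?\<phi> b)"
    by (subst sum.swap) (simp add: to_ac_sum sum_distrib_right)
  also have "\<dots> = (\<Sum>y\<in>?\<phi> ` B. to_ac (\<Sum>i<Q. c i (the_inv_into B ?\<phi> y) ^ Q * T ^ i) * y)"
    by (subst sum.reindex[OF inj]) (simp add: the_inv_into_f_f[OF inj])
  finally have z': "\<dots> = 0" using z by simp
  have "c i b = 0" if "b \<in> B" for b
  proof -
    have "(\<Sum>i<Q. c i b ^ Q * T ^ i) = 0"
      using ac.independentD[OF ind _ order_refl z', of "?\<phi> b"] that fin
      by (simp add: the_inv_into_f_f[OF inj])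
    then show ?thesis
      using conjunct2[OF Q(2)[unfolded power_basis_def], rule_format, of "\<lambda>i. c i b"] i by simp
  qed
  then show ?thesis using c[OF i] by simp
qed

section \<open>Substituting a matrix into a polynomial\<close>

text \<open>
  The iteration by which nilpotent matrices are defined, under a name of its own.
\<close>

definition mat_pow :: "'c::semiring_1^'t::finite^'t \<Rightarrow> nat \<Rightarrow> 'c^'t^'t" where
  "mat_pow M n = (((**) M) ^^ n) (mat 1)"

lemma mat_pow_0 [simp]: "mat_pow M 0 = mat 1"
  and mat_pow_Suc: "mat_pow M (Suc n) = M ** mat_pow M n"
  by (simp_all add: mat_pow_def)

lemma mat_pow_add: "mat_pow M (m + n) = mat_pow M m ** mat_pow M n"
  by (induction m) (simp_all add: mat_pow_Suc matrix_mul_assoc)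

lemma mat_mult_component: "((A::'c::semiring_1^'n^'m) ** B) $ i $ j = (\<Sum>k\<in>UNIV. A $ i $ k * B $ k $ j)"
  by (simp add: matrix_matrix_mult_def)

lemma matrix_add_rdistrib': "((A::'c::semiring_1^'n^'m) + B) ** C = A ** C + B ** C"
  by (simp add: vec_eq_iff mat_mult_component distrib_right sum.distrib)

lemma matrix_sum_ldistrib: "A ** (\<Sum>i\<in>I. B i) = (\<Sum>i\<in>I. (A::'c::semiring_1^'n^'m) ** B i)"
  by (induction I rule: infinite_finite_induct) (simp_all add: matrix_add_ldistrib)

lemma matrix_sum_rdistrib: "(\<Sum>i\<in>I. B i) ** A = (\<Sum>i\<in>I. (B i::'c::semiring_1^'n^'m) ** A)"
  by (induction I rule: infinite_finite_induct) (simp_all add: matrix_add_rdistrib')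

lemma mat_mult_left_component: "(mat c ** (A::'c::semiring_1^'n::finite^'m::finite)) $ i $ j = c * A $ i $ j"
  by (simp add: mat_mult_component mat_def if_distrib[of "\<lambda>x. x * _"] sum.delta cong: if_cong)

lemma mat_mult_right_component: "((A::'c::semiring_1^'n::finite^'m::finite) ** mat c) $ i $ j = A $ i $ j * c"
  by (simp add: mat_mult_component mat_def if_distrib[of "\<lambda>x. _ * x"] sum.delta' cong: if_cong)

lemma mat_commute: "mat c ** A = A ** mat (c::'c::comm_semiring_1)"
  by (simp add: vec_eq_iff mat_mult_left_component mat_mult_right_component mult.commute)

lemma mat_add: "mat a + mat b = (mat (a + b) :: 'c::monoid_add^'t^'t)"
  by (simp add: vec_eq_iff mat_def)

lemma mat_mult: "mat a ** mat b = (mat (a * b) :: 'c::semiring_1^'t::finite^'t)"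
  by (simp add: vec_eq_iff mat_mult_left_component) (simp add: mat_def)

lemma mat_eq_iff: "mat a = (mat b :: 'c::zero^'t::finite^'t) \<longleftrightarrow> a = b"
  by (auto simp: vec_eq_iff mat_def)

text \<open>
  Substitution of \<open>M\<close> is a ring homomorphism from the commutative ring of polynomials; it makes the
  additivity of \<open>Q\<close>-th powers available for matrices of the form \<open>scalar + N\<close>.
\<close>

definition poly_mat :: "'c::comm_ring_1^'t::finite^'t \<Rightarrow> 'c poly \<Rightarrow> 'c^'t^'t" where
  "poly_mat M P = fold_coeffs (\<lambda>a A. mat a + M ** A) P 0"

lemma poly_mat_0 [simp]: "poly_mat M 0 = 0"
  by (simp add: poly_mat_def)

lemma poly_mat_pCons: "poly_mat M (pCons a P) = mat a + M ** poly_mat M P"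
  by (cases "P = 0 \<and> a = 0") (auto simp: poly_mat_def)

lemma poly_mat_add: "poly_mat M (P + R) = poly_mat M P + poly_mat M R"
  by (induction P R rule: poly_induct2)
    (simp_all add: poly_mat_pCons mat_add[symmetric] matrix_add_ldistrib algebra_simps)

lemma poly_mat_smult: "poly_mat M (Polynomial.smult c P) = mat c ** poly_mat M P"
  by (induction P)
    (simp_all add: poly_mat_pCons mat_mult[symmetric] matrix_add_ldistrib matrix_mul_assoc mat_commute[of c M])

lemma poly_mat_mult: "poly_mat M (P * R) = poly_mat M P ** poly_mat M R"
  by (induction P)
    (simp_all add: poly_mat_pCons poly_mat_add poly_mat_smult matrix_add_rdistrib' matrix_mul_assoc)

lemma poly_mat_const: "poly_mat M [:c:] = mat c"
  by (simp add: poly_mat_pCons)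

lemma poly_mat_X: "poly_mat M [:0, 1:] = M"
  by (simp add: poly_mat_pCons)

lemma poly_mat_power: "poly_mat M (P ^ n) = mat_pow (poly_mat M P) n"
  by (induction n) (simp_all add: poly_mat_mult mat_pow_Suc poly_mat_const one_pCons)

lemma mat_pow_vec: "mat_pow N (m + n) *v v = mat_pow N m *v (mat_pow N n *v v)"
  by (simp add: mat_pow_add matrix_vector_mul_assoc)

text \<open>
  If \<open>k\<close> is the least exponent with \<open>N ^ k v = 0\<close>, then \<open>v, N v, \<dots>, N ^ (k - 1) v\<close> are linearly
  independent, so \<open>k\<close> is at most the dimension. The point is that one exponent serves for all
  nilpotent matrices.
\<close>

lemma nilpotent_mat_pow_CARD:
  fixes N :: "'c::field^'t::finite^'t"
  assumes "nilpotent_mat N" "CARD('t) \<le> m"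
  shows "mat_pow N m = 0"
proof -
  have "mat_pow N CARD('t) *v v = 0" for v
  proof (rule ccontr)
    assume v: "mat_pow N CARD('t) *v v \<noteq> 0"
    define w where "w i = mat_pow N i *v v" for i
    obtain n where "mat_pow N n = 0" using assms(1) by (auto simp: nilpotent_mat_def mat_pow_def)
    then have "w n = 0" by (simp add: w_def)
    define k where "k = (LEAST i. w i = 0)"
    have k: "w k = 0" "\<And>i. i < k \<Longrightarrow> w i \<noteq> 0"
      unfolding k_def using \<open>w n = 0\<close> by (auto intro: LeastI dest: not_less_Least)
    have shift: "mat_pow N i *v w j = w (i + j)" for i j
      by (simp add: w_def mat_pow_vec)
    have w0: "w i = 0" if "i \<ge> k" for i
      using shift[of "i - k" k] k(1) that by simp
    have "k > CARD('t)"
      using w0[of "CARD('t)"] v by (force simp: w_def)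
    have "vec.independent (w ` {k - j..<k}) \<and> card (w ` {k - j..<k}) = j" if "j \<le> k" for j
      using that
    proof (induction j)
      case (Suc j)
      \<comment> \<open>\<open>N ^ j\<close> kills the later vectors of the chain but not \<open>w (k - Suc j)\<close>.\<close>
      have "vec.span (w ` {k - j..<k}) \<subseteq> {x. mat_pow N j *v x = 0}"
      proof (rule vec.span_minimal)
        show "w ` {k - j..<k} \<subseteq> {x. mat_pow N j *v x = 0}"
          using w0 by (auto simp: shift)
        show "vec.subspace {x. mat_pow N j *v x = 0}"
          by (rule vec.subspaceI) (simp_all add: vec.add vec.scale)
      qed
      moreover have "mat_pow N j *v w (k - Suc j) \<noteq> 0"
        using k(2)[of "k - 1"] Suc.prems by (simp add: shift)
      ultimately have "w (k - Suc j) \<notin> vec.span (w ` {k - j..<k})" by blast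
      moreover from this have "w (k - Suc j) \<notin> w ` {k - j..<k}"
        using vec.span_base by blast
      moreover have "{k - Suc j..<k} = insert (k - Suc j) {k - j..<k}"
        using Suc.prems by auto
      ultimately show ?case
        using Suc by (simp add: vec.independent_insertI)
    qed (simp add: vec.independent_empty)
    from this[of k] have "vec.independent (w ` {0..<k})" "card (w ` {0..<k}) = k" by auto
    then have "k \<le> vec.dim (UNIV :: ('c^'t) set)"
      using vec.independent_card_le_dim[of "w ` {0..<k}" UNIV] by simp
    then show False
      using \<open>k > CARD('t)\<close> by (simp only: vec.dim_UNIV card_cart_basis)
  qed
  then have "mat_pow N CARD('t) = 0" by (subst matrix_eq) simp
  then show ?thesis
    using mat_pow_add[of N "m - CARD('t)" "CARD('t)"] assms(2) by simp
qed

section \<open>Extending the tangent action to the separable closure\<close>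

text \<open>
  An expansion \<open>\<Sum>i. u i ^ Q * T ^ i\<close> is encoded by the polynomial \<open>V\<close> with coefficients \<open>u i\<close>,
  of arbitrary degree. Then \<open>poly (twist (\<lambda>x. x) Q V) T\<close> is the value of the expansion, and
  \<open>twist \<iota> Q V\<close>, with \<open>\<theta> + N\<close> substituted for the variable, is the matrix to be assigned to it. Both
  are ring homomorphisms in \<open>V\<close>, and it remains to compare their kernels.
\<close>

definition sep_coeffs :: "'k::field alg_closure poly \<Rightarrow> bool" where
  "sep_coeffs V \<longleftrightarrow> (\<forall>i. separable_element (Polynomial.coeff V i))"

definition twist :: "('a::field \<Rightarrow> 'b::field) \<Rightarrow> nat \<Rightarrow> 'a poly \<Rightarrow> 'b poly" where
  "twist h Q V = map_poly (\<lambda>u. h (u ^ Q)) V"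

lemma field_embedding_simps:
  assumes "field_embedding h"
  shows "h 0 = 0" "h 1 = 1" "h (x + y) = h x + h y" "h (x * y) = h x * h y" "h (- x) = - h x"
    "h (x - y) = h x - h y" "h (x ^ n) = h x ^ n" "h x = h y \<longleftrightarrow> x = y" "h x = 0 \<longleftrightarrow> x = 0"
proof -
  have h: "h 1 = 1" "\<And>x y. h (x + y) = h x + h y" "\<And>x y. h (x * y) = h x * h y"
    using assms by (auto simp: field_embedding_def)
  have "h 0 + h 0 = h 0 + 0" using h(2)[of 0 0] by (simp only: add_0_right)
  then show h0: "h 0 = 0" by (simp only: add_left_cancel)
  have neg: "h (- x) = - h x" for x
    using h(2)[of x "- x"] h0 by (simp add: minus_unique)
  have diff: "h (x - y) = h x - h y" for x y using h(2)[of x "- y"] neg by simp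
  have z: "h x = 0 \<longleftrightarrow> x = 0" for x
    using h(3)[of x "inverse x"] h(1) h0 by (cases "x = 0") auto
  show "h 1 = 1" "h (x + y) = h x + h y" "h (x * y) = h x * h y" "h (- x) = - h x"
    "h (x - y) = h x - h y" "h x = 0 \<longleftrightarrow> x = 0" by (fact h neg diff z)+
  show "h (x ^ n) = h x ^ n" by (induction n) (simp_all add: h)
  show "h x = h y \<longleftrightarrow> x = y" using z[of "x - y"] diff by simp
qed

lemma CHAR_field_embedding:
  assumes h: "field_embedding (h :: 'a::field \<Rightarrow> 'b::field)"
  shows "CHAR('b) = CHAR('a)"
proof (rule CHAR_eqI)
  have nat: "h (of_nat n) = of_nat n" for n
    by (induction n) (simp_all add: field_embedding_simps[OF h])
  show "of_nat CHAR('a) = (0::'b)" using nat[of "CHAR('a)"] by (simp add: field_embedding_simps[OF h])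
  fix n assume "of_nat n = (0::'b)"
  then have "of_nat n = (0::'a)" using nat[of n] field_embedding_simps(9)[OF h] by metis
  then show "CHAR('a) dvd n" by (simp add: of_nat_eq_0_iff_char_dvd)
qed

lemma twist_pCons:
  assumes "field_embedding h" "Q > 0"
  shows "twist h Q (pCons a V) = pCons (h a ^ Q) (twist h Q V)" "twist h Q 0 = 0"
  using assms by (simp_all add: twist_def map_poly_pCons field_embedding_simps zero_power)

lemma twist_hom:
  fixes h :: "'a::field \<Rightarrow> 'b::field"
  assumes h: "field_embedding h" and p: "Factorial_Ring.prime CHAR('b)" and Q: "Q = CHAR('b) ^ n"
  shows "twist h Q (V + W) = twist h Q V + twist h Q W"
    and "twist h Q (V * W) = twist h Q V * twist h Q W"
    and "twist h Q (V - W) = twist h Q V - twist h Q W"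
proof -
  have Q0: "Q > 0" using Q p prime_gt_0_nat by auto
  note tw = twist_pCons[OF h Q0]
  note frob = power_CHAR_add[OF p, of _ _ n, folded Q]
  have add: "twist h Q (V + W) = twist h Q V + twist h Q W" for V W
    by (induction V W rule: poly_induct2) (simp_all add: tw frob field_embedding_simps[OF h])
  have smult: "twist h Q (Polynomial.smult c W) = Polynomial.smult (h c ^ Q) (twist h Q W)" for c W
    by (induction W) (simp_all add: tw power_mult_distrib field_embedding_simps[OF h])
  show "twist h Q (V * W) = twist h Q V * twist h Q W"
    by (induction V) (simp_all add: tw add smult field_embedding_simps[OF h] Q0 zero_power)
  show "twist h Q (V + W) = twist h Q V + twist h Q W" by (rule add)
  show "twist h Q (V - W) = twist h Q V - twist h Q W"
    using add[of "V - W" W] by (simp add: algebra_simps)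
qed

lemma field_embedding_id: "field_embedding (\<lambda>x. x)"
  by (simp add: field_embedding_def)

lemma sep_coeffs_hom:
  fixes V W :: "'k::field alg_closure poly"
  assumes p: "Factorial_Ring.prime CHAR('k)" and "sep_coeffs V" "sep_coeffs W"
  shows "sep_coeffs (V + W)" "sep_coeffs (V * W)" "sep_coeffs (V - W)"
  using assms separable_closed(1,2)[OF p] separable_diff[OF p]
  by (auto simp: sep_coeffs_def coeff_mult intro!: separable_sum[OF p])

lemma sep_coeffs_pCons:
  assumes p: "Factorial_Ring.prime CHAR('k)"
  shows "sep_coeffs (pCons (a::'k::field alg_closure) V) \<longleftrightarrow> separable_element a \<and> sep_coeffs V"
proof
  assume s: "sep_coeffs (pCons a V)"
  show "separable_element a \<and> sep_coeffs V"
    using s[unfolded sep_coeffs_def, rule_format, of 0] s[unfolded sep_coeffs_def, rule_format, of "Suc _"]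
    by (simp add: sep_coeffs_def)
qed (auto simp: sep_coeffs_def coeff_pCons split: nat.split)

lemma sep_coeffs_0:
  assumes p: "Factorial_Ring.prime CHAR('k)"
  shows "sep_coeffs (0::'k::field alg_closure poly)"
  using separable_to_ac[OF p, of 0] by (simp add: sep_coeffs_def)

lemma poly_twist_sum:
  assumes "field_embedding h" "Q > 0" "Polynomial.degree V < Q"
  shows "poly (twist h Q V) t = (\<Sum>i<Q. h (Polynomial.coeff V i) ^ Q * t ^ i)"
proof -
  have h0: "h (0 ^ Q) = 0" using assms(1,2) by (simp add: field_embedding_simps zero_power)
  have "Polynomial.degree (twist h Q V) \<le> Polynomial.degree V"
    unfolding twist_def by (rule map_poly_degree_leq)
  then have "poly (twist h Q V) t = (\<Sum>i<Q. Polynomial.coeff (twist h Q V) i * t ^ i)"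
    unfolding poly_altdef using assms(3)
    by (intro sum.mono_neutral_left) (auto simp: coeff_eq_0)
  then show ?thesis
    by (simp add: twist_def coeff_map_poly h0 field_embedding_simps[OF assms(1)])
qed

lemma sep_coeffs_const:
  assumes p: "Factorial_Ring.prime CHAR('k)"
  shows "sep_coeffs [:a::'k::field alg_closure:] \<longleftrightarrow> separable_element a"
  by (simp add: sep_coeffs_pCons[OF p] sep_coeffs_0[OF p])

lemma sep_coeffs_monom:
  assumes p: "Factorial_Ring.prime CHAR('k)" and "separable_element (a::'k::field alg_closure)"
  shows "sep_coeffs (Polynomial.monom a n)"
  unfolding sep_coeffs_def using assms(2) separable_to_ac[OF p, of 0] by simp

text \<open>
  Division by the monic polynomial \<open>X ^ Q - T\<close>, carried out by hand to see that the remainder has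
  separable coefficients again. Its twist is \<open>X ^ Q - T ^ Q\<close>, which vanishes at \<open>T\<close>.
\<close>

lemma sep_coeffs_mod_binomial:
  fixes V :: "'k::field alg_closure poly"
  assumes p: "Factorial_Ring.prime CHAR('k)" and V: "sep_coeffs V" and Q: "Q > 0"
  shows "\<exists>W V0. V = W * (Polynomial.monom 1 Q - [:to_ac T:]) + V0 \<and> sep_coeffs V0 \<and>
    Polynomial.degree V0 < Q"
  using V
proof (induction V)
  case 0
  show ?case using Q by (intro exI[of _ 0]) (simp add: sep_coeffs_0[OF p])
next
  case (pCons a V)
  let ?m = "Polynomial.monom 1 Q - [:to_ac T:]"
  have a: "separable_element a" "sep_coeffs V"
    using pCons.prems by (auto simp: sep_coeffs_pCons[OF p])
  then obtain W V0 where W: "V = W * ?m + V0" "sep_coeffs V0" "Polynomial.degree V0 < Q"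
    using pCons.IH by blast
  let ?R = "pCons a V0"
  let ?c = "Polynomial.coeff ?R Q"
  let ?V0 = "?R - [:?c:] * ?m"
  have m: "sep_coeffs ?m" "Polynomial.degree ?m \<le> Q" "Polynomial.coeff ?m Q = 1"
    using separable_to_ac[OF p, of 1] separable_to_ac[OF p, of T] Q
    by (auto simp: coeff_pCons sep_coeffs_const[OF p] degree_monom_le split: nat.split
        intro!: sep_coeffs_hom[OF p] sep_coeffs_monom[OF p] degree_diff_le)
  have R: "sep_coeffs ?R" using a W(2) by (simp add: sep_coeffs_pCons[OF p])
  then have "separable_element ?c" by (simp only: sep_coeffs_def)
  then have "sep_coeffs ?V0"
    using sep_coeffs_const[OF p, of ?c]
    by (intro sep_coeffs_hom(3)[OF p R] sep_coeffs_hom(2)[OF p _ m(1)]) simp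
  moreover have "Polynomial.degree ?V0 < Q"
  proof -
    have "Polynomial.degree ?R \<le> Q" using W(3) by (simp add: degree_pCons_eq_if)
    moreover have "Polynomial.degree ([:?c:] * ?m) \<le> Q"
      using m(2) degree_smult_le[of ?c ?m] by simp
    ultimately have "Polynomial.degree ?V0 \<le> Q" by (rule degree_diff_le)
    moreover have "Polynomial.coeff ?V0 Q = 0" using m(3) by simp
    then have "Polynomial.degree ?V0 \<noteq> Q"
      using Q leading_coeff_0_iff[of ?V0] by (metis degree_0 less_numeral_extra(3))
    ultimately show ?thesis by simp
  qed
  moreover have "pCons a V = (pCons 0 W + [:?c:]) * ?m + ?V0"
    unfolding W(1) by (simp add: algebra_simps)
  ultimately show ?case by blast
qed

lemma linear_power_CHAR:
  fixes \<theta> :: "'c::field"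
  assumes p: "Factorial_Ring.prime CHAR('c)" and Q: "Q = CHAR('c) ^ n"
  shows "[:- \<theta>, 1:] ^ Q = Polynomial.monom 1 Q - [:\<theta> ^ Q:]"
proof -
  have p': "Factorial_Ring.prime CHAR('c poly)" using p by simp
  have "[:- \<theta>, 1:] ^ Q = ([:0, 1:] - [:\<theta>:]) ^ Q" by simp
  also have "\<dots> = [:0, 1:] ^ Q - [:\<theta>:] ^ Q"
    using power_CHAR_diff[OF p', of "[:0, 1:]" "[:\<theta>:]" n] Q by simp
  finally show ?thesis by (simp add: monom_altdef poly_const_pow)
qed

text \<open>
  Modulo \<open>X ^ Q - T\<close> the degree of \<open>V\<close> drops below \<open>Q\<close>, where an expansion with value \<open>0\<close> is trivial.
  So \<open>V\<close> is a multiple of \<open>X ^ Q - T\<close>, and the twist of the latter by \<open>\<iota>\<close> is \<open>(X - \<theta>) ^ Q\<close>.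
\<close>

lemma twist_kernel:
  fixes \<iota> :: "'k::field alg_closure \<Rightarrow> 'c::field"
  assumes p: "Factorial_Ring.prime CHAR('k)" and Q: "Q = CHAR('k) ^ n" "power_basis T Q"
    and h: "field_embedding \<iota>" and V: "sep_coeffs V"
    and z: "poly (twist (\<lambda>x. x) Q V) (to_ac T) = 0"
  shows "[:- \<iota> (to_ac T), 1:] ^ Q dvd twist \<iota> Q V"
proof -
  have Q0: "Q > 0" using Q(1) p prime_gt_0_nat by auto
  have Ch: "CHAR('c) = CHAR('k)" using CHAR_field_embedding[OF h] by simp
  let ?m = "Polynomial.monom 1 Q - [:to_ac T:]"
  obtain W V0 where W: "V = W * ?m + V0" "sep_coeffs V0" "Polynomial.degree V0 < Q"
    using sep_coeffs_mod_binomial[OF p V Q0] by blast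
  have th: "twist g Q (A + B) = twist g Q A + twist g Q B"
      "twist g Q (A * B) = twist g Q A * twist g Q B"
      "twist g Q ?m = Polynomial.monom 1 Q - [:g (to_ac T) ^ Q:]"
    if g: "field_embedding g" "CHAR('d) = CHAR('k)" for g :: "'k alg_closure \<Rightarrow> 'd::field" and A B
  proof -
    have p': "Factorial_Ring.prime CHAR('d)" and Q': "Q = CHAR('d) ^ n" using p g(2) Q(1) by auto
    show "twist g Q (A + B) = twist g Q A + twist g Q B"
      "twist g Q (A * B) = twist g Q A * twist g Q B"
      by (rule twist_hom[OF g(1) p' Q'])+
    have "twist g Q (Polynomial.monom 1 Q) = Polynomial.monom 1 Q"
      unfolding twist_def using Q0
      by (subst map_poly_monom) (simp_all add: field_embedding_simps[OF g(1)] zero_power)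
    then show "twist g Q ?m = Polynomial.monom 1 Q - [:g (to_ac T) ^ Q:]"
      by (simp add: twist_hom(3)[OF g(1) p' Q'] twist_pCons[OF g(1) Q0])
  qed
  note thi = th[OF field_embedding_id CHAR_alg_closure]
  have z0: "poly (twist (\<lambda>x. x) Q V0) (to_ac T) = 0"
    using z unfolding W(1) thi by (simp add: poly_monom)
  have "V0 = 0"
  proof (rule poly_eqI)
    fix i
    show "Polynomial.coeff V0 i = Polynomial.coeff 0 i"
    proof (cases "i < Q")
      case True
      then show ?thesis
        using separable_power_expansion_unique[OF p Q _ _ True, of "Polynomial.coeff V0"] z0 W(2)
        by (simp add: poly_twist_sum[OF field_embedding_id Q0 W(3)] sep_coeffs_def)
    qed (use W(3) in \<open>simp add: coeff_eq_0\<close>)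
  qed
  then have "twist \<iota> Q V = twist \<iota> Q W * (Polynomial.monom 1 Q - [:\<iota> (to_ac T) ^ Q:])"
    unfolding W(1) th[OF h Ch] by (simp add: twist_pCons[OF h Q0])
  moreover have "[:- \<iota> (to_ac T), 1:] ^ Q = Polynomial.monom 1 Q - [:\<iota> (to_ac T) ^ Q:]"
    using linear_power_CHAR[of Q n "\<iota> (to_ac T)"] p Q(1) Ch by simp
  ultimately show ?thesis by simp
qed

lemma ex_twist_representation:
  fixes x :: "'k::field alg_closure"
  assumes p: "Factorial_Ring.prime CHAR('k)" and Q: "Q = CHAR('k) ^ n" "power_basis T Q"
    and x: "separable_element x"
  shows "\<exists>V. sep_coeffs V \<and> poly (twist (\<lambda>x. x) Q V) (to_ac T) = x"
proof -
  have Q0: "Q > 0" using Q(1) p prime_gt_0_nat by auto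
  obtain u where u: "\<And>i. separable_element (u i)" "x = (\<Sum>i<Q. u i ^ Q * to_ac T ^ i)"
    using separable_power_expansion[OF p Q x] by auto
  let ?V = "\<Sum>i<Q. Polynomial.monom (u i) i"
  have c: "Polynomial.coeff ?V i = (if i < Q then u i else 0)" for i
    by (simp add: coeff_sum)
  then have "sep_coeffs ?V"
    using u(1) separable_to_ac[OF p, of 0] by (simp add: sep_coeffs_def)
  moreover have "Polynomial.degree ?V < Q"
    using Q0 by (intro degree_lessI) (auto simp: c)
  then have "poly (twist (\<lambda>x. x) Q ?V) (to_ac T) = x"
    using u(2) by (simp add: poly_twist_sum[OF field_embedding_id Q0] c)
  ultimately show ?thesis by blast
qed

text \<open>
  The identity \<open>X ^ Q = (X - c) ^ Q + c ^ Q\<close>, evaluated at \<open>c + N\<close>.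
\<close>

lemma scalar_plus_nilpotent_power:
  fixes N :: "'c::field^'t::finite^'t"
  assumes p: "Factorial_Ring.prime CHAR('c)" and Q: "Q = CHAR('c) ^ n" "CARD('t) \<le> Q"
    and N: "nilpotent_mat N"
  shows "poly_mat (mat c + N) ([:- c, 1:] ^ Q) = 0" "mat_pow (mat c + N) Q = mat (c ^ Q)"
proof -
  have "poly_mat (mat c + N) [:- c, 1:] = (mat (- c) + mat c) + N"
    by (simp add: poly_mat_pCons add.assoc)
  then have "poly_mat (mat c + N) [:- c, 1:] = N" by (simp only: mat_add) simp
  then show z: "poly_mat (mat c + N) ([:- c, 1:] ^ Q) = 0"
    using nilpotent_mat_pow_CARD[OF N Q(2)] by (simp only: poly_mat_power)
  have "[:0, 1:] ^ Q = [:- c, 1:] ^ Q + [:c ^ Q:]"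
    by (simp add: linear_power_CHAR[OF p Q(1)] monom_altdef)
  then have "poly_mat (mat c + N) ([:0, 1:] ^ Q) = mat (c ^ Q)"
    by (simp only: poly_mat_add z poly_mat_const add_0)
  then show "mat_pow (mat c + N) Q = mat (c ^ Q)"
    by (simp only: poly_mat_power poly_mat_X)
qed

lemma nilpotent_mat_iff: "nilpotent_mat N \<longleftrightarrow> (\<exists>n. mat_pow N n = 0)"
  by (simp add: nilpotent_mat_def mat_pow_def)

text \<open>
  A polynomial that vanishes at \<open>c\<close> has the factor \<open>X - c\<close>, which becomes \<open>N\<close>.
\<close>

lemma poly_mat_nilpotent:
  fixes N :: "'c::field^'t::finite^'t"
  assumes p: "Factorial_Ring.prime CHAR('c)" and Q: "Q = CHAR('c) ^ n" "CARD('t) \<le> Q"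
    and N: "nilpotent_mat N" and P: "poly P c = 0"
  shows "nilpotent_mat (poly_mat (mat c + N) P)"
proof -
  obtain R where R: "P = [:- c, 1:] * R" using P by (auto simp: poly_eq_0_iff_dvd)
  have "mat_pow (poly_mat (mat c + N) P) Q = poly_mat (mat c + N) ([:- c, 1:] ^ Q * R ^ Q)"
    by (simp only: poly_mat_power[symmetric] R power_mult_distrib)
  also have "\<dots> = 0"
    by (simp only: poly_mat_mult scalar_plus_nilpotent_power[OF p Q N]) simp
  finally show ?thesis using nilpotent_mat_iff by blast
qed

text \<open>
  The properties that single out \<open>x \<mapsto> E\<^sub>x\<^sub>,\<^sub>*\<close>. The function is constrained only on the separable
  elements.
\<close>

definition tangent_extension ::
  "('k::field alg_closure \<Rightarrow> 'c::field) \<Rightarrow> 'k \<Rightarrow> 'c^'t::finite^'t \<Rightarrow> ('k alg_closure \<Rightarrow> 'c^'t^'t) \<Rightarrow> bool" where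
  "tangent_extension \<iota> T M D \<longleftrightarrow> D 1 = mat 1 \<and> D (to_ac T) = M \<and>
     (\<forall>x y. separable_element x \<longrightarrow> separable_element y \<longrightarrow>
       D (x + y) = D x + D y \<and> D (x * y) = D x ** D y) \<and>
     (\<forall>x. separable_element x \<longrightarrow> (\<exists>N. nilpotent_mat N \<and> D x = mat (\<iota> x) + N))"

lemma tangent_extensionD:
  assumes "tangent_extension \<iota> T M D"
  shows "D 1 = mat 1" "D (to_ac T) = M"
    and "separable_element x \<Longrightarrow> separable_element y \<Longrightarrow> D (x + y) = D x + D y"
    and "separable_element x \<Longrightarrow> separable_element y \<Longrightarrow> D (x * y) = D x ** D y"
    and "separable_element x \<Longrightarrow> \<exists>N. nilpotent_mat N \<and> D x = mat (\<iota> x) + N"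
  using assms by (simp_all add: tangent_extension_def)

lemma tangent_extension_power:
  fixes \<iota> :: "'k::field alg_closure \<Rightarrow> 'c::field" and M :: "'c^'t::finite^'t"
  assumes p: "Factorial_Ring.prime CHAR('k)" and Q: "Q = CHAR('c) ^ n" "CARD('t) \<le> Q"
    and h: "field_embedding \<iota>" and D: "tangent_extension \<iota> T M D" and x: "separable_element x"
  shows "mat_pow (D x) Q = mat (\<iota> x ^ Q)" "D (x ^ Q) = mat (\<iota> x ^ Q)"
proof -
  note D' = tangent_extensionD[OF D]
  have pc: "Factorial_Ring.prime CHAR('c)" using p CHAR_field_embedding[OF h] by simp
  obtain N where "nilpotent_mat N" "D x = mat (\<iota> x) + N" using D'(5)[OF x] by blast
  then show mp: "mat_pow (D x) Q = mat (\<iota> x ^ Q)"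
    using scalar_plus_nilpotent_power(2)[OF pc Q, of N "\<iota> x"] by simp
  have "D (x ^ m) = mat_pow (D x) m" for m
    by (induction m) (simp_all add: D'(1) D'(4)[OF x separable_power[OF p x]] mat_pow_Suc)
  then show "D (x ^ Q) = mat (\<iota> x ^ Q)" using mp by simp
qed

text \<open>
  By \<open>twist_kernel\<close>, expansions with the same value differ, after twisting, by a multiple of
  \<open>(X - \<theta>) ^ Q\<close>; this becomes \<open>N ^ Q = 0\<close>, so the matrix depends on the value alone. It differs
  from the scalar \<open>\<iota> x\<close> by the substitution into a polynomial vanishing at \<open>\<theta>\<close>, which is nilpotent.
\<close>

lemma ex_tangent_extension:
  fixes \<iota> :: "'k::field alg_closure \<Rightarrow> 'c::field" and N :: "'c^'t::finite^'t"
  assumes p: "Factorial_Ring.prime CHAR('k)" and Q: "Q = CHAR('k) ^ n" "power_basis T Q"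
    and h: "field_embedding \<iota>" and N: "nilpotent_mat N" "CARD('t) \<le> Q"
  shows "\<exists>D. tangent_extension \<iota> T (mat (\<iota> (to_ac T)) + N) D"
proof -
  have Q0: "Q > 0" using Q(1) p prime_gt_0_nat by auto
  have Ch: "CHAR('c) = CHAR('k)" using CHAR_field_embedding[OF h] by simp
  have pc: "Factorial_Ring.prime CHAR('c)" "Q = CHAR('c) ^ n" using p Q(1) Ch by auto
  have pk: "Factorial_Ring.prime CHAR('k alg_closure)" "Q = CHAR('k alg_closure) ^ n"
    using p Q(1) by auto
  let ?\<theta> = "\<iota> (to_ac T)"
  let ?M = "mat ?\<theta> + N"
  let ?val = "\<lambda>V. poly (twist (\<lambda>x. x) Q V) (to_ac T)"
  let ?mat = "\<lambda>V. poly_mat ?M (twist \<iota> Q V)"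
  note thi = twist_hom[OF field_embedding_id pk] and thc = twist_hom[OF h pc]
  define D where "D x = ?mat (SOME V. sep_coeffs V \<and> ?val V = x)" for x
  have D: "D (?val V) = ?mat V" if V: "sep_coeffs V" for V
  proof -
    define W where "W = (SOME W. sep_coeffs W \<and> ?val W = ?val V)"
    have W: "sep_coeffs W \<and> ?val W = ?val V"
      unfolding W_def by (rule someI[of _ V]) (simp add: V)
    then have "[:- ?\<theta>, 1:] ^ Q dvd twist \<iota> Q (W - V)"
      using V by (intro twist_kernel[OF p Q h] sep_coeffs_hom[OF p]) (auto simp: thi)
    then obtain R where "twist \<iota> Q (W - V) = [:- ?\<theta>, 1:] ^ Q * R" by (rule dvdE)
    then have "twist \<iota> Q W = twist \<iota> Q V + [:- ?\<theta>, 1:] ^ Q * R"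
      by (simp only: thc) (simp add: algebra_simps)
    then have "?mat W = ?mat V"
      by (simp only: poly_mat_add poly_mat_mult scalar_plus_nilpotent_power[OF pc N(2,1)]) simp
    then show ?thesis by (simp only: D_def W_def[symmetric])
  qed
  have rep: "\<exists>V. sep_coeffs V \<and> x = ?val V" if "separable_element x" for x
    using ex_twist_representation[OF p Q that] by blast
  have const: "D (x ^ Q) = mat (\<iota> x ^ Q)" if "separable_element x" for x
    using D[of "[:x:]"] that
    by (simp add: sep_coeffs_const[OF p] twist_pCons[OF field_embedding_id Q0] twist_pCons[OF h Q0]
        poly_mat_const)
  have "tangent_extension \<iota> T ?M D"
    unfolding tangent_extension_def
  proof (intro conjI allI impI)
    have s1: "separable_element (1::'k alg_closure)" and s0: "separable_element (0::'k alg_closure)"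
      using separable_to_ac[OF p, of 1] separable_to_ac[OF p, of 0] by simp_all
    show "D 1 = mat 1" using const[OF s1] by (simp add: field_embedding_simps[OF h])
    have "sep_coeffs [:0, 1 :: 'k alg_closure:]"
      using s0 s1 by (simp add: sep_coeffs_pCons[OF p] sep_coeffs_0[OF p])
    from D[OF this] show "D (to_ac T) = mat (\<iota> (to_ac T)) + N"
      using Q0 by (simp add: twist_pCons[OF field_embedding_id Q0] twist_pCons[OF h Q0]
          field_embedding_simps[OF h] zero_power poly_mat_X)
    fix x assume "separable_element (x :: 'k alg_closure)"
    then obtain V where V: "sep_coeffs V" "x = ?val V" using rep by blast
    have "poly (twist \<iota> Q V - [:\<iota> x:]) ?\<theta> = 0"
    proof -
      have "poly (twist \<iota> Q V) ?\<theta> = \<iota> (?val V)"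
        by (induction V) (simp_all add: twist_pCons[OF field_embedding_id Q0] twist_pCons[OF h Q0]
            field_embedding_simps[OF h])
      then show ?thesis using V(2) by simp
    qed
    then have "nilpotent_mat (poly_mat ?M (twist \<iota> Q V - [:\<iota> x:]))"
      by (rule poly_mat_nilpotent[OF pc N(2,1)])
    moreover have "D x = mat (\<iota> x) + poly_mat ?M (twist \<iota> Q V - [:\<iota> x:])"
      using D[OF V(1)] poly_mat_add[of ?M "[:\<iota> x:]" "twist \<iota> Q V - [:\<iota> x:]"]
      by (simp add: V(2)[symmetric] poly_mat_const)
    ultimately show "\<exists>N'. nilpotent_mat N' \<and> D x = mat (\<iota> x) + N'" by blast
    fix y assume "separable_element (y :: 'k alg_closure)"
    then obtain W where W: "sep_coeffs W" "y = ?val W" using rep by blast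
    have "D (x + y) = ?mat (V + W)"
      using D[OF sep_coeffs_hom(1)[OF p V(1) W(1)]] by (simp add: thi V(2) W(2))
    then show "D (x + y) = D x + D y"
      by (simp add: D V W thc poly_mat_add)
    have "D (x * y) = ?mat (V * W)"
      using D[OF sep_coeffs_hom(2)[OF p V(1) W(1)]] by (simp add: thi V(2) W(2))
    then show "D (x * y) = D x ** D y"
      by (simp add: D V W thc poly_mat_mult)
  qed
  then show ?thesis by blast
qed

text \<open>
  The value on a \<open>Q\<close>-th power and the value on \<open>T\<close> are prescribed, which fixes the value on every
  expansion.
\<close>

lemma tangent_extension_val:
  fixes \<iota> :: "'k::field alg_closure \<Rightarrow> 'c::field" and M :: "'c^'t::finite^'t"
  assumes p: "Factorial_Ring.prime CHAR('k)" and Q: "Q = CHAR('c) ^ n" "CARD('t) \<le> Q"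
    and h: "field_embedding \<iota>" and D: "tangent_extension \<iota> T M D" and V: "sep_coeffs V"
  shows "separable_element (poly (twist (\<lambda>x. x) Q V) (to_ac T)) \<and>
    D (poly (twist (\<lambda>x. x) Q V) (to_ac T)) = poly_mat M (twist \<iota> Q V)"
  using V
proof (induction V)
  have pc: "Factorial_Ring.prime CHAR('c)" using p CHAR_field_embedding[OF h] by simp
  have Q0: "Q > 0" using Q(1) pc prime_gt_0_nat by auto
  note tw = twist_pCons[OF field_embedding_id Q0] twist_pCons[OF h Q0]
  note D' = tangent_extensionD[OF D]
  {
    case 0
    have "separable_element (0 :: 'k alg_closure)" using separable_to_ac[OF p, of 0] by simp
    moreover from D'(3)[OF this this] have "D 0 = 0" by simp
    ultimately show ?case by (simp add: tw)
  next
    case (pCons a V)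
    let ?v = "poly (twist (\<lambda>x. x) Q V) (to_ac T)"
    have a: "separable_element a" "separable_element ?v" "D ?v = poly_mat M (twist \<iota> Q V)"
      using pCons by (auto simp: sep_coeffs_pCons[OF p])
    note sep = separable_power[OF p a(1), of Q] separable_to_ac[OF p, of T]
      separable_closed(2)[OF p separable_to_ac[OF p, of T] a(2)]
    show ?case
      using a(3) separable_closed(1)[OF p sep(1,3)]
      by (simp add: tw D'(3)[OF sep(1,3)] D'(4)[OF sep(2) a(2)] D'(2) poly_mat_pCons
          tangent_extension_power(2)[OF p Q h D a(1)])
  }
qed

lemma tangent_extension_unique:
  fixes \<iota> :: "'k::field alg_closure \<Rightarrow> 'c::field" and M :: "'c^'t::finite^'t"
  assumes p: "Factorial_Ring.prime CHAR('k)" and Q: "Q = CHAR('k) ^ n" "power_basis T Q"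
    and h: "field_embedding \<iota>" and card: "CARD('t) \<le> Q"
    and D: "tangent_extension \<iota> T M D1" "tangent_extension \<iota> T M D2"
    and x: "separable_element x"
  shows "D1 x = D2 x"
proof -
  have Qc: "Q = CHAR('c) ^ n" using Q(1) CHAR_field_embedding[OF h] by simp
  obtain V where V: "sep_coeffs V" "poly (twist (\<lambda>x. x) Q V) (to_ac T) = x"
    using ex_twist_representation[OF p Q x] by blast
  show ?thesis
    using tangent_extension_val[OF p Qc card h D(1) V(1)]
      tangent_extension_val[OF p Qc card h D(2) V(1)] by (simp add: V(2))
qed

section \<open>The ring of twisted power series\<close>

text \<open>
  What the composition of twisted series needs: \<open>x \<mapsto> x ^ r\<close> is a ring endomorphism.
\<close>

locale frobenius_field =
  fixes r :: nat and ty :: "'c::field itself"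
  assumes two_le_r: "2 \<le> r"
    and power_r_add: "\<And>x y :: 'c. (x + y) ^ r = x ^ r + y ^ r"
begin

lemma r_pos: "0 < r" using two_le_r by simp

lemma power_add_r: "(x + y :: 'c) ^ (r ^ i) = x ^ (r ^ i) + y ^ (r ^ i)"
proof (induction i)
  case (Suc i)
  have "z ^ (r ^ Suc i) = (z ^ (r ^ i)) ^ r" for z :: 'c
    by (simp add: power_mult[symmetric] mult.commute)
  then show ?case using Suc by (simp add: power_r_add)
qed simp

lemma power_sum_r: "(\<Sum>k\<in>I. f k :: 'c) ^ (r ^ i) = (\<Sum>k\<in>I. f k ^ (r ^ i))"
  using r_pos by (induction I rule: infinite_finite_induct) (simp_all add: power_add_r zero_power)

lemma power_diff_r: "(x - y :: 'c) ^ (r ^ i) = x ^ (r ^ i) - y ^ (r ^ i)"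
  using power_add_r[of "x - y" y i] by (simp add: algebra_simps)

lemma frob_mat_mult: "frob_mat r i ((A::'c^'t::finite^'t) ** B) = frob_mat r i A ** frob_mat r i B"
  by (simp add: vec_eq_iff frob_mat_def mat_mult_component power_sum_r power_mult_distrib)

lemma frob_mat_add: "frob_mat r i ((A::'c^'t::finite^'t) + B) = frob_mat r i A + frob_mat r i B"
  by (simp add: vec_eq_iff frob_mat_def power_add_r)

lemma frob_mat_zero: "frob_mat r i (0::'c^'t::finite^'t) = 0"
  using r_pos by (simp add: vec_eq_iff frob_mat_def zero_power)

lemma frob_mat_sum: "frob_mat r i (\<Sum>k\<in>I. (A k::'c^'t::finite^'t)) = (\<Sum>k\<in>I. frob_mat r i (A k))"
  by (induction I rule: infinite_finite_induct) (simp_all add: frob_mat_add frob_mat_zero)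

lemma frob_mat_frob_mat: "frob_mat r i (frob_mat r j (A::'c^'t::finite^'t)) = frob_mat r (i + j) A"
  by (simp add: vec_eq_iff frob_mat_def power_mult[symmetric] power_add mult.commute)

lemma frob_mat_mat: "frob_mat r i (mat c :: 'c^'t::finite^'t) = mat (c ^ (r ^ i))"
  using r_pos by (auto simp: vec_eq_iff frob_mat_def mat_def zero_power)

lemma frob_mat_0_left: "frob_mat r 0 (A::'c^'t::finite^'t) = A"
  by (simp add: vec_eq_iff frob_mat_def)

lemma frob_vec_mult: "frob_vec r i ((A::'c^'t::finite^'t) *v z) = frob_mat r i A *v frob_vec r i z"
  by (simp add: vec_eq_iff frob_mat_def frob_vec_def matrix_vector_mult_def power_sum_r power_mult_distrib)

lemma frob_vec_frob_vec: "frob_vec r i (frob_vec r j (z::'c^'t::finite)) = frob_vec r (i + j) z"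
  by (simp add: vec_eq_iff frob_vec_def power_mult[symmetric] power_add mult.commute)

text \<open>
  Both sides are the sum of \<open>f j F\<^sup>j(g k) F\<^sup>j\<^sup>+\<^sup>k(h m)\<close> over \<open>j + k + m = n\<close>, where \<open>F\<close> is the Frobenius
  map on matrices.
\<close>

lemma tau_comp_assoc:
  fixes f g h :: "('c, 't::finite) tau_series"
  shows "tau_comp r (tau_comp r f g) h = tau_comp r f (tau_comp r g h)"
proof
  fix n
  define \<phi> where "\<phi> j k = f j ** frob_mat r j (g k) ** frob_mat r (j + k) (h (n - (j + k)))" for j k
  have "tau_comp r (tau_comp r f g) h n = (\<Sum>i\<le>n. \<Sum>j\<le>i. \<phi> j (i - j))"
    unfolding tau_comp_def \<phi>_def
    by (intro sum.cong refl) (simp add: matrix_sum_rdistrib)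
  also have "\<dots> = (\<Sum>(j, k)\<in>{(j, k). j + k \<le> n}. \<phi> j k)"
    by (rule sum.triangle_reindex_eq[symmetric])
  also have "{(j, k). j + k \<le> n} = Sigma {..n} (\<lambda>j. {..n - j})" by auto
  also have "(\<Sum>(j, k)\<in>\<dots>. \<phi> j k) = (\<Sum>j\<le>n. \<Sum>k\<le>n - j. \<phi> j k)"
    by (subst sum.Sigma) auto
  also have "\<dots> = tau_comp r f (tau_comp r g h) n"
    unfolding tau_comp_def \<phi>_def
    by (intro sum.cong refl)
      (simp add: frob_mat_sum frob_mat_mult frob_mat_frob_mat matrix_sum_ldistrib matrix_mul_assoc)
  finally show "tau_comp r (tau_comp r f g) h n = tau_comp r f (tau_comp r g h) n" .
qed

lemma tau_comp_const_left: "tau_comp r (tau_const M) (f :: ('c, 't::finite) tau_series) n = M ** f n"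
proof -
  have "tau_comp r (tau_const M) f n = (\<Sum>i\<in>{0}. tau_const M i ** frob_mat r i (f (n - i)))"
    unfolding tau_comp_def by (rule sum.mono_neutral_right) (auto simp: tau_const_def)
  then show ?thesis by (simp add: tau_const_def frob_mat_0_left)
qed

lemma tau_comp_const_right:
  "tau_comp r (f :: ('c, 't::finite) tau_series) (tau_const M) n = f n ** frob_mat r n M"
proof -
  have "tau_comp r f (tau_const M) n = (\<Sum>i\<in>{n}. f i ** frob_mat r i (tau_const M (n - i)))"
    unfolding tau_comp_def by (rule sum.mono_neutral_right) (auto simp: tau_const_def frob_mat_zero)
  then show ?thesis by (simp add: tau_const_def)
qed

lemma tau_comp_one: 
  fixes f :: "('c, 't::finite) tau_series"
  shows "tau_comp r (tau_const (mat 1)) f = f" "tau_comp r f (tau_const (mat 1)) = f"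
  by (auto simp: fun_eq_iff tau_comp_const_left tau_comp_const_right frob_mat_mat)

lemma tau_comp_const_const:
  "tau_comp r (tau_const M) (tau_const (N::'c^'t::finite^'t)) = tau_const (M ** N)"
proof
  fix n
  have "tau_comp r (tau_const M) (tau_const N) n = M ** tau_const N n"
    by (rule tau_comp_const_left)
  then show "tau_comp r (tau_const M) (tau_const N) n = tau_const (M ** N) n"
    by (simp add: tau_const_def)
qed

lemma tau_add_const: "tau_add (tau_const M) (tau_const N) = tau_const (M + N)"
  by (auto simp: fun_eq_iff tau_add_def tau_const_def)

lemma tau_comp_add_right:
  fixes f g h :: "('c, 't::finite) tau_series"
  shows "tau_comp r f (tau_add g h) = tau_add (tau_comp r f g) (tau_comp r f h)"
  by (simp add: fun_eq_iff tau_comp_def tau_add_def frob_mat_add matrix_add_ldistrib sum.distrib)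

lemma tau_comp_add_left:
  fixes f g h :: "('c, 't::finite) tau_series"
  shows "tau_comp r (tau_add f g) h = tau_add (tau_comp r f h) (tau_comp r g h)"
  by (simp add: fun_eq_iff tau_comp_def tau_add_def matrix_add_rdistrib' sum.distrib)

lemma tangent_comp: "tangent (tau_comp r f (g :: ('c, 't::finite) tau_series)) = tangent f ** tangent g"
  by (simp add: tangent_def tau_comp_def frob_mat_0_left)

lemma tau_comp_split:
  fixes f g :: "('c, 't::finite) tau_series"
  shows "tau_comp r f g n = f 0 ** g n + (\<Sum>j\<in>{1..n}. f j ** frob_mat r j (g (n - j)))"
proof -
  have "{..n} = insert 0 {1..n}" by auto
  then show ?thesis by (simp add: tau_comp_def frob_mat_0_left)
qed

end

text \<open>
  One recursion serves two purposes: for \<open>A 0 = 1\<close> and \<open>c n = - 1\<close> it yields the right inverse of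
  \<open>A\<close>, and for \<open>c n = 1 / (w ^ (r ^ n) - w)\<close> the series that intertwines the scalar \<open>w\<close> with \<open>A\<close>.
\<close>

fun tau_recursion ::
  "nat \<Rightarrow> (nat \<Rightarrow> 'c::field) \<Rightarrow> ('c, 't::finite) tau_series \<Rightarrow> ('c, 't) tau_series" where
  "tau_recursion r c A n = (if n = 0 then mat 1 else
     mat (c n) ** (\<Sum>j\<in>{1..n}. A j ** frob_mat r j (tau_recursion r c A (n - j))))"

declare tau_recursion.simps [simp del]

context frobenius_field
begin

lemma ex_tau_right_inverse:
  fixes f :: "('c, 't::finite) tau_series"
  assumes "f 0 = mat 1"
  shows "\<exists>g. g 0 = mat 1 \<and> tau_comp r f g = tau_const (mat 1)"
proof -
  let ?g = "tau_recursion r (\<lambda>n. - 1) f"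
  have "tau_comp r f ?g n = tau_const (mat 1) n" for n
  proof (cases "n = 0")
    case True
    then show ?thesis
      using assms by (simp add: tau_comp_def tau_const_def tau_recursion.simps[of r _ f 0] frob_mat_mat)
  next
    case False
    define S where "S = (\<Sum>j\<in>{1..n}. f j ** frob_mat r j (?g (n - j)))"
    have "?g n = mat (- 1) ** S"
      using False by (subst tau_recursion.simps) (simp add: S_def)
    then have "tau_comp r f ?g n = mat (- 1) ** S + mat 1 ** S"
      using assms by (simp add: tau_comp_split S_def)
    also have "\<dots> = (mat (- 1) + mat 1) ** S" by (simp only: matrix_add_rdistrib')
    also have "\<dots> = 0" by (simp only: mat_add) simp
    finally show ?thesis using False by (simp add: tau_const_def)
  qed
  then show ?thesis by (intro exI[of _ ?g]) (auto simp: tau_recursion.simps[of r _ f 0])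
qed

lemma ex1_tau_inverse:
  fixes f :: "('c, 't::finite) tau_series"
  assumes "f 0 = mat 1"
  shows "\<exists>!g. tau_comp r f g = tau_const (mat 1) \<and> tau_comp r g f = tau_const (mat 1)"
proof -
  obtain g where g: "g 0 = mat 1" "tau_comp r f g = tau_const (mat 1)"
    using ex_tau_right_inverse[of f, OF assms] by blast
  obtain h where h: "tau_comp r g h = tau_const (mat 1)"
    using ex_tau_right_inverse[of g, OF g(1)] by blast
  have "f = tau_comp r f (tau_comp r g h)" by (simp add: h tau_comp_one)
  also have "\<dots> = h" by (simp add: tau_comp_assoc[symmetric] g tau_comp_one)
  finally have gf: "tau_comp r g f = tau_const (mat 1)" using h by simp
  show ?thesis
  proof (rule ex1I)
    show "tau_comp r f g = tau_const (mat 1) \<and> tau_comp r g f = tau_const (mat 1)"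
      using g(2) gf by blast
    fix k assume k: "tau_comp r f k = tau_const (mat 1) \<and> tau_comp r k f = tau_const (mat 1)"
    have "k = tau_comp r (tau_comp r g f) k" by (simp add: gf tau_comp_one)
    also have "\<dots> = tau_comp r g (tau_const (mat 1))" using k by (simp add: tau_comp_assoc)
    finally show "k = g" by (simp add: tau_comp_one)
  qed
qed

text \<open>
  The scalar \<open>w\<close> passes the power \<open>n\<close> of \<open>\<tau>\<close> as \<open>w ^ (r ^ n)\<close>. With a scalar, unlike with a general
  matrix, the coefficient \<open>g n\<close> can be isolated.
\<close>

lemma intertwiner_iff:
  fixes A g :: "('c, 't::finite) tau_series"
  assumes "A 0 = mat w"
  shows "tau_comp r g (tau_const (mat w)) n = tau_comp r A g n \<longleftrightarrow>
    mat (w ^ (r ^ n) - w) ** g n = (\<Sum>j\<in>{1..n}. A j ** frob_mat r j (g (n - j)))"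
proof -
  have "mat (w ^ (r ^ n) - w) ** g n + mat w ** g n = mat (w ^ (r ^ n)) ** g n"
    by (simp only: matrix_add_rdistrib'[symmetric] mat_add) simp
  then have "mat (w ^ (r ^ n) - w) ** g n = mat (w ^ (r ^ n)) ** g n - mat w ** g n"
    by (simp only: eq_diff_eq)
  moreover have "tau_comp r g (tau_const (mat w)) n = mat (w ^ (r ^ n)) ** g n"
    by (simp only: tau_comp_const_right frob_mat_mat mat_commute)
  moreover have "tau_comp r A g n = mat w ** g n + (\<Sum>j\<in>{1..n}. A j ** frob_mat r j (g (n - j)))"
    by (simp only: tau_comp_split assms)
  ultimately show ?thesis by (simp only: diff_eq_eq) (simp only: add.commute)
qed

lemma intertwiner_unique:
  fixes A g h :: "('c, 't::finite) tau_series"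
  assumes A: "A 0 = mat w" and w: "\<And>n. n > 0 \<Longrightarrow> w ^ (r ^ n) \<noteq> w"
    and g: "tau_comp r g (tau_const (mat w)) = tau_comp r A g"
    and h: "tau_comp r h (tau_const (mat w)) = tau_comp r A h" and gh: "g 0 = h 0"
  shows "g = h"
proof
  fix n show "g n = h n"
  proof (induction n rule: less_induct)
    case (less n)
    show ?case
    proof (cases "n = 0")
      case False
      let ?c = "w ^ (r ^ n) - w"
      have "(\<Sum>j\<in>{1..n}. A j ** frob_mat r j (g (n - j))) = (\<Sum>j\<in>{1..n}. A j ** frob_mat r j (h (n - j)))"
        using less by (intro sum.cong) auto
      then have "mat ?c ** g n = mat ?c ** h n"
        using intertwiner_iff[where A = A and g = g and n = n, OF A]
          intertwiner_iff[where A = A and g = h and n = n, OF A] g h by simp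
      then have "mat (inverse ?c) ** mat ?c ** g n = mat (inverse ?c) ** mat ?c ** h n"
        by (simp only: matrix_mul_assoc[symmetric])
      then show ?thesis using w False by (simp add: mat_mult)
    qed (simp add: gh)
  qed
qed

lemma tau_recursion_intertwines:
  fixes A :: "('c, 't::finite) tau_series"
  assumes A: "A 0 = mat w" and w: "\<And>n. n > 0 \<Longrightarrow> w ^ (r ^ n) \<noteq> w"
  defines "e \<equiv> tau_recursion r (\<lambda>n. inverse (w ^ (r ^ n) - w)) A"
  shows "tau_comp r e (tau_const (mat w)) = tau_comp r A e"
proof
  fix n
  have "mat (w ^ (r ^ n) - w) ** e n = (\<Sum>j\<in>{1..n}. A j ** frob_mat r j (e (n - j)))"
  proof (cases "n = 0")
    case False
    have "e n = mat (inverse (w ^ (r ^ n) - w)) ** (\<Sum>j\<in>{1..n}. A j ** frob_mat r j (e (n - j)))"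
      unfolding e_def using False by (subst tau_recursion.simps) simp
    then show ?thesis using w False by (simp add: matrix_mul_assoc mat_mult)
  qed simp
  then show "tau_comp r e (tau_const (mat w)) n = tau_comp r A e n"
    using intertwiner_iff[where A = A and g = e and n = n, OF A] by simp
qed

end

section \<open>Ultrametric convergence\<close>

lemma matrix_vector_sum_rdistrib:
  "(\<Sum>i\<in>I. A i) *v x = (\<Sum>i\<in>I. (A i::'c::semiring_1^'n^'m) *v x)"
  by (induction I rule: infinite_finite_induct) (simp_all add: matrix_vector_mult_add_rdistrib)

text \<open>
  The metric properties of a completed algebraic closure, in terms of \<open>|x| = dist x 0\<close>. The type class
  relates the metric to the field operations in no way, so that the limit theorems for sums and
  powers have to come from the ultrametric inequality.
\<close>

locale ultrametric_frobenius_field = frobenius_field r ty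
  for r :: nat and ty :: "'c::{field,complete_space} itself" +
  assumes dist_diff: "\<And>x y :: 'c. dist x y = dist (x - y) 0"
    and dist_mult: "\<And>x y :: 'c. dist (x * y) 0 = dist x 0 * dist y 0"
    and dist_add_le: "\<And>x y :: 'c. dist (x + y) 0 \<le> max (dist x 0) (dist y 0)"
    and ex_small: "\<exists>t :: 'c. 0 < dist t 0 \<and> dist t 0 < 1"
begin

definition absv :: "'c \<Rightarrow> real" where "absv x = dist x 0"

lemma absv_0 [simp]: "absv 0 = 0" and absv_nonneg [simp]: "0 \<le> absv x"
  and absv_eq_0 [simp]: "absv x = 0 \<longleftrightarrow> x = 0"
  by (simp_all add: absv_def)

lemma absv_mult: "absv (x * y) = absv x * absv y"
  by (simp add: absv_def dist_mult)

lemma absv_add: "absv (x + y) \<le> max (absv x) (absv y)"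
  by (simp add: absv_def dist_add_le)

lemma absv_1 [simp]: "absv 1 = 1"
  using absv_mult[of 1 1] absv_eq_0[of 1] by simp

lemma absv_power: "absv (x ^ n) = absv x ^ n"
  by (induction n) (simp_all add: absv_mult)

lemma absv_minus: "absv (- x) = absv x"
  using dist_diff[of 0 x] by (simp add: absv_def dist_commute)

lemma absv_diff: "absv (x - y) \<le> max (absv x) (absv y)"
  using absv_add[of x "- y"] by (simp add: absv_minus)

lemma absv_inverse: "absv (inverse x) = inverse (absv x)"
proof (cases "x = 0")
  case False
  then have "absv x * absv (inverse x) = 1" by (simp add: absv_mult[symmetric])
  then show ?thesis by (rule inverse_unique[symmetric])
qed simp

lemma absv_diff_eq:
  assumes "absv y < absv x" shows "absv (x - y) = absv x"
  using absv_diff[of x y] absv_add[of "x - y" y] assms by (auto simp: max_def split: if_splits)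

lemma absv_sum_le:
  assumes "\<And>i. i \<in> I \<Longrightarrow> absv (f i) \<le> B" "0 \<le> B"
  shows "absv (\<Sum>i\<in>I. f i) \<le> B"
  using assms
proof (induction I rule: infinite_finite_induct)
  case (insert x F)
  have "absv (f x + sum f F) \<le> max (absv (f x)) (absv (sum f F))" by (rule absv_add)
  also have "\<dots> \<le> B" using insert by simp
  finally show ?case using insert.hyps by simp
qed simp_all

lemma tendsto_absv: "f \<longlonglongrightarrow> l \<longleftrightarrow> (\<lambda>n. absv (f n - l)) \<longlonglongrightarrow> 0"
  by (subst tendsto_dist_iff) (simp add: dist_diff[of _ l] absv_def)

lemma tendsto_zero_absv: "f \<longlonglongrightarrow> 0 \<longleftrightarrow> (\<lambda>n. absv (f n)) \<longlonglongrightarrow> 0"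
  by (subst tendsto_absv) simp

lemma tendsto_add_absv:
  fixes f g :: "nat \<Rightarrow> 'c"
  assumes "f \<longlonglongrightarrow> a" "g \<longlonglongrightarrow> b"
  shows "(\<lambda>n. f n + g n) \<longlonglongrightarrow> a + b"
proof -
  have "(\<lambda>n. max (absv (f n - a)) (absv (g n - b))) \<longlonglongrightarrow> max 0 0"
    using assms by (intro tendsto_max) (simp_all add: tendsto_absv)
  then have "(\<lambda>n. max (absv (f n - a)) (absv (g n - b))) \<longlonglongrightarrow> 0" by simp
  then show ?thesis
    unfolding tendsto_absv
  proof (rule tendsto_sandwich[of "\<lambda>_. 0", rotated 3])
    show "\<forall>\<^sub>F n in sequentially. absv (f n + g n - (a + b)) \<le> max (absv (f n - a)) (absv (g n - b))"
      using absv_add[of "f _ - a" "g _ - b"] by (intro always_eventually allI) (simp add: algebra_simps)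
  qed simp_all
qed

lemma tendsto_frob_absv:
  fixes f :: "nat \<Rightarrow> 'c"
  assumes "f \<longlonglongrightarrow> a"
  shows "(\<lambda>n. c * f n ^ (r ^ j)) \<longlonglongrightarrow> c * a ^ (r ^ j)"
proof -
  have "(\<lambda>n. absv c * absv (f n - a) ^ (r ^ j)) \<longlonglongrightarrow> absv c * 0 ^ (r ^ j)"
    using assms by (intro tendsto_mult_left tendsto_power) (simp add: tendsto_absv)
  moreover have "absv c * absv (f n - a) ^ (r ^ j) = absv (c * f n ^ (r ^ j) - c * a ^ (r ^ j))" for n
    by (simp add: absv_mult[symmetric] absv_power[symmetric] power_diff_r right_diff_distrib)
  ultimately show ?thesis
    unfolding tendsto_absv using r_pos by (simp add: zero_power)
qed

lemma sums_add_absv: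
  fixes f g :: "nat \<Rightarrow> 'c"
  assumes "f sums a" "g sums b"
  shows "(\<lambda>n. f n + g n) sums (a + b)"
  using tendsto_add_absv[OF assms[unfolded sums_def]] by (simp add: sums_def sum.distrib)

lemma sums_sum_absv:
  fixes f :: "'i \<Rightarrow> nat \<Rightarrow> 'c"
  assumes "\<And>i. i \<in> I \<Longrightarrow> f i sums s i"
  shows "(\<lambda>n. \<Sum>i\<in>I. f i n) sums (\<Sum>i\<in>I. s i)"
  using assms by (induction I rule: infinite_finite_induct) (auto intro: sums_add_absv)

lemma sums_frob_absv:
  fixes f :: "nat \<Rightarrow> 'c"
  assumes "f sums a"
  shows "(\<lambda>n. c * f n ^ (r ^ j)) sums (c * a ^ (r ^ j))"
proof -
  have "c * (\<Sum>i<n. f i) ^ (r ^ j) = (\<Sum>i<n. c * f i ^ (r ^ j))" for n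
    by (simp add: power_sum_r sum_distrib_left)
  then show ?thesis using tendsto_frob_absv[OF assms[unfolded sums_def], of c j] by (simp add: sums_def)
qed

lemma sums_imp_tendsto_zero:
  fixes f :: "nat \<Rightarrow> 'c"
  assumes "f sums a" shows "f \<longlonglongrightarrow> 0"
proof -
  let ?S = "\<lambda>n. \<Sum>i<n. f i"
  have S: "?S \<longlonglongrightarrow> a" using assms by (simp add: sums_def)
  then have "(\<lambda>n. ?S (Suc n)) \<longlonglongrightarrow> a" by (rule LIMSEQ_Suc)
  moreover have "(\<lambda>n. - 1 * ?S n ^ (r ^ 0)) \<longlonglongrightarrow> - 1 * a ^ (r ^ 0)"
    using S by (rule tendsto_frob_absv)
  ultimately have "(\<lambda>n. ?S (Suc n) + - 1 * ?S n ^ (r ^ 0)) \<longlonglongrightarrow> a + - 1 * a ^ (r ^ 0)"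
    by (rule tendsto_add_absv)
  then show ?thesis by simp
qed

text \<open>
  In a complete ultrametric field a series converges as soon as its terms tend to zero.
\<close>

lemma summable_absv:
  fixes f :: "nat \<Rightarrow> 'c"
  assumes "(\<lambda>n. absv (f n)) \<longlonglongrightarrow> 0"
  shows "summable f"
proof -
  have "Cauchy (\<lambda>n. \<Sum>i<n. f i)"
  proof (rule metric_CauchyI)
    fix \<epsilon> :: real assume \<epsilon>: "0 < \<epsilon>"
    then have "eventually (\<lambda>n. absv (f n) < \<epsilon> / 2) sequentially"
      using order_tendstoD(2)[OF assms, of "\<epsilon> / 2"] by simp
    then obtain N where N: "\<And>n. n \<ge> N \<Longrightarrow> absv (f n) < \<epsilon> / 2"
      by (auto simp: eventually_sequentially)
    have *: "dist (\<Sum>i<m. f i) (\<Sum>i<n. f i) < \<epsilon>" if "N \<le> n" "n \<le> m" for m n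
    proof -
      have "(\<Sum>i<m. f i) - (\<Sum>i<n. f i) = (\<Sum>i\<in>{n..<m}. f i)"
        using that(2) by (simp add: sum_diff_nat_ivl[of 0 n m, simplified atLeast0LessThan[symmetric]] lessThan_atLeast0)
      moreover have "absv (\<Sum>i\<in>{n..<m}. f i) \<le> \<epsilon> / 2"
      proof (rule absv_sum_le)
        fix i assume "i \<in> {n..<m}"
        then show "absv (f i) \<le> \<epsilon> / 2" using N[of i] that(1) by auto
      qed (use \<epsilon> in simp)
      ultimately show ?thesis using \<epsilon> by (subst dist_diff) (simp add: absv_def)
    qed
    show "\<exists>M. \<forall>m\<ge>M. \<forall>n\<ge>M. dist (\<Sum>i<m. f i) (\<Sum>i<n. f i) < \<epsilon>"
    proof (intro exI[of _ N] allI impI)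
      fix m n assume "N \<le> m" "N \<le> n"
      then show "dist (\<Sum>i<m. f i) (\<Sum>i<n. f i) < \<epsilon>"
        using *[of n m] *[of m n] by (cases "n \<le> m") (auto simp: dist_commute)
    qed
  qed
  then show ?thesis
    using Cauchy_convergent by (auto simp: summable_def sums_def convergent_def)
qed

lemma sums_shift_absv:
  fixes f :: "nat \<Rightarrow> 'c"
  assumes "f sums a"
  shows "(\<lambda>n. if n < j then 0 else f (n - j)) sums a"
proof -
  have "(\<Sum>i<n + j. if i < j then 0 else f (i - j)) = (\<Sum>i<n. f i)" for n
    by (induction n) simp_all
  then show ?thesis
    using assms LIMSEQ_offset[of "\<lambda>n. \<Sum>i<n. if i < j then 0 else f (i - j)" j a]
    by (simp add: sums_def)
qed

lemma sums_vec_iff: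
  fixes f :: "nat \<Rightarrow> 'c^'t::finite"
  shows "f sums s \<longleftrightarrow> (\<forall>k. (\<lambda>n. f n $ k) sums (s $ k))"
proof
  assume "f sums s"
  then show "\<forall>k. (\<lambda>n. f n $ k) sums (s $ k)"
    unfolding sums_def by (auto dest: tendsto_vec_nth simp: sum_component)
next
  assume "\<forall>k. (\<lambda>n. f n $ k) sums (s $ k)"
  then show "f sums s"
    unfolding sums_def by (intro vec_tendstoI) (simp add: sum_component)
qed

lemma sums_frob_vec:
  fixes f :: "nat \<Rightarrow> 'c^'t::finite" and A :: "'c^'t^'t"
  assumes "f sums s"
  shows "(\<lambda>n. A *v frob_vec r j (f n)) sums (A *v frob_vec r j s)"
  unfolding sums_vec_iff
proof
  fix k
  have "(\<lambda>n. \<Sum>l\<in>UNIV. A $ k $ l * (f n $ l) ^ (r ^ j)) sums (\<Sum>l\<in>UNIV. A $ k $ l * (s $ l) ^ (r ^ j))"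
    using assms by (intro sums_sum_absv sums_frob_absv) (simp add: sums_vec_iff)
  then show "(\<lambda>n. (A *v frob_vec r j (f n)) $ k) sums ((A *v frob_vec r j s) $ k)"
    by (simp add: matrix_vector_mult_def frob_vec_def)
qed

lemma tau_converges_sums: "tau_converges r f z \<Longrightarrow> (\<lambda>n. f n *v frob_vec r n z) sums tau_eval r f (z :: 'c^'t::finite)"
  unfolding tau_converges_def tau_eval_def by (rule summable_sums)

lemma tau_eval_finite:
  fixes A :: "('c, 't::finite) tau_series"
  assumes "\<And>j. j > d \<Longrightarrow> A j = 0"
  shows "tau_eval r A v = (\<Sum>j\<le>d. A j *v frob_vec r j v)"
  unfolding tau_eval_def by (rule suminf_finite) (use assms in auto)

text \<open>
  Each of the finitely many summands of the polynomial operator \<open>A\<close> is continuous and additive, so it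
  can be applied term by term to the series of \<open>g\<close>.
\<close>

lemma tau_comp_finite_sums:
  fixes A g :: "('c, 't::finite) tau_series"
  assumes A: "\<And>j. j > d \<Longrightarrow> A j = 0" and g: "tau_converges r g z"
  shows "(\<lambda>n. tau_comp r A g n *v frob_vec r n z) sums tau_eval r A (tau_eval r g z)"
proof -
  let ?t = "\<lambda>j n. if n < j then 0 else A j *v frob_vec r j (g (n - j) *v frob_vec r (n - j) z)"
  have "?t j sums (A j *v frob_vec r j (tau_eval r g z))" for j
  proof -
    have s: "(\<lambda>n. A j *v frob_vec r j (g n *v frob_vec r n z)) sums (A j *v frob_vec r j (tau_eval r g z))"
      by (rule sums_frob_vec[OF tau_converges_sums[OF g]])
    show ?thesis
      unfolding sums_vec_iff
    proof
      fix k
      show "(\<lambda>n. ?t j n $ k) sums ((A j *v frob_vec r j (tau_eval r g z)) $ k)"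
        using sums_shift_absv[OF s[unfolded sums_vec_iff, rule_format, of k], of j]
        by (simp add: if_distrib[of "\<lambda>v. v $ k"] cong: if_cong)
    qed
  qed
  then have "(\<lambda>n. \<Sum>j\<le>d. ?t j n) sums (\<Sum>j\<le>d. A j *v frob_vec r j (tau_eval r g z))"
    unfolding sums_vec_iff sum_component by (intro allI sums_sum_absv) simp
  moreover have "(\<Sum>j\<le>d. ?t j n) = tau_comp r A g n *v frob_vec r n z" for n
  proof -
    have "tau_comp r A g n *v frob_vec r n z = (\<Sum>j\<le>n. A j *v frob_vec r j (g (n - j) *v frob_vec r (n - j) z))"
      unfolding tau_comp_def
      by (simp add: frob_vec_mult frob_vec_frob_vec matrix_vector_mul_assoc matrix_vector_sum_rdistrib)
    also have "\<dots> = (\<Sum>j\<le>max n d. ?t j n)"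
      by (rule sum.mono_neutral_cong_left) auto
    also have "\<dots> = (\<Sum>j\<le>d. ?t j n)"
      using A by (intro sum.mono_neutral_right) auto
    finally show ?thesis by simp
  qed
  ultimately show ?thesis by (simp add: tau_eval_finite[where A = A and d = d, OF A])
qed

lemma tau_comp_const_term:
  fixes g :: "('c, 't::finite) tau_series"
  shows "tau_comp r g (tau_const M) n *v frob_vec r n z = g n *v frob_vec r n (M *v z)"
  by (simp add: tau_comp_const_right frob_vec_mult matrix_vector_mul_assoc)

text \<open>
  If \<open>a i\<close> is the first nonzero coefficient, the term of index \<open>i\<close> is at most as large as the largest
  later one. At \<open>x = t ^ m\<close> with \<open>|t| < 1\<close> the later terms are smaller by a factor of at least
  \<open>|t| ^ m\<close>, up to a constant; let \<open>m\<close> tend to infinity.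
\<close>

lemma additive_series_zero:
  fixes a :: "nat \<Rightarrow> 'c"
  assumes z: "\<And>x. (\<lambda>n. a n * x ^ (r ^ n)) sums 0"
  shows "a n = 0"
proof (rule ccontr)
  assume "a n \<noteq> 0"
  define i where "i = (LEAST i. a i \<noteq> 0)"
  have i: "a i \<noteq> 0" "\<And>j. j < i \<Longrightarrow> a j = 0"
    unfolding i_def using LeastI[of "\<lambda>i. a i \<noteq> 0", OF \<open>a n \<noteq> 0\<close>]
    by (auto dest: not_less_Least)
  obtain t :: 'c where t: "0 < absv t" "absv t < 1" using ex_small by (auto simp: absv_def)
  have "a \<longlonglongrightarrow> 0" using sums_imp_tendsto_zero[OF z[of 1]] by simp
  then have "Bseq (\<lambda>n. absv (a n))"
    unfolding tendsto_zero_absv by (intro convergent_imp_Bseq convergentI)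
  then obtain C where C: "C > 0" "\<And>n. absv (a n) \<le> C" by (auto simp: Bseq_def)
  have bound: "absv (a i) \<le> C * absv t ^ m" for m
  proof -
    let ?x = "t ^ m"
    let ?q = "absv t ^ m"
    have q: "0 < ?q" "?q \<le> 1" using t by (auto intro: power_le_one)
    let ?B = "C * ?q ^ (r ^ Suc i)"
    have "absv (a i * ?x ^ (r ^ i)) \<le> ?B + \<epsilon>" if \<epsilon>: "\<epsilon> > 0" for \<epsilon>
    proof -
      have "(\<lambda>n. absv (\<Sum>j<n. a j * ?x ^ (r ^ j))) \<longlonglongrightarrow> 0"
        using z[of ?x] unfolding sums_def tendsto_zero_absv .
      then have "eventually (\<lambda>n. absv (\<Sum>j<n. a j * ?x ^ (r ^ j)) < \<epsilon>) sequentially"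
        using order_tendstoD(2) \<epsilon> by blast
      then obtain M where M: "\<And>n. n \<ge> M \<Longrightarrow> absv (\<Sum>j<n. a j * ?x ^ (r ^ j)) < \<epsilon>"
        by (auto simp: eventually_sequentially)
      let ?N = "max M (Suc i)"
      let ?S = "\<Sum>j<?N. a j * ?x ^ (r ^ j)" and ?R = "\<Sum>j\<in>{Suc i..<?N}. a j * ?x ^ (r ^ j)"
      have "{..<?N} = {..<i} \<union> {i} \<union> {Suc i..<?N}" by auto
      then have "?S = (\<Sum>j\<in>{..<i} \<union> {i} \<union> {Suc i..<?N}. a j * ?x ^ (r ^ j))" by (simp only:)
      also have "\<dots> = a i * ?x ^ (r ^ i) + ?R"
        by (subst sum.union_disjoint) (auto simp: i(2))
      finally have eq: "a i * ?x ^ (r ^ i) = ?S - ?R" by simp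
      have "absv ?R \<le> ?B"
      proof (rule absv_sum_le)
        fix j assume "j \<in> {Suc i..<?N}"
        then have "r ^ Suc i \<le> r ^ j" using two_le_r by (intro power_increasing) auto
        then have "?q ^ (r ^ j) \<le> ?q ^ (r ^ Suc i)" by (rule power_decreasing) (use q in auto)
        then show "absv (a j * ?x ^ (r ^ j)) \<le> ?B"
          using C q by (simp add: absv_mult absv_power mult_mono del: power_Suc)
      qed (use C q in simp)
      moreover have "absv ?S \<le> \<epsilon>" using M[of ?N] by simp
      moreover have "0 \<le> ?B" using C q by simp
      ultimately show ?thesis
        unfolding eq using absv_diff[of ?S ?R] \<epsilon> by linarith
    qed
    then have "absv (a i * ?x ^ (r ^ i)) \<le> ?B" by (rule field_le_epsilon)
    then have "absv (a i) * ?q ^ (r ^ i) \<le> C * ?q ^ (r ^ Suc i)"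
      by (simp add: absv_mult absv_power del: power_Suc)
    also have "\<dots> \<le> C * ?q ^ Suc (r ^ i)"
    proof -
      have "1 * r ^ i < r * r ^ i" using two_le_r r_pos by (intro mult_strict_right_mono) auto
      then have "Suc (r ^ i) \<le> r ^ Suc i" by (simp only: power_Suc mult_1 Suc_le_eq)
      then show ?thesis using C q by (intro mult_left_mono power_decreasing) auto
    qed
    finally have "absv (a i) * ?q ^ (r ^ i) \<le> (C * ?q) * ?q ^ (r ^ i)" by (simp add: mult.assoc)
    then show ?thesis using q by (simp add: mult_le_cancel_right)
  qed
  have "(\<lambda>m. C * absv t ^ m) \<longlonglongrightarrow> C * 0"
    using t by (intro tendsto_mult_left LIMSEQ_realpow_zero) auto
  then have "absv (a i) \<le> C * 0"
    by (rule LIMSEQ_le_const) (use bound in auto)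
  then show False using i(1) absv_nonneg[of "a i"] by simp
qed

lemma tau_eval_inject:
  fixes f g :: "('c, 't::finite) tau_series"
  assumes "\<And>z. (\<lambda>n. f n *v frob_vec r n z) sums s z" "\<And>z. (\<lambda>n. g n *v frob_vec r n z) sums s z"
  shows "f = g"
proof -
  have "f n $ k $ l - g n $ k $ l = 0" for n k l
  proof (rule additive_series_zero)
    fix x
    have comp: "(A *v frob_vec r n (axis l x)) $ k = A $ k $ l * x ^ (r ^ n)"
      for A :: "'c^'t^'t" and n
    proof -
      have "(A *v frob_vec r n (axis l x)) $ k = (\<Sum>j\<in>UNIV. if j = l then A $ k $ l * x ^ (r ^ n) else 0)"
      proof -
        have "(A *v frob_vec r n (axis l x)) $ k = (\<Sum>j\<in>UNIV. A $ k $ j * (if j = l then x else 0) ^ (r ^ n))"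
          by (simp add: matrix_vector_mult_def frob_vec_def axis_def)
        also have "\<dots> = (\<Sum>j\<in>UNIV. if j = l then A $ k $ l * x ^ (r ^ n) else 0)"
          by (rule sum.cong) (use r_pos in \<open>auto simp: zero_power\<close>)
        finally show ?thesis .
      qed
      then show ?thesis by simp
    qed
    let ?s = "s (axis l x) $ k"
    have "(\<lambda>n. f n $ k $ l * x ^ (r ^ n)) sums ?s"
      using assms(1)[of "axis l x", unfolded sums_vec_iff, rule_format, of k] by (simp only: comp)
    moreover have "(\<lambda>n. g n $ k $ l * x ^ (r ^ n)) sums ?s"
      using assms(2)[of "axis l x", unfolded sums_vec_iff, rule_format, of k] by (simp only: comp)
    ultimately have "(\<lambda>n. f n $ k $ l * x ^ (r ^ n) + - 1 * (g n $ k $ l * x ^ (r ^ n)) ^ (r ^ 0)) sums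
        (?s + - 1 * ?s ^ (r ^ 0))"
      by (intro sums_add_absv sums_frob_absv)
    then show "(\<lambda>n. (f n $ k $ l - g n $ k $ l) * x ^ (r ^ n)) sums 0"
      by (simp add: left_diff_distrib)
  qed
  then show ?thesis by (simp add: fun_eq_iff vec_eq_iff)
qed

end

section \<open>Existence and uniqueness of the exponential\<close>

context ultrametric_frobenius_field
begin

lemma absv_power_r_diff:
  assumes w: "1 < absv w" and n: "n > 0"
  shows "absv (w ^ (r ^ n) - w) = absv w ^ (r ^ n)" "w ^ (r ^ n) \<noteq> w"
proof -
  have "1 < r ^ n" using two_le_r n by (intro one_less_power) auto
  then have "absv w ^ 1 < absv w ^ (r ^ n)" using w by (intro power_strict_increasing) auto
  then have lt: "absv w < absv (w ^ (r ^ n))" by (simp add: absv_power)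
  from absv_diff_eq[OF this] show "absv (w ^ (r ^ n) - w) = absv w ^ (r ^ n)"
    by (simp add: absv_power)
  show "w ^ (r ^ n) \<noteq> w" using lt by auto
qed

text \<open>
  The recursion multiplies by at most \<open>C\<close>, raises to a power \<open>r ^ j\<close>, and divides by
  \<open>|w| ^ (r ^ n)\<close>. On the scale of \<open>r ^ n\<close>-th roots, a step back by \<open>j \<le> d\<close> gains the factor
  \<open>1 / |w| = v ^ d \<le> v ^ j\<close>. The extra factor \<open>C\<close> on the left absorbs
  the constant: \<open>C ^ 2 \<le> C ^ (r ^ j)\<close>.
\<close>

lemma tau_recursion_bound:
  fixes A e :: "('c, 't::finite) tau_series"
  assumes C: "C \<ge> 1" "\<And>j k l. absv (A j $ k $ l) \<le> C" and A: "\<And>j. j > d \<Longrightarrow> A j = 0"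
    and w: "1 < absv w" and v: "0 < v" "v ^ d * absv w = 1"
  defines "e \<equiv> tau_recursion r (\<lambda>n. inverse (w ^ (r ^ n) - w)) A"
  shows "C * absv (e n $ k $ l) \<le> (C * v ^ n) ^ (r ^ n)"
proof (induction n arbitrary: k l rule: less_induct)
  case (less n)
  let ?W = "absv w"
  have v1: "v \<le> 1"
  proof (rule ccontr)
    assume "\<not> v \<le> 1"
    then have "1 \<le> v ^ d" by (intro one_le_power) simp
    then have "1 * 1 < v ^ d * ?W" using w by (intro mult_le_less_imp_less) auto
    then show False using v(2) by simp
  qed
  show ?case
  proof (cases "n = 0")
    case True
    then have "absv (e n $ k $ l) \<le> 1"
      unfolding e_def by (subst tau_recursion.simps) (simp add: mat_def)
    then show ?thesis using C(1) True by simp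
  next
    case False
    have "e n = mat (inverse (w ^ (r ^ n) - w)) ** (\<Sum>j\<in>{1..n}. A j ** frob_mat r j (e (n - j)))"
      unfolding e_def using False by (subst tau_recursion.simps) simp
    then have en: "e n $ k $ l = inverse (w ^ (r ^ n) - w) *
        (\<Sum>j\<in>{1..n}. \<Sum>m\<in>UNIV. A j $ k $ m * (e (n - j) $ m $ l) ^ (r ^ j))"
      by (simp only: mat_mult_left_component) (simp add: sum_component mat_mult_component frob_mat_def)
    let ?B = "?W ^ (r ^ n) * (C * v ^ n) ^ (r ^ n) / C"
    have B0: "0 \<le> ?B" using C v by (intro divide_nonneg_nonneg mult_nonneg_nonneg zero_le_power) auto
    have term_le: "absv (A j $ k $ m * (e (n - j) $ m $ l) ^ (r ^ j)) \<le> ?B" if j: "j \<in> {1..n}" for j m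
    proof (cases "j \<le> d")
      case jd: True
      let ?y = "absv (e (n - j) $ m $ l)"
      have "2 \<le> r ^ j" using j two_le_r power_increasing[of 1 j r] by simp
      then have "C ^ 2 \<le> C ^ (r ^ j)" using C(1) by (intro power_increasing) auto
      then have "C * C * ?y ^ (r ^ j) \<le> (C * ?y) ^ (r ^ j)"
        by (simp add: power_mult_distrib power2_eq_square mult_right_mono)
      also have "\<dots> \<le> ((C * v ^ (n - j)) ^ (r ^ (n - j))) ^ (r ^ j)"
        using less.IH[of "n - j" m l] j C(1) by (intro power_mono) auto
      also have "\<dots> = (C * v ^ (n - j)) ^ (r ^ n)"
        using j by (simp add: power_mult[symmetric] power_add[symmetric])
      also have "\<dots> \<le> (?W * (C * v ^ n)) ^ (r ^ n)"
      proof (rule power_mono)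
        have "v ^ (n - j) * (v ^ d * ?W) \<le> v ^ (n - j) * (v ^ j * ?W)"
          using v v1 jd w by (intro mult_left_mono mult_right_mono power_decreasing) auto
        then have "v ^ (n - j) \<le> ?W * v ^ n"
        proof -
          have "v ^ (n - j) * v ^ j = v ^ n" using j by (simp add: power_add[symmetric])
          then have "v ^ (n - j) * (v ^ j * ?W) = ?W * v ^ n"
            by (simp only: mult.assoc[symmetric]) (simp only: mult.commute)
          moreover have "v ^ (n - j) * (v ^ d * ?W) = v ^ (n - j)" by (simp only: v(2) mult_1_right)
          ultimately show ?thesis using \<open>v ^ (n - j) * (v ^ d * ?W) \<le> v ^ (n - j) * (v ^ j * ?W)\<close> by argo
        qed
        then show "C * v ^ (n - j) \<le> ?W * (C * v ^ n)"
          using C(1) by (simp add: mult.left_commute)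
      qed (use C v in simp)
      finally have "C * (C * ?y ^ (r ^ j)) \<le> ?W ^ (r ^ n) * (C * v ^ n) ^ (r ^ n)"
        by (simp add: power_mult_distrib mult.assoc)
      then have "C * ?y ^ (r ^ j) \<le> ?B"
        using C(1) by (subst pos_le_divide_eq) (simp_all only: mult.commute)
      moreover have "absv (A j $ k $ m * (e (n - j) $ m $ l) ^ (r ^ j)) \<le> C * ?y ^ (r ^ j)"
        unfolding absv_mult absv_power using C(2) by (intro mult_right_mono) auto
      ultimately show ?thesis by linarith
    qed (use A B0 in simp)
    have "absv (\<Sum>j\<in>{1..n}. \<Sum>m\<in>UNIV. A j $ k $ m * (e (n - j) $ m $ l) ^ (r ^ j)) \<le> ?B"
      by (intro absv_sum_le term_le B0)
    then have "absv (e n $ k $ l) \<le> inverse (?W ^ (r ^ n)) * ?B"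
      unfolding en absv_mult absv_inverse absv_power_r_diff(1)[OF w False[unfolded neq0_conv]]
      using w by (intro mult_left_mono) auto
    also have "\<dots> = (C * v ^ n) ^ (r ^ n) / C"
    proof -
      have "w \<noteq> 0" using w by auto
      then have "?W ^ (r ^ n) \<noteq> 0" by simp
      then show ?thesis by simp
    qed
    finally show ?thesis
      using C(1) by (subst (asm) pos_le_divide_eq) (simp_all only: mult.commute)
  qed
qed

text \<open>
  Eventually \<open>C |x| v ^ n \<le> 1/2\<close>, for any given argument \<open>x\<close>.
\<close>

lemma tau_converges_of_bound:
  fixes e :: "('c, 't::finite) tau_series"
  assumes C: "C \<ge> 1" and v: "0 < v" "v < 1"
    and e: "\<And>n k l. C * absv (e n $ k $ l) \<le> (C * v ^ n) ^ (r ^ n)"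
  shows "tau_converges r e z"
proof -
  have summ: "summable (\<lambda>n. e n $ k $ l * x ^ (r ^ n))" for k l x
  proof (rule summable_absv)
    let ?u = "\<lambda>n. C * absv x * v ^ n"
    have "?u \<longlonglongrightarrow> C * absv x * 0"
      using v by (intro tendsto_mult_left LIMSEQ_realpow_zero) auto
    then have "eventually (\<lambda>n. ?u n < 1 / 2) sequentially"
      by (intro order_tendstoD(2)) auto
    then have ev: "eventually (\<lambda>n. absv (e n $ k $ l * x ^ (r ^ n)) \<le> (1 / 2) ^ n) sequentially"
    proof eventually_elim
      case (elim n)
      have "absv (e n $ k $ l) \<le> C * absv (e n $ k $ l)"
        using mult_right_mono[OF C, of "absv (e n $ k $ l)"] by simp
      also have "\<dots> \<le> (C * v ^ n) ^ (r ^ n)" by (rule e)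
      finally have "absv (e n $ k $ l * x ^ (r ^ n)) \<le> (C * v ^ n) ^ (r ^ n) * absv x ^ (r ^ n)"
        unfolding absv_mult absv_power by (intro mult_right_mono) auto
      also have "\<dots> = ?u n ^ (r ^ n)" by (simp add: power_mult_distrib algebra_simps)
      also have "\<dots> \<le> (1 / 2) ^ (r ^ n)"
        using elim C v by (intro power_mono) auto
      also have "\<dots> \<le> (1 / 2) ^ n"
      proof (rule power_decreasing)
        have "n < 2 ^ n" by (rule less_exp)
        also have "\<dots> \<le> r ^ n" using two_le_r by (intro power_mono) auto
        finally show "n \<le> r ^ n" by simp
      qed auto
      finally show ?case .
    qed
    have half: "(\<lambda>n. (1 / 2 :: real) ^ n) \<longlonglongrightarrow> 0" by (intro LIMSEQ_realpow_zero) auto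
    show "(\<lambda>n. absv (e n $ k $ l * x ^ (r ^ n))) \<longlonglongrightarrow> 0"
      by (rule tendsto_sandwich[OF _ ev tendsto_const half]) simp
  qed
  have "(\<lambda>n. e n *v frob_vec r n z) sums (\<chi> k. \<Sum>l\<in>UNIV. suminf (\<lambda>n. e n $ k $ l * (z $ l) ^ (r ^ n)))"
    unfolding sums_vec_iff
  proof
    fix k
    have "(\<lambda>n. \<Sum>l\<in>UNIV. e n $ k $ l * (z $ l) ^ (r ^ n)) sums
        (\<Sum>l\<in>UNIV. suminf (\<lambda>n. e n $ k $ l * (z $ l) ^ (r ^ n)))"
      by (intro sums_sum_absv summable_sums summ)
    then show "(\<lambda>n. (e n *v frob_vec r n z) $ k) sums
        ((\<chi> k. \<Sum>l\<in>UNIV. suminf (\<lambda>n. e n $ k $ l * (z $ l) ^ (r ^ n))) $ k)"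
      by (simp add: matrix_vector_mult_def frob_vec_def)
  qed
  then show ?thesis unfolding tau_converges_def by (rule sums_summable)
qed

lemma finite_support_bounds:
  fixes A :: "('c, 't::finite) tau_series"
  assumes fin: "finite {i. A i \<noteq> 0}"
  shows "\<exists>C d. 1 \<le> C \<and> (\<forall>j k l. absv (A j $ k $ l) \<le> C) \<and> 0 < d \<and> (\<forall>j>d. A j = 0)"
proof -
  obtain d where d: "\<And>i. A i \<noteq> 0 \<Longrightarrow> i \<le> d"
    using finite_nat_set_iff_bounded_le fin by auto
  let ?V = "(\<lambda>(j, k, l). absv (A j $ k $ l)) ` ({..d} \<times> UNIV \<times> UNIV)"
  let ?C = "Max (insert 1 ?V)"
  have "absv (A j $ k $ l) \<le> ?C" for j k l
  proof (cases "j \<le> d")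
    case True
    then have "absv (A j $ k $ l) \<in> ?V" by (intro image_eqI[of _ _ "(j, k, l)"]) auto
    then show ?thesis by (intro Max_ge) auto
  next
    case False
    then have "A j = 0" using d by blast
    moreover have "1 \<le> ?C" by (intro Max_ge) auto
    ultimately show ?thesis by simp
  qed
  moreover have "1 \<le> ?C" by (intro Max_ge) auto
  moreover have "A j = 0" if "j > Suc d" for j using d[of j] that by auto
  ultimately show ?thesis by (intro exI[of _ ?C] exI[of _ "Suc d"]) simp
qed

text \<open>
  Let \<open>e\<close> be the solution of \<open>e w = E a0 e\<close>. For any \<open>b\<close>, both \<open>E b e\<close> and \<open>e E\<^sub>b\<^sub>,\<^sub>*\<close> intertwine \<open>w\<close> with
  \<open>E a0\<close> and have the same constant term, so they agree. Conversely, the functional equation for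
  values implies the one for series, because an everywhere convergent series is determined by its
  values.
\<close>

lemma ex_exponential:
  fixes E :: "'q::{field,finite} poly \<Rightarrow> ('c, 't::finite) tau_series"
  assumes r: "CARD('q) = r" and fin: "\<And>a. finite {i. E a i \<noteq> 0}"
    and mult: "\<And>a b. tau_comp r (E a) (E b) = E (a * b)"
    and w: "tangent (E a0) = mat w" "1 < absv w"
  shows "\<exists>!e. is_exponential E e"
    and "is_exponential E e \<Longrightarrow>
      tau_comp r e (tau_const (tangent (E a))) = tau_comp r (E a) e"
proof -
  let ?A = "E a0"
  let ?e = "tau_recursion r (\<lambda>n. inverse (w ^ (r ^ n) - w)) ?A"
  have A0: "?A 0 = mat w" using w(1) by (simp add: tangent_def)
  note ne = absv_power_r_diff(2)[OF w(2)]
  have e0: "?e 0 = mat 1" by (subst tau_recursion.simps) simp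
  have inter: "tau_comp r ?e (tau_const (mat w)) = tau_comp r ?A ?e"
    by (rule tau_recursion_intertwines[of ?A, OF A0 ne])
  have all: "tau_comp r ?e (tau_const (tangent (E b))) = tau_comp r (E b) ?e" for b
  proof (rule intertwiner_unique[of ?A, OF A0 ne])
    show "tau_comp r (tau_comp r ?e (tau_const (tangent (E b)))) (tau_const (mat w)) =
        tau_comp r ?A (tau_comp r ?e (tau_const (tangent (E b))))"
      by (simp only: tau_comp_assoc tau_comp_const_const mat_commute[symmetric])
        (simp only: tau_comp_const_const[symmetric] tau_comp_assoc[symmetric] inter)
    show "tau_comp r (tau_comp r (E b) ?e) (tau_const (mat w)) = tau_comp r ?A (tau_comp r (E b) ?e)"
      by (simp only: tau_comp_assoc inter) (simp only: tau_comp_assoc[symmetric] mult mult.commute)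
    show "tau_comp r ?e (tau_const (tangent (E b))) 0 = tau_comp r (E b) ?e 0"
      using e0 tangent_comp[of ?e "tau_const (tangent (E b))"] tangent_comp[of "E b" ?e]
      by (simp add: tangent_def tau_const_def)
  qed simp
  have conv: "tau_converges r ?e z" for z
  proof -
    obtain C d where C: "C \<ge> 1" "\<And>j k l. absv (?A j $ k $ l) \<le> C" "d > 0" "\<And>j. j > d \<Longrightarrow> ?A j = 0"
      using finite_support_bounds[OF fin[of a0]] by auto
    let ?v = "root d (1 / absv w)"
    have "w \<noteq> 0" using w(2) by auto
    then have v: "0 < ?v" "?v < 1" "?v ^ d * absv w = 1" using C(3) w(2) by simp_all
    show ?thesis
      by (rule tau_converges_of_bound[OF C(1) v(1,2) tau_recursion_bound[OF C(1,2,4) w(2) v(1,3)]])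
  qed
  have comp_sums: "(\<lambda>n. tau_comp r (E a) g n *v frob_vec r n z) sums tau_eval r (E a) (tau_eval r g z)"
    if "\<And>z. tau_converges r g z" for a g z
  proof -
    obtain d where "\<And>j. j > d \<Longrightarrow> E a j = 0"
      using finite_support_bounds[OF fin[of a]] by auto
    then show ?thesis by (rule tau_comp_finite_sums[OF _ that])
  qed
  have const_sums: "(\<lambda>n. tau_comp r g (tau_const M) n *v frob_vec r n z) sums tau_eval r g (M *v z)"
    if "\<And>z. tau_converges r g z" for g :: "('c, 't) tau_series" and M z
    unfolding tau_comp_const_term by (rule tau_converges_sums[OF that])
  have exp: "is_exponential E ?e"
    unfolding is_exponential_def r
  proof (intro conjI allI)
    fix a z
    show "tau_eval r ?e (tangent (E a) *v z) = tau_eval r (E a) (tau_eval r ?e z)"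
      by (rule sums_unique2[OF const_sums[OF conv] comp_sums[OF conv, of a z, folded all]])
  qed (fact e0 conv)+
  have uniq: "f = ?e" if f: "is_exponential E f" for f
  proof -
    have f': "f 0 = mat 1" "\<And>z. tau_converges r f z"
      "\<And>a z. tau_eval r f (tangent (E a) *v z) = tau_eval r (E a) (tau_eval r f z)"
      using f by (simp_all add: is_exponential_def r)
    have "tau_comp r f (tau_const (mat w)) = tau_comp r ?A f"
    proof (rule tau_eval_inject)
      fix z
      show "(\<lambda>n. tau_comp r ?A f n *v frob_vec r n z) sums tau_eval r ?A (tau_eval r f z)"
        by (rule comp_sums[OF f'(2)])
      show "(\<lambda>n. tau_comp r f (tau_const (mat w)) n *v frob_vec r n z) sums tau_eval r ?A (tau_eval r f z)"
        using const_sums[OF f'(2), of "mat w" z] f'(3)[of a0 z] w(1) by simp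
    qed
    then show ?thesis
      by (intro intertwiner_unique[of ?A, OF A0 ne _ inter]) (simp_all add: f'(1) e0)
  qed
  show "\<exists>!e. is_exponential E e" using exp uniq by blast
  show "tau_comp r e (tau_const (tangent (E a))) = tau_comp r (E a) e" if "is_exponential E e"
    using uniq[OF that] all by simp
qed

end

section \<open>Extension of the action to multi-valued operators\<close>

lemma poly_to_fls_pCons: "poly_to_fls (pCons a p) = fls_const a + T_infty * poly_to_fls p"
  and poly_to_fls_0: "poly_to_fls 0 = 0"
  by (simp_all add: poly_to_fls_def map_poly_pCons)

theorem theorem2:
  fixes \<iota>\<^sub>o :: "'q::{field,finite} fls alg_closure \<Rightarrow> 'b::{field,complete_space}"
    and \<iota>\<^sub>s :: "'q fls alg_closure \<Rightarrow> 'c::{field,complete_space}"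
    and \<theta> :: "'b \<Rightarrow> 'c"
    and E :: "'q poly \<Rightarrow> ('c, 't::finite) tau_series"
  assumes "completed_alg_closure \<iota>\<^sub>o"
    and "completed_alg_closure \<iota>\<^sub>s"
    and "canonical_iso \<iota>\<^sub>o \<iota>\<^sub>s \<theta>"
    and "T_module \<iota>\<^sub>s E"
    and "uniformizable E"
  shows "\<exists>!F. F \<in> K_sep \<iota>\<^sub>o \<rightarrow>\<^sub>E multivalued_operators E \<and>
           tau_algebra_hom (const_infty \<iota>\<^sub>o) (const_infty \<iota>\<^sub>s) (K_sep \<iota>\<^sub>o) F \<and>
           inj_on F (K_sep \<iota>\<^sub>o) \<and>
           (\<forall>a. F (\<iota>\<^sub>o (to_ac (poly_to_fls a))) = E a) \<and>
           (\<forall>x\<in>K_sep \<iota>\<^sub>o. \<exists>N. nilpotent_mat N \<and> tangent (F x) = mat (\<theta> x) + N)"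
proof -
  let ?r = "CARD('q)"
  let ?\<kappa> = "const_infty \<iota>\<^sub>s"
  let ?T = "T_infty :: 'q fls"
  have embo: "field_embedding \<iota>\<^sub>o" and embs: "field_embedding \<iota>\<^sub>s"
    using assms(1,2) by (auto simp: completed_alg_closure_def)
  note io = field_embedding_simps[OF embo] and iS = field_embedding_simps[OF embs]
  have theta: "\<theta> (\<iota>\<^sub>o y) = \<iota>\<^sub>s y" for y using assms(3) by (simp add: canonical_iso_def)
  have p: "Factorial_Ring.prime CHAR('q fls)"
    using prime_CHAR_finite_field[where 'q='q] by simp
  have Ch: "CHAR('c) = CHAR('q fls)" using CHAR_field_embedding[OF embs] by simp
  then have pc: "Factorial_Ring.prime CHAR('c)" using p by simp
  obtain m where m: "?r = CHAR('c) ^ m" using CARD_finite_field[where 'q='q] Ch by auto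
  have r2: "2 \<le> ?r"
    using card_mono[of "UNIV :: 'q set" "{0, 1}"] by simp

  have dist_s: "\<And>x y :: 'c. dist x y = dist (x - y) 0"
      "\<And>x y :: 'c. dist (x * y) 0 = dist x 0 * dist y 0"
      "\<And>x y :: 'c. dist (x + y) 0 \<le> max (dist x 0) (dist y 0)"
      "\<And>x. dist (\<iota>\<^sub>s (to_ac x)) 0 = abs_infty x"
    using assms(2) by (auto simp: completed_alg_closure_def)
  interpret ultrametric_frobenius_field "?r" "TYPE('c)"
  proof
    show "2 \<le> ?r" by (rule r2)
    show "(x + y) ^ ?r = x ^ ?r + y ^ ?r" for x y :: 'c
      unfolding m by (rule power_CHAR_add[OF pc])
    have "dist (\<iota>\<^sub>s (to_ac fls_X)) 0 = 1 / real ?r"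
      by (simp add: dist_s(4) abs_infty_def power_int_minus inverse_eq_divide)
    then show "\<exists>t :: 'c. 0 < dist t 0 \<and> dist t 0 < 1"
      using r2 by (intro exI[of _ "\<iota>\<^sub>s (to_ac fls_X)"]) simp
  qed (fact dist_s)+

  define Q where "Q = ?r ^ CARD('t)"
  have "CARD('t) < 2 ^ CARD('t)" by (rule less_exp)
  also have "\<dots> \<le> Q" unfolding Q_def using r2 by (intro power_mono) auto
  finally have cardQ: "CARD('t) \<le> Q" by simp
  have Qc: "Q = CHAR('c) ^ (m * CARD('t))" unfolding Q_def m by (simp add: power_mult)
  then have Qk: "Q = CHAR('q fls) ^ (m * CARD('t))" by (simp add: Ch)
  have Q0: "Q > 0" unfolding Q_def by simp
  have basis: "power_basis ?T Q" by (rule power_basis_T_infty[OF Q_def])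

  have fin: "\<And>a. finite {i. E a i \<noteq> 0}"
    and homE: "tau_algebra_hom (\<lambda>c. [:c:]) ?\<kappa> UNIV E"
    using assms(4) by (auto simp: T_module_def)
  obtain N where N: "nilpotent_mat N" "tangent (E [:0, 1:]) = mat (\<iota>\<^sub>s (to_ac ?T)) + N"
    using assms(4) by (auto simp: T_module_def)
  have E1: "E 1 = tau_const (mat 1)" and Eadd: "\<And>a b. E (a + b) = tau_add (E a) (E b)"
    and Emult: "\<And>a b. E (a * b) = tau_comp ?r (E a) (E b)"
    and Econst: "\<And>c a. E ([:c:] * a) = tau_comp ?r (tau_const (mat (?\<kappa> c))) (E a)"
    using homE unfolding tau_algebra_hom_def by blast+
  have Ec: "E [:c:] = tau_const (mat (?\<kappa> c))" for c
    using Econst[of c 1] by (simp add: E1 tau_comp_one)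
  have tE: "tangent (E (a * b)) = tangent (E a) ** tangent (E b)" 
      "tangent (E (a + b)) = tangent (E a) + tangent (E b)" for a b
    by (simp_all only: Emult tangent_comp) (simp add: Eadd tau_add_def tangent_def)
  have t_const: "tangent (tau_const M) = M" for M :: "'c^'t^'t"
    by (simp add: tangent_def tau_const_def)
  have tEpow: "tangent (E (a ^ n)) = mat_pow (tangent (E a)) n" for a n
    by (induction n) (simp_all add: tE mat_pow_Suc E1 t_const)
  \<comment> \<open>The exponent \<open>Q\<close> kills the nilpotent part, so \<open>T ^ Q\<close> acts on the tangent space by a scalar.\<close>
  have tT: "tangent (E ([:0, 1:] ^ Q)) = mat (\<iota>\<^sub>s (to_ac ?T) ^ Q)"
    unfolding tEpow N(2) by (rule scalar_plus_nilpotent_power(2)[OF pc Qc cardQ N(1)])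
  have "absv (\<iota>\<^sub>s (to_ac ?T)) = real ?r"
    by (simp add: absv_def dist_s(4) abs_infty_def T_infty_def)
  then have big: "1 < absv (\<iota>\<^sub>s (to_ac ?T) ^ Q)"
    using r2 Q0 by (simp add: absv_power one_less_power)

  define e where "e = exponential E"
  define l where "l = logarithm E"
  have "is_exponential E e"
    unfolding e_def exponential_def
    by (rule theI'[OF ex_exponential(1)[OF refl fin Emult[symmetric] tT big]])
  then have e0: "e 0 = mat 1"
    and eE: "\<And>a. tau_comp ?r e (tau_const (tangent (E a))) = tau_comp ?r (E a) e"
    using ex_exponential(2)[OF refl fin Emult[symmetric] tT big] by (auto simp: is_exponential_def)
  \<comment> \<open>The definite descriptions of \<open>e\<close> and \<open>l\<close> denote the series just constructed.\<close>
  have el: "tau_comp ?r e l = tau_const (mat 1)" and le: "tau_comp ?r l e = tau_const (mat 1)"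
    using theI'[OF ex1_tau_inverse[of e, OF e0]]
    by (simp_all add: l_def logarithm_def e_def[symmetric])
  have l0: "tangent l = mat 1"
    using tangent_comp[of e l] el e0 by (simp add: tangent_def tau_const_def)

  define op where "op M = tau_comp ?r e (tau_comp ?r (tau_const M) l)" for M :: "'c^'t^'t"
  have op_tangent: "tangent (op M) = M" for M
    unfolding op_def tangent_comp l0 using e0 by (simp add: tangent_def tau_const_def)
  have op_add: "op (M + M') = tau_add (op M) (op M')" for M M'
    by (simp only: op_def tau_add_const[symmetric] tau_comp_add_left tau_comp_add_right)
  have op_mult: "op (M ** M') = tau_comp ?r (op M) (op M')" for M M'
  proof -
    have "tau_comp ?r (op M) (op M') =
        tau_comp ?r e (tau_comp ?r (tau_const M) (tau_comp ?r (tau_comp ?r l e) (tau_comp ?r (tau_const M') l)))"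
      by (simp only: op_def tau_comp_assoc)
    also have "\<dots> = op (M ** M')"
      by (simp only: le tau_comp_one op_def tau_comp_const_const[symmetric] tau_comp_assoc)
    finally show ?thesis by simp
  qed
  have op_E: "op (tangent (E a)) = E a" for a
  proof -
    have "op (tangent (E a)) = tau_comp ?r (tau_comp ?r e (tau_const (tangent (E a)))) l"
      by (simp only: op_def tau_comp_assoc)
    also have "\<dots> = E a" by (simp only: eE tau_comp_assoc el tau_comp_one)
    finally show ?thesis .
  qed
  have mv: "f \<in> multivalued_operators E \<longleftrightarrow> f = op (tangent f)" for f
    unfolding multivalued_operators_def e_def[symmetric] l_def[symmetric] op_def[symmetric]
    by (auto simp: op_tangent)
  have op_const: "op (mat (?\<kappa> c)) = tau_const (mat (?\<kappa> c))" for c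
    using op_E[of "[:c:]"] by (simp add: Ec t_const)

  \<comment> \<open>Constants are \<open>Q\<close>-th powers of themselves, so the extension acts on them by scalars.\<close>
  have cQ: "to_ac (fls_const c) ^ Q = to_ac (fls_const c)" for c :: 'q
  proof -
    have "c ^ (?r ^ n) = c" for n by (induction n) (simp_all add: power_mult finite_field_power_card)
    then have "fls_const c ^ Q = fls_const c" by (simp only: Q_def fls_const_power[symmetric])
    then show ?thesis by (simp only: to_ac_power[symmetric])
  qed
  have sep: "separable_element (to_ac c)" for c :: "'q fls" by (rule separable_to_ac[OF p])

  let ?P = "\<lambda>F. F \<in> K_sep \<iota>\<^sub>o \<rightarrow>\<^sub>E multivalued_operators E \<and>
           tau_algebra_hom (const_infty \<iota>\<^sub>o) (const_infty \<iota>\<^sub>s) (K_sep \<iota>\<^sub>o) F \<and>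
           inj_on F (K_sep \<iota>\<^sub>o) \<and>
           (\<forall>a. F (\<iota>\<^sub>o (to_ac (poly_to_fls a))) = E a) \<and>
           (\<forall>x\<in>K_sep \<iota>\<^sub>o. \<exists>N. nilpotent_mat N \<and> tangent (F x) = mat (\<theta> x) + N)"
  have Ksep: "\<iota>\<^sub>o y \<in> K_sep \<iota>\<^sub>o \<longleftrightarrow> separable_element y" for y
    by (auto simp: K_sep_def io)

  obtain D where D: "tangent_extension \<iota>\<^sub>s ?T (tangent (E [:0, 1:])) D"
    using ex_tangent_extension[OF p Qk basis embs N(1) cardQ] N(2) by auto
  note D' = tangent_extensionD[OF D]
  have Dc: "D (to_ac (fls_const c)) = mat (?\<kappa> c)" for c
    using tangent_extension_power(2)[OF p Qc cardQ embs D sep, of "fls_const c"] by (simp add: cQ iS(7)[symmetric])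
  have Dpoly: "D (to_ac (poly_to_fls a)) = tangent (E a)" for a
  proof (induction a)
    case 0
    have "tangent (E 0) = 0" using tE(2)[of 0 0] by simp
    moreover have "D 0 = 0" using D'(3)[OF sep sep, of 0 0] by simp
    ultimately show ?case by (simp add: poly_to_fls_0)
  next
    case (pCons c a)
    have "pCons c a = [:c:] + [:0, 1:] * a" by simp
    then have "tangent (E (pCons c a)) = tangent (E [:c:]) + tangent (E [:0, 1:]) ** tangent (E a)"
      by (simp only: tE)
    also have "\<dots> = mat (?\<kappa> c) + D (to_ac ?T) ** D (to_ac (poly_to_fls a))"
      by (simp only: pCons.IH D'(2)) (simp add: Ec t_const)
    also have "\<dots> = D (to_ac (poly_to_fls (pCons c a)))"
      using D'(3)[OF sep sep, of "fls_const c" "?T * poly_to_fls a"] D'(4)[OF sep sep, of ?T "poly_to_fls a"]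
      by (simp add: poly_to_fls_pCons Dc)
    finally show ?case by simp
  qed

  define F where "F = restrict (\<lambda>x. op (D (inv_into UNIV \<iota>\<^sub>o x))) (K_sep \<iota>\<^sub>o)"
  have inj: "inj \<iota>\<^sub>o" by (simp add: inj_on_def io)
  have F: "F (\<iota>\<^sub>o y) = op (D y)" if "separable_element y" for y
    using that by (simp add: F_def Ksep inv_f_f[OF inj])
  show ?thesis
  proof (rule ex1I)
    show "?P F"
    proof (intro conjI allI ballI)
      show "F \<in> K_sep \<iota>\<^sub>o \<rightarrow>\<^sub>E multivalued_operators E"
        by (auto simp: F_def mv op_tangent)
      show "F (\<iota>\<^sub>o (to_ac (poly_to_fls a))) = E a" for a
        by (simp add: F[OF sep] Dpoly op_E)
      show "inj_on F (K_sep \<iota>\<^sub>o)"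
      proof (rule inj_onI)
        fix x' y' assume "x' \<in> K_sep \<iota>\<^sub>o" "y' \<in> K_sep \<iota>\<^sub>o" and eq: "F x' = F y'"
        then obtain x y where xy: "x' = \<iota>\<^sub>o x" "y' = \<iota>\<^sub>o y" "separable_element x" "separable_element y"
          by (auto simp: K_sep_def)
        note pow = tangent_extension_power(1)[OF p Qc cardQ embs D]
        have "D x = D y"
          using arg_cong[OF eq, of tangent] by (simp add: xy F op_tangent)
        then have "\<iota>\<^sub>s x ^ Q = \<iota>\<^sub>s y ^ Q"
          using pow[OF xy(3)] pow[OF xy(4)] by (simp add: mat_eq_iff)
        then have "\<iota>\<^sub>s x = \<iota>\<^sub>s y" unfolding Qc by (rule inj_power_CHAR[OF pc])
        then show "x' = y'" by (simp add: xy iS)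
      qed
      show "tau_algebra_hom (const_infty \<iota>\<^sub>o) (const_infty \<iota>\<^sub>s) (K_sep \<iota>\<^sub>o) F"
        unfolding tau_algebra_hom_def
      proof (intro conjI allI ballI)
        have "op (mat 1) = tau_const (mat 1)" using op_const[of 1] by (simp add: iS)
        then show "F 1 = tau_const (mat 1)"
          using F[OF sep, of 1] by (simp add: io D'(1))
        fix x' assume "x' \<in> K_sep \<iota>\<^sub>o"
        then obtain x where x: "x' = \<iota>\<^sub>o x" "separable_element x" by (auto simp: K_sep_def)
        show "F (const_infty \<iota>\<^sub>o c * x') = tau_comp ?r (tau_const (mat (?\<kappa> c))) (F x')" for c
        proof -
          have "F (const_infty \<iota>\<^sub>o c * x') = op (D (to_ac (fls_const c) * x))"
            using F[OF separable_closed(3)[OF p x(2) x(2)], of "fls_const c"] by (simp add: x(1) io)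
          also have "\<dots> = tau_comp ?r (op (mat (?\<kappa> c))) (op (D x))"
            by (simp only: D'(4)[OF sep x(2)] op_mult Dc)
          finally show ?thesis by (simp add: op_const x F)
        qed
        fix y' assume "y' \<in> K_sep \<iota>\<^sub>o"
        then obtain y where y: "y' = \<iota>\<^sub>o y" "separable_element y" by (auto simp: K_sep_def)
        have "F (\<iota>\<^sub>o (x + y)) = op (D x + D y)" "F (\<iota>\<^sub>o (x * y)) = op (D x ** D y)"
          using F[OF separable_closed(1)[OF p x(2) y(2)]] F[OF separable_closed(2)[OF p x(2) y(2)]]
          by (simp_all only: D'(3,4)[OF x(2) y(2)])
        then show "F (x' + y') = tau_add (F x') (F y')" "F (x' * y') = tau_comp ?r (F x') (F y')"
          by (simp_all add: x y io F op_add op_mult)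
      qed
      fix x' assume "x' \<in> K_sep \<iota>\<^sub>o"
      then obtain x where x: "x' = \<iota>\<^sub>o x" "separable_element x" by (auto simp: K_sep_def)
      show "\<exists>N. nilpotent_mat N \<and> tangent (F x') = mat (\<theta> x') + N"
        using D'(5)[OF x(2)] by (simp add: x F op_tangent theta)
    qed
    fix G assume G: "?P G"
    have ext: "tangent_extension \<iota>\<^sub>s ?T (tangent (E [:0, 1:])) (\<lambda>y. tangent (H (\<iota>\<^sub>o y)))"
      if H: "?P H" for H
      unfolding tangent_extension_def
    proof (intro conjI allI impI)
      have H1: "H 1 = tau_const (mat 1)"
        and Hadd: "\<And>x y. x \<in> K_sep \<iota>\<^sub>o \<Longrightarrow> y \<in> K_sep \<iota>\<^sub>o \<Longrightarrow> H (x + y) = tau_add (H x) (H y)"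
        and Hmult: "\<And>x y. x \<in> K_sep \<iota>\<^sub>o \<Longrightarrow> y \<in> K_sep \<iota>\<^sub>o \<Longrightarrow> H (x * y) = tau_comp ?r (H x) (H y)"
        and HE: "\<And>a. H (\<iota>\<^sub>o (to_ac (poly_to_fls a))) = E a"
        and HN: "\<And>x. x \<in> K_sep \<iota>\<^sub>o \<Longrightarrow> \<exists>N. nilpotent_mat N \<and> tangent (H x) = mat (\<theta> x) + N"
        using H unfolding tau_algebra_hom_def by blast+
      show "tangent (H (\<iota>\<^sub>o 1)) = mat 1" by (simp add: io H1 t_const)
      show "tangent (H (\<iota>\<^sub>o (to_ac ?T))) = tangent (E [:0, 1:])"
        using HE[of "[:0, 1:]"] by (simp add: poly_to_fls_pCons poly_to_fls_0)
      fix x :: "'q fls alg_closure" assume x: "separable_element x"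
      show "\<exists>N. nilpotent_mat N \<and> tangent (H (\<iota>\<^sub>o x)) = mat (\<iota>\<^sub>s x) + N"
        using HN[of "\<iota>\<^sub>o x"] x by (simp add: Ksep theta)
      fix y :: "'q fls alg_closure" assume y: "separable_element y"
      show "tangent (H (\<iota>\<^sub>o (x + y))) = tangent (H (\<iota>\<^sub>o x)) + tangent (H (\<iota>\<^sub>o y))"
        using Hadd[of "\<iota>\<^sub>o x" "\<iota>\<^sub>o y"] x y by (simp add: Ksep io tangent_def tau_add_def)
      show "tangent (H (\<iota>\<^sub>o (x * y))) = tangent (H (\<iota>\<^sub>o x)) ** tangent (H (\<iota>\<^sub>o y))"
        using Hmult[of "\<iota>\<^sub>o x" "\<iota>\<^sub>o y"] x y by (simp add: Ksep io tangent_comp)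
    qed
    have same: "tangent (G (\<iota>\<^sub>o y)) = tangent (F (\<iota>\<^sub>o y))" if "separable_element y" for y
      by (rule tangent_extension_unique[OF p Qk basis embs cardQ ext[OF G] ext[OF \<open>?P F\<close>] that])
    have GF: "G \<in> K_sep \<iota>\<^sub>o \<rightarrow>\<^sub>E multivalued_operators E" "F \<in> K_sep \<iota>\<^sub>o \<rightarrow>\<^sub>E multivalued_operators E"
      using G \<open>?P F\<close> by blast+
    show "G = F"
    proof (rule PiE_ext[OF GF])
      fix x' assume x': "x' \<in> K_sep \<iota>\<^sub>o"
      then obtain x where x: "x' = \<iota>\<^sub>o x" "separable_element x" by (auto simp: K_sep_def)
      have "G x' = op (tangent (G x'))" "F x' = op (tangent (F x'))"
        using PiE_mem[OF GF(1) x'] PiE_mem[OF GF(2) x'] by (simp_all only: mv)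
      then show "G x' = F x'" using same[OF x(2)] x(1) by metis
    qed
  qed
qed

end
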